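(* Let $\Omega\subset\mathbb{R}^n$ be open. For $j=1,2$ let $\rho_j:\mathbb{R}^n\to[0,\infty]$ be radial with $\rho_j(x)<\infty$ for all $x\neq0$, $\rho_j\in L^1_{\mathrm{loc}}(\mathbb{R}^n)$, $\int_{\mathbb{R}^n}\min\{1,|x|^{-1}\}\rho_j(x)\,dx<\infty$, and $\inf_{B_{\varepsilon_j}}\rho_j>0$ for some $\varepsilon_j>0$. Assume that $(\rho_1-\rho_2)/|\cdot|\in L^1(\mathbb{R}^n)$. Then the following two statements hold. (i) Let $p\in[1,\infty]$. Then $H^{\rho_1,p}_0(\Omega)=H^{\rho_2,p}_0(\Omega)$ with equivalent norms. (ii) Let $p\in(1,\infty)$ and assume that $\Omega$ is bounded. If there is a $C_1>0$ such that for all $u\in H^{\rho_1,p}_0(\Omega)$ $$\|u\|_{L^p(\Omega)}\leq C_1\|D_{\rho_1}u\|_{L^p(\mathbb{R}^n,\mathbb{R}^n)},$$ then there is a $C_2>0$ such that for all $u\in H^{\rho_2,p}_0(\Omega)$ $$\|u\|_{L^p(\Omega)}\leq C_2\|D_{\rho_2}u\|_{L^p(\mathbb{R}^n,\mathbb{R}^n)}.$$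
   Context: Here $n\in\mathbb{N}$, $n\ge1$, $B_r$ is the open ball of radius $r$ centred at $0$, and radial means $\rho(x)=\overline{\rho}(|x|)$ for a function $\overline\rho$ on $[0,\infty)$. For a kernel $\rho$ as in the claim and $\Phi\in C_c^\infty(\mathbb{R}^n,\mathbb{R}^n)$ the nonlocal divergence is $$\operatorname{div}_\rho\Phi(x)=\int_{\mathbb{R}^n}\frac{\Phi(x)-\Phi(y)}{|x-y|}\cdot\frac{x-y}{|x-y|}\rho(x-y)\,dy.$$ For $u\in L^1(\mathbb{R}^n)+L^\infty(\mathbb{R}^n)$ the weak nonlocal gradient $D_\rho u$ is the distribution $\langle D_\rho u,\Phi\rangle=-\int_{\mathbb{R}^n}u\,\operatorname{div}_\rho\Phi\,dx$, $\Phi\in C_c^\infty(\mathbb{R}^n,\mathbb{R}^n)$. For $p\in[1,\infty]$, $H^{\rho,p}(\mathbb{R}^n)$ is the set of (real-valued) $u\in L^p(\mathbb{R}^n)$ with $D_\rho u\in L^p(\mathbb{R}^n,\mathbb{R}^n)$, with norm $\left(\|u\|_{L^p}^p+\|D_\rho u\|_{L^p}^p\right)^{1/p}$ for $p<\infty$ and $\max\{\|u\|_{L^\infty},\|D_\rho u\|_{L^\infty}\}$ for $p=\infty$. For $\Omega$ open, $H^{\rho,p}_0(\Omega)=\{u\in H^{\rho,p}(\mathbb{R}^n): u=0\text{ a.e. in }\Omega^c\}$ with the same norm. *)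

theory Defs
  imports "HOL-Analysis.Analysis" "HOL-Probability.Essential_Supremum"
begin

text \<open>Elements of the spaces below are functions rather than classes modulo equality almost
  everywhere. All spaces are closed under modification on null sets, and all norms are invariant
  under it. Exponents range over \<open>[1, \<infinity>]\<close>, as elements of \<^typ>\<open>ennreal\<close>.\<close>

definition Lp_space :: "'a measure \<Rightarrow> ennreal \<Rightarrow> ('a \<Rightarrow> 'b::euclidean_space) set" where
  "Lp_space M p = {f \<in> borel_measurable M.
     if p = \<infinity> then esssup M (\<lambda>x. ennreal (norm (f x))) < \<infinity>
     else integrable M (\<lambda>x. norm (f x) powr enn2real p)}"

definition Lp_norm :: "'a measure \<Rightarrow> ennreal \<Rightarrow> ('a \<Rightarrow> 'b::euclidean_space) \<Rightarrow> real" where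
  "Lp_norm M p f =
     (if p = \<infinity> then enn2real (esssup M (\<lambda>x. ennreal (norm (f x))))
      else (\<integral>x. norm (f x) powr enn2real p \<partial>M) powr (1 / enn2real p))"

text \<open>\<open>C\<^sup>k\<close> on the whole space, via directional derivatives: for \<open>k \<ge> 1\<close>, \<open>f\<close> is
  differentiable and all its directional derivatives are \<open>C\<^sup>k\<^sup>-\<^sup>1\<close>.\<close>

primrec Ck :: "nat \<Rightarrow> ('a::euclidean_space \<Rightarrow> 'b::euclidean_space) \<Rightarrow> bool" where
  "Ck 0 f \<longleftrightarrow> continuous_on UNIV f"
| "Ck (Suc k) f \<longleftrightarrow> (\<forall>x. f differentiable (at x)) \<and>
     (\<forall>v. Ck k (\<lambda>x. frechet_derivative f (at x) v))"

definition test_fields :: "('a::euclidean_space \<Rightarrow> 'a) set" where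
  "test_fields = {\<Phi>. (\<forall>k. Ck k \<Phi>) \<and> compact (closure {x. \<Phi> x \<noteq> 0})}"

definition radial :: "('a::euclidean_space \<Rightarrow> ennreal) \<Rightarrow> bool" where
  "radial \<rho> \<longleftrightarrow> (\<exists>\<rho>' :: real \<Rightarrow> ennreal. \<forall>x. \<rho> x = \<rho>' (norm x))"

definition locally_integrable :: "('a::euclidean_space \<Rightarrow> ennreal) \<Rightarrow> bool" where
  "locally_integrable \<rho> \<longleftrightarrow> \<rho> \<in> borel_measurable lebesgue \<and>
     (\<forall>K. compact K \<longrightarrow> (\<integral>\<^sup>+x\<in>K. \<rho> x \<partial>lebesgue) < \<infinity>)"

definition admissible_kernel :: "('a::euclidean_space \<Rightarrow> ennreal) \<Rightarrow> bool" where
  "admissible_kernel \<rho> \<longleftrightarrow>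
     radial \<rho> \<and>
     (\<forall>x. x \<noteq> 0 \<longrightarrow> \<rho> x < \<infinity>) \<and>
     locally_integrable \<rho> \<and>
     (\<integral>\<^sup>+x. ennreal (min 1 (inverse (norm x))) * \<rho> x \<partial>lebesgue) < \<infinity> \<and>
     (\<exists>\<epsilon>>0. (INF x\<in>ball 0 \<epsilon>. \<rho> x) > 0)"

text \<open>In the integrals below (and above) the conventions \<open>inverse 0 = 0\<close> and
  \<open>enn2real \<infinity> = 0\<close> only affect the integrand on the null set where the argument of the kernel
  is \<open>0\<close>.\<close>

definition nonlocal_div ::
    "('a::euclidean_space \<Rightarrow> ennreal) \<Rightarrow> ('a \<Rightarrow> 'a) \<Rightarrow> 'a \<Rightarrow> real" where
  "nonlocal_div \<rho> \<Phi> x =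
     (\<integral>y. (((\<Phi> x - \<Phi> y) /\<^sub>R norm (x - y)) \<bullet> ((x - y) /\<^sub>R norm (x - y)))
           * enn2real (\<rho> (x - y)) \<partial>lebesgue)"

definition weak_nonlocal_grad ::
    "('a::euclidean_space \<Rightarrow> ennreal) \<Rightarrow> ('a \<Rightarrow> real) \<Rightarrow> ('a \<Rightarrow> 'a) \<Rightarrow> real" where
  "weak_nonlocal_grad \<rho> u \<Phi> = - (\<integral>x. u x * nonlocal_div \<rho> \<Phi> x \<partial>lebesgue)"

definition represents ::
    "('a::euclidean_space \<Rightarrow> 'a) \<Rightarrow> (('a \<Rightarrow> 'a) \<Rightarrow> real) \<Rightarrow> bool" where
  "represents g T \<longleftrightarrow> (\<forall>\<Phi>\<in>test_fields. T \<Phi> = (\<integral>x. g x \<bullet> \<Phi> x \<partial>lebesgue))"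

text \<open>The gradient as an \<open>L\<^sup>p\<close> function. The choice is unique up to null sets whenever the
  distribution is represented by an \<open>L\<^sup>p\<close> field, and is only used in this case.\<close>

definition nonlocal_grad ::
    "('a::euclidean_space \<Rightarrow> ennreal) \<Rightarrow> ennreal \<Rightarrow> ('a \<Rightarrow> real) \<Rightarrow> 'a \<Rightarrow> 'a" where
  "nonlocal_grad \<rho> p u =
     (SOME g. g \<in> Lp_space lebesgue p \<and> represents g (weak_nonlocal_grad \<rho> u))"

definition H_space ::
    "('a::euclidean_space \<Rightarrow> ennreal) \<Rightarrow> ennreal \<Rightarrow> ('a \<Rightarrow> real) set" where
  "H_space \<rho> p = {u \<in> Lp_space lebesgue p.
     \<exists>g \<in> Lp_space lebesgue p. represents g (weak_nonlocal_grad \<rho> u)}"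

definition H_norm ::
    "('a::euclidean_space \<Rightarrow> ennreal) \<Rightarrow> ennreal \<Rightarrow> ('a \<Rightarrow> real) \<Rightarrow> real" where
  "H_norm \<rho> p u =
     (if p = \<infinity>
      then max (Lp_norm lebesgue p u) (Lp_norm lebesgue p (nonlocal_grad \<rho> p u))
      else (Lp_norm lebesgue p u powr enn2real p
            + Lp_norm lebesgue p (nonlocal_grad \<rho> p u) powr enn2real p) powr (1 / enn2real p))"

definition H0_space ::
    "('a::euclidean_space \<Rightarrow> ennreal) \<Rightarrow> ennreal \<Rightarrow> 'a set \<Rightarrow> ('a \<Rightarrow> real) set" where
  "H0_space \<rho> p \<Omega> = {u \<in> H_space \<rho> p. AE x in lebesgue. x \<notin> \<Omega> \<longrightarrow> u x = 0}"

definition equivalent_norms_on ::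
    "'u set \<Rightarrow> ('u \<Rightarrow> real) \<Rightarrow> ('u \<Rightarrow> real) \<Rightarrow> bool" where
  "equivalent_norms_on V N1 N2 \<longleftrightarrow>
     (\<exists>c>0. \<exists>C>0. \<forall>u\<in>V. c * N1 u \<le> N2 u \<and> N2 u \<le> C * N1 u)"

end

theory Submission
  imports Defs "HOL-Complex_Analysis.Great_Picard"
begin

text \<open>
  Write the integrand of the nonlocal divergence as \<open>(\<Phi> x - \<Phi> y) \<bullet> \<kappa> (x - y)\<close> with the vector kernel
  \<open>\<kappa> z = \<rho> z / \<bar>z\<bar>\<^sup>2 *\<^sub>R z\<close>. Since \<open>\<rho>\<close> is radial, \<open>\<kappa>\<close> is odd, and \<open>min 1 \<bar>z\<bar> * \<bar>\<kappa> z\<bar>\<close> is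
  integrable. The assumption on \<open>\<rho>1 - \<rho>2\<close> says that \<open>k = \<kappa>1 - \<kappa>2\<close> is an integrable odd vector
  field, so its integral vanishes and the two divergences of \<open>\<Phi>\<close> differ by the convolution
  \<open>\<integral> \<Phi> y \<bullet> k (x - y) dy\<close> alone (\<open>div_field_change_kernel\<close>). By duality the two weak gradients of
  \<open>u\<close> differ by the function \<open>y \<mapsto> \<integral> u x *\<^sub>R k (x - y) dx\<close>, called \<open>correlation u k\<close> below
  (\<open>weak_grad_change_kernel\<close>), and Young's inequality bounds its \<open>L\<^sup>p\<close> norm by that of \<open>u\<close>. This
  gives the first claim. As the norm of the gradient refers to a chosen representative, it also needs that
  the gradient is unique up to null sets (\<open>weak_grad_unique\<close>).

  For the second claim suppose that the inequality fails for \<open>\<rho>2\<close>: there are \<open>u n\<close> of unit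
  \<open>L\<^sup>p\<close> norm, supported in the bounded set \<open>\<Omega>\<close>, whose gradients for \<open>\<rho>2\<close> tend to \<open>0\<close>. In \<open>L\<^sup>1\<close>
  the field \<open>k\<close> is close to a continuous compactly supported \<open>k'\<close>, and the error can be absorbed in the
  inequality for \<open>\<rho>1\<close>. Hence the norm of \<open>u i - u j\<close> is controlled by the gradients for \<open>\<rho>2\<close> and by
  \<open>correlation (u i - u j) k'\<close> (\<open>poincare_up_to_regular_correlation\<close>). By Arzela-Ascoli the latter is
  small along a subsequence (\<open>correlation_compact\<close>), so that this subsequence converges to some \<open>w\<close> of
  unit norm whose gradient for \<open>\<rho>2\<close> vanishes.

  Such a \<open>w\<close> must be zero (\<open>weak_grad_zero_imp_AE_zero\<close>). Testing with plane waves shows that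
  the Fourier transform of \<open>w\<close> vanishes at every frequency where the sine transform
  \<open>\<integral> sin (z \<bullet> \<xi>) *\<^sub>R \<kappa>2 z dz\<close> does not. The latter is continuous in \<open>\<xi>\<close>, and it is not
  identically zero because \<open>\<rho>2\<close> is nonnegative and positive near the origin. So the Fourier transform
  of \<open>w\<close> vanishes on an open set. Differentiating there, all polynomial moments of \<open>w\<close> times a wave
  vanish, and since \<open>w\<close> has bounded support, the Weierstrass theorem yields \<open>w = 0\<close>.

  The analysis is carried out for Borel functions and Borel kernels, where Fubini's theorem
  applies to functions of \<open>(x, x - y)\<close>; every Lebesgue measurable function agrees almost everywhere with
  a Borel one.
\<close>

section \<open>Test fields\<close>

lemma continuous_bounded_on_cball:
  fixes f :: "'a::euclidean_space \<Rightarrow> 'b::real_normed_vector"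
  assumes f: "continuous_on UNIV f"
  obtains B where "B > 0" "\<And>x. norm x \<le> R \<Longrightarrow> norm (f x) \<le> B"
proof -
  have "bounded (f ` cball 0 R)"
    by (intro compact_imp_bounded compact_continuous_image continuous_on_subset[OF f]
        compact_cball subset_UNIV)
  then obtain B where "B > 0" "\<forall>y\<in>f ` cball 0 R. norm y \<le> B" unfolding bounded_pos by blast
  then show thesis by (intro that[of B]) auto
qed

lemma compactly_supported_continuous_bounded:
  fixes f :: "'a::euclidean_space \<Rightarrow> 'b::real_normed_vector"
  assumes "continuous_on UNIV f" "\<forall>x. norm x > R \<longrightarrow> f x = 0"
  obtains B where "B > 0" "\<And>x. norm (f x) \<le> B"
proof -
  obtain B where B: "B > 0" "\<And>x. norm x \<le> R \<Longrightarrow> norm (f x) \<le> B"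
    using continuous_bounded_on_cball[OF assms(1)] by blast
  have "norm (f x) \<le> B" for x using B assms(2) by (cases "norm x \<le> R") auto
  then show thesis using that[OF B(1)] by blast
qed

lemma integrable_indicator_cball: "integrable lborel (indicator (cball a r) :: 'a::euclidean_space \<Rightarrow> real)"
  by (rule integrable_real_indicator[OF _ emeasure_lborel_cball_finite]) simp

lemma integrable_mult_continuous:
  fixes f w :: "'a::euclidean_space \<Rightarrow> real"
  assumes f: "integrable lborel f" and supp: "\<And>x. norm x > R \<Longrightarrow> f x = 0" and w: "continuous_on UNIV w"
  shows "integrable lborel (\<lambda>x. f x * w x)"
proof -
  have [measurable]: "f \<in> borel_measurable borel" using f by auto
  have [measurable]: "w \<in> borel_measurable borel" by (rule borel_measurable_continuous_onI[OF w])
  obtain B where "\<And>x. norm x \<le> R \<Longrightarrow> norm (w x) \<le> B"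
    using continuous_bounded_on_cball[OF w] by blast
  then have B: "norm x \<le> R \<Longrightarrow> \<bar>w x\<bar> \<le> B" for x by simp
  have le: "norm (f x * w x) \<le> norm (B * f x)" for x
  proof (cases "norm x \<le> R")
    case True
    then show ?thesis using B[OF True]
      by (auto simp: abs_mult mult.commute[of "\<bar>f x\<bar>"] intro!: mult_right_mono)
  qed (simp add: supp)
  show ?thesis
    by (rule Bochner_Integration.integrable_bound[where f="\<lambda>x. B * f x"]) (use f le in auto)
qed

text \<open>The functions \<open>exp (- 1 / t) / t ^ j\<close> on \<open>t > 0\<close>, extended by zero. This family contains the standard
  flat function (\<open>j = 0\<close>), and derivatives of its members are linear combinations of members.\<close>

definition flat_exp :: "nat \<Rightarrow> real \<Rightarrow> real" where
  "flat_exp j t = (if t > 0 then exp (- 1 / t) / t ^ j else 0)"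

lemma flat_exp_tendsto_0: "(flat_exp j \<longlongrightarrow> 0) (at_right 0)"
proof -
  have "((\<lambda>t::real. (inverse t) ^ j / exp (inverse t)) \<longlongrightarrow> 0) (at_right 0)"
    by (rule filterlim_compose[OF tendsto_power_div_exp_0 filterlim_inverse_at_top_right])
  moreover have "\<forall>\<^sub>F t in at_right 0. (inverse t) ^ j / exp (inverse t) = flat_exp j t"
    unfolding eventually_at_right_field
    by (intro exI[of _ 1]) (auto simp: flat_exp_def exp_minus field_simps)
  ultimately show ?thesis
    by (rule Lim_transform_eventually)
qed

lemma flat_exp_DERIV:
  "(flat_exp j has_real_derivative (flat_exp (j + 2) t - real j * flat_exp (j + 1) t)) (at t)"
proof -
  consider "t < 0" | "t = 0" | "t > 0" by linarith
  then show ?thesis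
  proof cases
    case 1
    have "((\<lambda>_. 0) has_real_derivative 0) (at t)" by simp
    then have "(flat_exp j has_real_derivative 0) (at t)"
      by (rule has_field_derivative_transform_within_open[where S="{..<0}"])
        (use 1 in \<open>auto simp: flat_exp_def\<close>)
    then show ?thesis using 1 by (simp add: flat_exp_def)
  next
    case 2
    have "((\<lambda>h. (flat_exp j h - flat_exp j 0) / (h - 0)) \<longlongrightarrow> 0) (at_right 0)"
    proof (rule Lim_transform_eventually[OF flat_exp_tendsto_0[of "j + 1"]])
      show "\<forall>\<^sub>F h in at_right 0. flat_exp (j + 1) h = (flat_exp j h - flat_exp j 0) / (h - 0)"
        unfolding eventually_at_right_field
        by (intro exI[of _ 1]) (auto simp: flat_exp_def field_simps)
    qed
    moreover have "((\<lambda>h. (flat_exp j h - flat_exp j 0) / (h - 0)) \<longlongrightarrow> 0) (at_left 0)"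
    proof (rule Lim_transform_eventually[OF tendsto_const])
      show "\<forall>\<^sub>F h in at_left 0. 0 = (flat_exp j h - flat_exp j 0) / (h - 0)"
        unfolding eventually_at_left_field
        by (intro exI[of _ "-1"]) (auto simp: flat_exp_def)
    qed
    ultimately have "((\<lambda>h. (flat_exp j h - flat_exp j 0) / (h - 0)) \<longlongrightarrow> 0) (at 0)"
      by (simp add: filterlim_split_at)
    then have "(flat_exp j has_real_derivative 0) (at 0)"
      by (simp add: has_field_derivative_iff)
    then show ?thesis using 2 by (simp add: flat_exp_def)
  next
    case 3
    have "((\<lambda>t. exp (- 1 / t) * inverse (t ^ j)) has_real_derivative
        exp (- 1 / t) * (1 / t\<^sup>2) * inverse (t ^ j)
        + exp (- 1 / t) * (- (inverse (t ^ j) * (real j * t ^ (j - 1)) * inverse (t ^ j)))) (at t)"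
      using 3 by (auto intro!: derivative_eq_intros simp: power2_eq_square)
    moreover have "inverse (t ^ j) * (real j * t ^ (j - 1)) * inverse (t ^ j)
        = real j * (1 / t ^ (j + 1))"
      using 3 by (cases j) (auto simp: divide_simps)
    ultimately have "((\<lambda>t. exp (- 1 / t) * inverse (t ^ j)) has_real_derivative
        exp (- 1 / t) * (1 / t\<^sup>2) * inverse (t ^ j)
        + exp (- 1 / t) * (- (real j * (1 / t ^ (j + 1))))) (at t)"
      by (simp only:)
    then have "((\<lambda>t. exp (- 1 / t) / t ^ j) has_real_derivative
        (exp (- 1 / t) / t ^ (j + 2) - real j * (exp (- 1 / t) / t ^ (j + 1)))) (at t)"
      using 3 by (simp add: divide_inverse power_add power2_eq_square mult_ac)
    then have "(flat_exp j has_real_derivative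
        (exp (- 1 / t) / t ^ (j + 2) - real j * (exp (- 1 / t) / t ^ (j + 1)))) (at t)"
      by (rule has_field_derivative_transform_within_open[where S="{0<..}"])
        (use 3 in \<open>auto simp: flat_exp_def\<close>)
    then show ?thesis using 3 by (simp add: flat_exp_def)
  qed
qed

text \<open>A class of smooth functions that is closed under directional derivatives. It contains
  polynomials, plane waves and cutoffs, hence all scalar factors of the test fields used below. Closure under
  derivatives yields \<open>Ck k\<close> for every \<open>k\<close> by induction.\<close>

inductive elementary :: "('a::euclidean_space \<Rightarrow> real) \<Rightarrow> bool" where
  const: "elementary (\<lambda>x. c)"
| linear: "elementary (\<lambda>x. x \<bullet> v)"
| flat: "elementary (\<lambda>x. flat_exp j (x \<bullet> v + c))"
| sine: "elementary (\<lambda>x. sin (x \<bullet> v + c))"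
| add: "elementary f \<Longrightarrow> elementary g \<Longrightarrow> elementary (\<lambda>x. f x + g x)"
| mult: "elementary f \<Longrightarrow> elementary g \<Longrightarrow> elementary (\<lambda>x. f x * g x)"

lemma elementary_prod:
  "finite I \<Longrightarrow> (\<And>i. i \<in> I \<Longrightarrow> elementary (f i)) \<Longrightarrow> elementary (\<lambda>x. \<Prod>i\<in>I. f i x)"
  by (induction I rule: finite_induct) (auto intro: elementary.intros)

lemma elementary_polynomial:
  fixes P :: "'a::euclidean_space \<Rightarrow> real"
  shows "real_polynomial_function P \<Longrightarrow> elementary P"
proof (induction rule: real_polynomial_function.induct)
  case (linear f)
  then have "f = (\<lambda>x. x \<bullet> adjoint f 1)"
    using adjoint_works[of f _ 1] by (auto simp: bounded_linear.linear)
  then show ?case using elementary.linear[of "adjoint f 1"] by simp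
qed (auto intro: elementary.intros)

lemma elementary_derivative:
  fixes f :: "'a::euclidean_space \<Rightarrow> real"
  assumes "elementary f"
  shows "\<exists>f'. \<forall>x. (f has_derivative f' x) (at x) \<and> (\<forall>v. elementary (\<lambda>x. f' x v))"
  using assms
proof induction
  case (const c)
  show ?case by (intro exI[of _ "\<lambda>x v. 0"]) (auto intro: elementary.const)
next
  case (linear w)
  show ?case
    by (intro exI[of _ "\<lambda>x v. v \<bullet> w"]) (auto intro: elementary.const intro!: derivative_eq_intros)
next
  case (flat j w c)
  have "((\<lambda>x. flat_exp j (x \<bullet> w + c)) has_derivative
     (\<lambda>v. (v \<bullet> w) * (flat_exp (j+2) (x \<bullet> w + c) + (- real j) * flat_exp (j+1) (x \<bullet> w + c)))) (at x)" for x
    by (rule has_derivative_eq_rhs, rule DERIV_compose_FDERIV[OF flat_exp_DERIV])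
      (auto intro!: derivative_eq_intros simp: algebra_simps)
  then show ?case
    by (intro exI[of _ "\<lambda>x v. (v \<bullet> w) * (flat_exp (j+2) (x \<bullet> w + c) + (- real j) * flat_exp (j+1) (x \<bullet> w + c))"])
       (intro allI conjI elementary.intros; assumption)
next
  case (sine w c)
  have "((\<lambda>x. sin (x \<bullet> w + c)) has_derivative (\<lambda>v. (v \<bullet> w) * sin (x \<bullet> w + (c + pi / 2)))) (at x)" for x
    by (rule has_derivative_eq_rhs, rule DERIV_compose_FDERIV[OF DERIV_sin])
      (auto intro!: derivative_eq_intros simp: sin_add cos_add add.assoc[symmetric])
  then show ?case
    by (intro exI[of _ "\<lambda>x v. (v \<bullet> w) * sin (x \<bullet> w + (c + pi / 2))"]) (auto intro!: elementary.intros)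
next
  case (add f g)
  then obtain f' g' where "\<forall>x. (f has_derivative f' x) (at x) \<and> (\<forall>v. elementary (\<lambda>x. f' x v))"
    "\<forall>x. (g has_derivative g' x) (at x) \<and> (\<forall>v. elementary (\<lambda>x. g' x v))" by blast
  then show ?case
    by (intro exI[of _ "\<lambda>x v. f' x v + g' x v"]) (auto intro!: elementary.intros derivative_intros)
next
  case (mult f g)
  then obtain f' g' where *: "\<forall>x. (f has_derivative f' x) (at x) \<and> (\<forall>v. elementary (\<lambda>x. f' x v))"
    "\<forall>x. (g has_derivative g' x) (at x) \<and> (\<forall>v. elementary (\<lambda>x. g' x v))" by blast
  show ?case
    by (intro exI[of _ "\<lambda>x v. f x * g' x v + f' x v * g x"])
      (use * mult.hyps in \<open>auto intro!: elementary.add elementary.mult has_derivative_mult\<close>)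
qed

lemma elementary_differentiable: "elementary f \<Longrightarrow> f differentiable (at x)"
  using elementary_derivative[of f] unfolding differentiable_def by blast

lemma elementary_continuous: "elementary f \<Longrightarrow> continuous_on UNIV f"
  by (meson continuous_at_imp_continuous_on differentiable_imp_continuous_within elementary_differentiable)

lemma Ck_elementary: "elementary f \<Longrightarrow> Ck k (\<lambda>x. f x *\<^sub>R b)"
proof (induction k arbitrary: f)
  case 0
  then show ?case by (auto intro!: continuous_intros elementary_continuous)
next
  case (Suc k)
  obtain f' where f': "\<And>x. (f has_derivative f' x) (at x)" "\<And>v. elementary (\<lambda>x. f' x v)"
    using elementary_derivative[OF Suc.prems] by blast
  have D: "((\<lambda>x. f x *\<^sub>R b) has_derivative (\<lambda>v. f' x v *\<^sub>R b)) (at x)" for x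
    by (auto intro!: derivative_eq_intros f')
  have "frechet_derivative (\<lambda>x. f x *\<^sub>R b) (at x) v = f' x v *\<^sub>R b" for x v
    using frechet_derivative_at[OF D] by metis
  then show ?case
    using Suc.IH[OF f'(2)] D by (auto simp: differentiable_def intro!: exI)
qed

text \<open>A product over the coordinates: positive on the cube of side \<open>2 * R\<close> around the origin and zero outside.
  The ball of radius \<open>R\<close> lies in the cube, which in turn lies in the ball of radius \<open>R * DIM('a)\<close>.\<close>

definition cutoff :: "real \<Rightarrow> 'a::euclidean_space \<Rightarrow> real" where
  "cutoff R x = (\<Prod>b\<in>Basis. flat_exp 0 (x \<bullet> (- (1 / R) *\<^sub>R b) + 1) * flat_exp 0 (x \<bullet> ((1 / R) *\<^sub>R b) + 1))"

lemma elementary_cutoff: "elementary (cutoff R)"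
  unfolding cutoff_def by (intro elementary_prod elementary.intros finite_Basis)

lemma cutoff_pos:
  assumes "norm x < R" shows "cutoff R x > 0"
  unfolding cutoff_def
proof (intro prod_pos ballI mult_pos_pos)
  fix b :: 'a assume "b \<in> Basis"
  then have "\<bar>x \<bullet> b\<bar> < R" using Basis_le_norm assms by (meson le_less_trans)
  moreover have "R > 0" using assms norm_ge_zero by (meson le_less_trans)
  ultimately show "0 < flat_exp 0 (x \<bullet> (- (1 / R) *\<^sub>R b) + 1)" "0 < flat_exp 0 (x \<bullet> ((1 / R) *\<^sub>R b) + 1)"
    by (auto simp: flat_exp_def field_simps abs_less_iff)
qed

lemma cutoff_eq_0:
  fixes x :: "'a::euclidean_space" and R :: real
  assumes "R > 0" "norm x > R * DIM('a)" shows "cutoff R x = 0"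
proof -
  have "\<exists>b\<in>Basis. \<bar>x \<bullet> b\<bar> \<ge> R"
  proof (rule ccontr)
    assume "\<not> ?thesis"
    then have "(\<Sum>b\<in>Basis. \<bar>x \<bullet> b\<bar>) \<le> (\<Sum>b\<in>(Basis::'a set). R)"
      by (intro sum_mono) force
    then show False using norm_le_l1[of x] assms by (simp add: mult.commute)
  qed
  then obtain b where b: "b \<in> Basis" "\<bar>x \<bullet> b\<bar> \<ge> R" by blast
  then have "flat_exp 0 (x \<bullet> (- (1 / R) *\<^sub>R b) + 1) * flat_exp 0 (x \<bullet> ((1 / R) *\<^sub>R b) + 1) = 0"
    using assms by (cases "x \<bullet> b \<ge> 0") (auto simp: flat_exp_def field_simps)
  then show ?thesis unfolding cutoff_def using b
    by (meson finite_Basis prod_zero)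
qed

lemma cutoff_abs_le_1: "\<bar>cutoff R x\<bar> \<le> 1"
proof -
  have "0 \<le> flat_exp 0 t" "flat_exp 0 t \<le> 1" for t by (auto simp: flat_exp_def)
  then have "0 \<le> cutoff R x" "cutoff R x \<le> 1" 
    unfolding cutoff_def by (auto intro!: prod_nonneg prod_le_1 mult_nonneg_nonneg mult_le_one)
  then show ?thesis by simp
qed

lemma test_field_cutoff:
  assumes "elementary f" "R > 0"
  shows "(\<lambda>x::'a::euclidean_space. (cutoff R x * f x) *\<^sub>R b) \<in> test_fields"
proof -
  have "{x. (cutoff R x * f x) *\<^sub>R b \<noteq> 0} \<subseteq> cball (0::'a) (R * DIM('a))"
    using cutoff_eq_0[OF assms(2)] by (force simp: not_le)
  then have "compact (closure {x. (cutoff R x * f x) *\<^sub>R b \<noteq> 0})"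
    using bounded_subset bounded_cball compact_closure by blast
  then show ?thesis
    unfolding test_fields_def
    using Ck_elementary[OF elementary.mult[OF elementary_cutoff assms(1)]] by auto
qed

text \<open>By the Stone-Weierstrass theorem polynomials may be replaced by continuous functions. The sign of \<open>f\<close> is an
  almost everywhere limit of continuous functions with values in \<open>[-1, 1]\<close>, so the integral
  of \<open>f x * sgn (f x)\<close>, which is that of \<open>\<bar>f x\<bar>\<close>, vanishes as well.\<close>

lemma polynomial_moments_zero_imp_AE_zero:
  fixes f :: "'a::euclidean_space \<Rightarrow> real"
  assumes f: "integrable lborel f" and supp: "\<And>x. norm x > R \<Longrightarrow> f x = 0"
    and zero: "\<And>P. real_polynomial_function P \<Longrightarrow> (\<integral>x. f x * P x \<partial>lborel) = 0"
  shows "AE x in lborel. f x = 0"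
proof -
  have [measurable]: "f \<in> borel_measurable borel" using f by auto
  have int: "integrable lborel (\<lambda>x. f x * w x)" if "continuous_on UNIV w" for w
    by (rule integrable_mult_continuous[where R = R]) (use f supp that in auto)
  have cont0: "(\<integral>x. f x * w x \<partial>lborel) = 0" if w: "continuous_on UNIV w" for w
  proof (rule ccontr)
    assume nz: "(\<integral>x. f x * w x \<partial>lborel) \<noteq> 0"
    define A where "A = (\<integral>x. \<bar>f x\<bar> \<partial>lborel)"
    have A: "A \<ge> 0" unfolding A_def by simp
    define e where "e = \<bar>\<integral>x. f x * w x \<partial>lborel\<bar> / (A + 1)"
    have "e > 0" using nz A unfolding e_def by simp
    then obtain P where P: "real_polynomial_function P" "\<And>x. x \<in> cball 0 R \<Longrightarrow> \<bar>w x - P x\<bar> < e"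
      using Stone_Weierstrass_real_polynomial_function[of "cball 0 R" w e] continuous_on_subset[OF w] by auto
    have cP: "continuous_on UNIV P" using elementary_continuous[OF elementary_polynomial[OF P(1)]] .
    have "(\<integral>x. f x * w x \<partial>lborel) = (\<integral>x. f x * w x - f x * P x \<partial>lborel)"
      by (subst Bochner_Integration.integral_diff[OF int[OF w] int[OF cP]]) (simp add: zero[OF P(1)])
    also have "\<bar>\<dots>\<bar> \<le> (\<integral>x. \<bar>f x\<bar> * e \<partial>lborel)"
    proof (rule order_trans[OF integral_abs_bound], rule integral_mono)
      show "integrable lborel (\<lambda>x. \<bar>f x * w x - f x * P x\<bar>)" using int[OF w] int[OF cP] by auto
      show "integrable lborel (\<lambda>x. \<bar>f x\<bar> * e)" using f by auto
      fix x
      show "\<bar>f x * w x - f x * P x\<bar> \<le> \<bar>f x\<bar> * e"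
      proof (cases "norm x \<le> R")
        case True
        then show ?thesis using P(2)[of x]
          by (auto simp: abs_mult simp flip: right_diff_distrib intro!: mult_left_mono)
      qed (simp add: supp)
    qed
    also have "\<dots> = A * e" unfolding A_def by simp
    also have "\<dots> < (A + 1) * e" using \<open>e > 0\<close> by simp
    also have "\<dots> = \<bar>\<integral>x. f x * w x \<partial>lborel\<bar>" unfolding e_def using A by simp
    finally show False by simp
  qed
  have "(\<lambda>x. sgn (f x)) measurable_on UNIV"
    by (subst measurable_on_iff_borel_measurable)
      (simp_all add: lebesgue_on_UNIV_eq measurable_completion)
  then obtain N g where N: "negligible N" and g: "\<And>n. continuous_on UNIV (g n)"
    and lim: "\<And>x. x \<notin> N \<Longrightarrow> (\<lambda>n. g n x) \<longlonglongrightarrow> sgn (f x)"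
    unfolding measurable_on_def by auto
  define c where "c n x = max (-1) (min 1 (g n x))" for n x
  have c: "continuous_on UNIV (c n)" for n
    unfolding c_def by (intro continuous_intros g)
  have [measurable]: "c n \<in> borel_measurable borel" for n
    by (rule borel_measurable_continuous_onI[OF c])
  have AE_N: "AE x in lborel. x \<notin> N"
    using N AE_not_in[of N lebesgue] by (simp add: AE_completion_iff negligible_iff_null_sets)
  have "(\<lambda>n. \<integral>x. f x * c n x \<partial>lborel) \<longlonglongrightarrow> (\<integral>x. f x * sgn (f x) \<partial>lborel)"
  proof (rule integral_dominated_convergence[where w="\<lambda>x. \<bar>f x\<bar>"])
    show "AE x in lborel. (\<lambda>n. f x * c n x) \<longlonglongrightarrow> f x * sgn (f x)"
      using AE_N
    proof eventually_elim
      case (elim x)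
      have "(\<lambda>n. f x * c n x) \<longlonglongrightarrow> f x * max (-1) (min 1 (sgn (f x)))"
        unfolding c_def by (intro tendsto_intros lim elim)
      moreover have "max (-1) (min 1 (sgn (f x))) = sgn (f x)" by (auto simp: sgn_if)
      ultimately show ?case by simp
    qed
    show "AE x in lborel. norm (f x * c n x) \<le> \<bar>f x\<bar>" for n
      by (rule AE_I2) (auto simp: abs_mult c_def intro!: mult_left_le)
  qed (use f in auto)
  then have "(\<integral>x. f x * sgn (f x) \<partial>lborel) = 0" using cont0[OF c] by (simp add: LIMSEQ_const_iff)
  then have "(\<integral>x. \<bar>f x\<bar> \<partial>lborel) = 0" by (simp add: abs_sgn)
  then show ?thesis using integral_nonneg_eq_0_iff_AE[of lborel "\<lambda>x. \<bar>f x\<bar>"] f by auto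
qed

text \<open>The fundamental lemma of the calculus of variations. Cutoffs times polynomials are test fields, so the
  previous lemma applies to each component of \<open>g\<close> times a cutoff, and cutoffs are positive on large balls.\<close>

lemma vanishing_on_test_fields_imp_AE_zero:
  fixes g :: "'a::euclidean_space \<Rightarrow> 'a"
  assumes [measurable]: "g \<in> borel_measurable borel"
    and loc: "\<And>R. integrable lborel (\<lambda>x. indicator (cball 0 R) x * norm (g x))"
    and zero: "\<And>\<Phi>. \<Phi> \<in> test_fields \<Longrightarrow> (\<integral>x. g x \<bullet> \<Phi> x \<partial>lborel) = 0"
  shows "AE x in lborel. g x = 0"
proof -
  have "AE x in lborel. norm x < real n \<longrightarrow> g x \<bullet> b = 0" if b: "b \<in> Basis" for b :: 'a and n :: nat
  proof (cases "n = 0")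
    case False
    define f where "f x = cutoff n x * (g x \<bullet> b)" for x
    have contc: "continuous_on UNIV (cutoff n :: 'a \<Rightarrow> real)" by (rule elementary_continuous[OF elementary_cutoff])
    have [measurable]: "cutoff n \<in> borel_measurable (borel :: 'a measure)"
      by (rule borel_measurable_continuous_onI[OF contc])
    let ?R = "real n * DIM('a)"
    have [measurable]: "f \<in> borel_measurable borel" unfolding f_def by measurable
    have "integrable lborel f"
    proof (rule Bochner_Integration.integrable_bound[OF loc[of ?R]])
      have "norm (f x) \<le> norm (indicator (cball 0 ?R) x * norm (g x))" for x
      proof (cases "norm x \<le> ?R")
        case True
        have "\<bar>cutoff n x\<bar> * \<bar>g x \<bullet> b\<bar> \<le> 1 * norm (g x)"
          by (intro mult_mono cutoff_abs_le_1 Basis_le_norm[OF b]) auto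
        then show ?thesis using True by (simp add: f_def abs_mult)
      qed (use False in \<open>simp add: f_def cutoff_eq_0[of "real n"] not_le\<close>)
      then show "AE x in lborel. norm (f x) \<le> norm (indicator (cball 0 ?R) x * norm (g x))" by simp
    qed measurable
    then have "AE x in lborel. f x = 0"
    proof (rule polynomial_moments_zero_imp_AE_zero[where R = ?R])
      fix P :: "'a \<Rightarrow> real" assume P: "real_polynomial_function P"
      have "(\<lambda>x. (cutoff n x * P x) *\<^sub>R b) \<in> test_fields"
        by (rule test_field_cutoff[OF elementary_polynomial[OF P]]) (use False in auto)
      from zero[OF this] show "(\<integral>x. f x * P x \<partial>lborel) = 0"
        by (simp add: f_def mult_ac)
    qed (use False in \<open>simp add: f_def cutoff_eq_0[of "real n"]\<close>)
    then show ?thesis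
    proof eventually_elim
      case (elim x)
      then show ?case using cutoff_pos[of x n] by (auto simp: f_def)
    qed
  qed auto
  then have "AE x in lborel. \<forall>n::nat. \<forall>b\<in>Basis. norm x < real n \<longrightarrow> g x \<bullet> b = 0"
    by (intro AE_all_countable[THEN iffD2] allI AE_finite_allI finite_Basis)
  then show ?thesis
  proof eventually_elim
    case (elim x)
    obtain n :: nat where "norm x < real n" using reals_Archimedean2 by blast
    then show ?case using elim by (auto intro: euclidean_eqI)
  qed
qed

section \<open>Lebesgue spaces and Young's inequality\<close>

lemma lborel_distr_reflect: "distr lborel borel (\<lambda>y. x - y) = (lborel :: 'a::euclidean_space measure)"
  by (subst lborel_affine[of "-1" x]) (auto simp: density_1 one_ennreal_def[symmetric])

lemma integrable_reflect_iff:
  fixes f :: "'a::euclidean_space \<Rightarrow> 'b::{banach, second_countable_topology}"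
  assumes [measurable]: "f \<in> borel_measurable borel"
  shows "integrable lborel (\<lambda>y. f (x - y)) \<longleftrightarrow> integrable lborel f"
  by (subst (2) lborel_distr_reflect[of x, symmetric]) (simp add: integrable_distr_eq)

lemma integral_reflect:
  fixes f :: "'a::euclidean_space \<Rightarrow> 'b::{banach, second_countable_topology}"
  assumes [measurable]: "f \<in> borel_measurable borel"
  shows "(\<integral>y. f (x - y) \<partial>lborel) = (\<integral>y. f y \<partial>lborel)"
  by (subst (2) lborel_distr_reflect[of x, symmetric]) (simp add: integral_distr)

lemma integrable_shift_iff:
  fixes f :: "'a::euclidean_space \<Rightarrow> 'b::{banach, second_countable_topology}"
  assumes [measurable]: "f \<in> borel_measurable borel"
  shows "integrable lborel (\<lambda>y. f (y - x)) \<longleftrightarrow> integrable lborel f"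
  by (subst (2) lborel_distr_plus[of "-x", symmetric], subst integrable_distr_eq) simp_all

lemma integral_shift:
  fixes f :: "'a::euclidean_space \<Rightarrow> 'b::{banach, second_countable_topology}"
  assumes [measurable]: "f \<in> borel_measurable borel"
  shows "(\<integral>y. f (y - x) \<partial>lborel) = (\<integral>y. f y \<partial>lborel)"
  by (subst (2) lborel_distr_plus[of "-x", symmetric]) (simp add: integral_distr)

lemma Lp_spaceD_measurable: "f \<in> Lp_space M p \<Longrightarrow> f \<in> borel_measurable M"
  by (simp add: Lp_space_def)

lemma Lp_space_infinityE:
  assumes "f \<in> Lp_space M \<infinity>"
  obtains B where "B \<ge> 0" "B = Lp_norm M \<infinity> f" "AE x in M. norm (f x) \<le> B"
proof -
  have fin: "esssup M (\<lambda>x. ennreal (norm (f x))) < \<infinity>" using assms by (simp add: Lp_space_def)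
  have "AE x in M. norm (f x) \<le> Lp_norm M \<infinity> f"
    using esssup_AE[of "\<lambda>x. ennreal (norm (f x))" M]
  proof eventually_elim
    case (elim x)
    then show ?case using enn2real_mono[OF elim] fin by (auto simp: Lp_norm_def)
  qed
  then show thesis by (intro that[of "Lp_norm M \<infinity> f"]) (auto simp: Lp_norm_def)
qed

lemma Lp_space_infinityI:
  assumes [measurable]: "f \<in> borel_measurable M" and "B \<ge> 0" "AE x in M. norm (f x) \<le> B"
  shows "f \<in> Lp_space M \<infinity>" "Lp_norm M \<infinity> f \<le> B"
proof -
  have *: "esssup M (\<lambda>x. ennreal (norm (f x))) \<le> ennreal B"
    by (rule esssup_I) (use assms in \<open>auto intro: ennreal_leI\<close>)
  then show "f \<in> Lp_space M \<infinity>" 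
    using assms by (auto simp: Lp_space_def intro: le_less_trans[OF *])
  show "Lp_norm M \<infinity> f \<le> B"
    using enn2real_mono[OF *] assms by (simp add: Lp_norm_def)
qed

text \<open>Plays the role of Hoelder's inequality. Multiplying by a weight and integrating
  bounds a pairing of \<open>t\<close> by the integral of \<open>t powr q\<close>, with a parameter \<open>l\<close> that is either optimised or sent
  to zero.\<close>

lemma le_add_powr:
  fixes t l q :: real
  assumes "t \<ge> 0" "l > 0" "q \<ge> 1"
  shows "t \<le> l + l powr (1 - q) * t powr q"
proof (cases "t \<le> l")
  case False
  then have "(t / l) powr 1 \<le> (t / l) powr q" using assms by (intro powr_mono) auto
  then have "t \<le> l * (t / l) powr q" using assms False by (simp add: field_simps)
  also have "\<dots> = l powr (1 - q) * t powr q"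
    using assms False by (simp add: powr_divide powr_diff)
  finally show ?thesis using assms by linarith
qed (use assms in \<open>simp add: add_increasing2\<close>)

text \<open>The weight lies in \<open>L\<^sup>1\<close> and in \<open>L\<^sup>\<infinity>\<close>, hence in every conjugate \<open>L\<^sup>p\<close> space. For finite \<open>p\<close> one
  has \<open>\<bar>f w\<bar> \<le> \<bar>w\<bar> + B \<bar>f\<bar>\<^sup>p\<close>.\<close>

lemma Lp_mult_integrable:
  fixes f :: "'a \<Rightarrow> 'b::euclidean_space" and w :: "'a \<Rightarrow> real"
  assumes f: "f \<in> Lp_space M p" and p: "1 \<le> p"
    and w: "integrable M w" and B: "\<And>x. \<bar>w x\<bar> \<le> B"
  shows "integrable M (\<lambda>x. norm (f x) * w x)"
proof -
  have [measurable]: "f \<in> borel_measurable M" "w \<in> borel_measurable M"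
    using f w by (auto dest: Lp_spaceD_measurable)
  show ?thesis
  proof (cases "p = \<infinity>")
    case True
    then obtain C where C: "AE x in M. norm (f x) \<le> C" "C \<ge> 0" using Lp_space_infinityE f by blast
    show ?thesis
    proof (rule Bochner_Integration.integrable_bound[where f="\<lambda>x. C * w x"])
      show "AE x in M. norm (norm (f x) * w x) \<le> norm (C * w x)"
        using C(1) by eventually_elim (use C in \<open>auto simp: abs_mult intro: mult_right_mono\<close>)
    qed (use w in auto)
  next
    case False
    define q where "q = enn2real p"
    have q: "q \<ge> 1" unfolding q_def using False p
      by (metis enn2real_1 enn2real_mono infinity_ennreal_def top.not_eq_extremum)
    have i: "integrable M (\<lambda>x. norm (f x) powr q)" using f False by (simp add: Lp_space_def q_def)
    show ?thesis
    proof (rule Bochner_Integration.integrable_bound[where f="\<lambda>x. \<bar>w x\<bar> + B * norm (f x) powr q"])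
      show "AE x in M. norm (norm (f x) * w x) \<le> norm (\<bar>w x\<bar> + B * norm (f x) powr q)"
      proof (rule AE_I2)
        fix x
        have "norm (f x) * \<bar>w x\<bar> \<le> (1 + norm (f x) powr q) * \<bar>w x\<bar>"
          using le_add_powr[of "norm (f x)" 1 q] q by (intro mult_right_mono) auto
        also have "\<dots> \<le> \<bar>w x\<bar> + B * norm (f x) powr q"
          using B[of x] by (auto simp: algebra_simps intro: mult_right_mono)
        finally show "norm (norm (f x) * w x) \<le> norm (\<bar>w x\<bar> + B * norm (f x) powr q)"
          by (simp add: abs_mult)
      qed
    qed (use w i in auto)
  qed
qed

text \<open>The adjoint of the convolution \<open>\<Phi> \<mapsto> \<integral> \<Phi> y \<bullet> k (x - y) dy\<close>, see \<open>correlation_duality\<close>. For odd \<open>k\<close>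
  it is minus the convolution of \<open>u\<close> and \<open>k\<close>.\<close>

definition correlation :: "('a::euclidean_space \<Rightarrow> real) \<Rightarrow> ('a \<Rightarrow> 'a) \<Rightarrow> 'a \<Rightarrow> 'a" where
  "correlation u k y = (\<integral>x. u x *\<^sub>R k (x - y) \<partial>lborel)"

lemma correlation_measurable [measurable]:
  assumes [measurable]: "u \<in> borel_measurable borel" "k \<in> borel_measurable borel"
  shows "correlation u k \<in> borel_measurable borel"
  unfolding correlation_def[abs_def] by measurable

lemma integrable_pair_shift:
  fixes F :: "'a::euclidean_space \<Rightarrow> real" and k :: "'a \<Rightarrow> 'b::{banach, second_countable_topology}"
  assumes F: "integrable lborel F" and k: "integrable lborel k"
  shows "integrable (lborel \<Otimes>\<^sub>M lborel) (\<lambda>(x, y). F x *\<^sub>R k (x - y))"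
proof -
  have [measurable]: "F \<in> borel_measurable borel" "k \<in> borel_measurable borel" using F k by auto
  have "(\<integral>y. norm (k (x - y)) \<partial>lborel) = (\<integral>y. norm (k y) \<partial>lborel)" for x
    by (rule integral_reflect[of "\<lambda>y. norm (k y)" x]) simp
  moreover have "integrable lborel (\<lambda>y. F x *\<^sub>R k (x - y))" for x
    using integrable_reflect_iff[of k x] k by simp
  ultimately show ?thesis
    by (intro lborel_pair.Fubini_integrable) (use F in auto)
qed

text \<open>Pointwise, \<open>\<bar>u\<bar> \<le> l + l powr (1 - q) * \<bar>u\<bar> powr q\<close> gives
  \<open>\<bar>correlation u k y\<bar> \<le> l * A + l powr (1 - q) * I y\<close>, where \<open>I\<close> is the correlation of \<open>\<bar>u\<bar> powr q\<close> and \<open>\<bar>k\<bar>\<close>;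
  by Fubini the integral of \<open>I\<close> is at most \<open>A\<close> times that of \<open>\<bar>u\<bar> powr q\<close>. The optimal \<open>l\<close> costs only the
  factor \<open>2 powr q\<close>.\<close>

lemma Young:
  fixes u :: "'a::euclidean_space \<Rightarrow> real" and k :: "'a \<Rightarrow> 'a"
  assumes [measurable]: "u \<in> borel_measurable borel"
    and u: "integrable lborel (\<lambda>x. \<bar>u x\<bar> powr q)" and q: "q \<ge> 1"
    and k: "integrable lborel k" and A: "(\<integral>x. norm (k x) \<partial>lborel) \<le> A" "A > 0"
  shows "AE y in lborel. integrable lborel (\<lambda>x. u x *\<^sub>R k (x - y))"
    and "integrable lborel (\<lambda>y. norm (correlation u k y) powr q)"
    and "(\<integral>y. norm (correlation u k y) powr q \<partial>lborel) \<le> (2 * A) powr q * (\<integral>x. \<bar>u x\<bar> powr q \<partial>lborel)"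
proof -
  have [measurable]: "k \<in> borel_measurable borel" using k by auto
  have nk: "integrable lborel (\<lambda>x. norm (k x))" using k by auto
  define I where "I y = (\<integral>x. \<bar>u x\<bar> powr q * norm (k (x - y)) \<partial>lborel)" for y
  have pair: "integrable (lborel \<Otimes>\<^sub>M lborel) (\<lambda>(x, y). \<bar>u x\<bar> powr q * norm (k (x - y)))"
    using integrable_pair_shift[OF u nk] by simp
  have I: "integrable lborel I" and AEI: "AE y in lborel. integrable lborel (\<lambda>x. \<bar>u x\<bar> powr q * norm (k (x - y)))"
    using lborel_pair.integrable_snd[OF pair] lborel_pair.AE_integrable_snd[OF pair] by (auto simp: I_def[abs_def])
  have "(\<integral>y. I y \<partial>lborel) = (\<integral>x. (\<integral>y. \<bar>u x\<bar> powr q * norm (k (x - y)) \<partial>lborel) \<partial>lborel)"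
    unfolding I_def using lborel_pair.Fubini_integral[OF pair] by simp
  also have "\<dots> = (\<integral>x. \<bar>u x\<bar> powr q \<partial>lborel) * (\<integral>x. norm (k x) \<partial>lborel)"
    using integral_reflect[of "\<lambda>x. norm (k x)"] by simp
  finally have intI: "(\<integral>y. I y \<partial>lborel) \<le> (\<integral>x. \<bar>u x\<bar> powr q \<partial>lborel) * A"
    using A by (simp add: mult_left_mono)
  have pt: "integrable lborel (\<lambda>x. u x *\<^sub>R k (x - y)) \<and>
      norm (correlation u k y) powr q \<le> 2 powr q * A powr (q - 1) * I y"
    if iy: "integrable lborel (\<lambda>x. \<bar>u x\<bar> powr q * norm (k (x - y)))" for y
  proof -
    have ky: "integrable lborel (\<lambda>x. norm (k (x - y)))" using integrable_shift_iff[of "\<lambda>x. norm (k x)" y] nk by simp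
    have kA: "(\<integral>x. norm (k (x - y)) \<partial>lborel) \<le> A" using integral_shift[of "\<lambda>x. norm (k x)" y] A by simp
    have dom: "norm (u x *\<^sub>R k (x - y)) \<le> l * norm (k (x - y)) + l powr (1 - q) * (\<bar>u x\<bar> powr q * norm (k (x - y)))"
      if "l > 0" for l x
    proof -
      have "\<bar>u x\<bar> * norm (k (x - y)) \<le> (l + l powr (1 - q) * \<bar>u x\<bar> powr q) * norm (k (x - y))"
        by (intro mult_right_mono le_add_powr) (use that q in auto)
      then show ?thesis by (simp add: algebra_simps)
    qed
    have intg: "integrable lborel (\<lambda>x. u x *\<^sub>R k (x - y))"
      by (rule Bochner_Integration.integrable_bound
          [where f="\<lambda>x. 1 * norm (k (x - y)) + 1 powr (1 - q) * (\<bar>u x\<bar> powr q * norm (k (x - y)))"])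
        (use ky iy dom[of 1] in \<open>auto intro!: AE_I2 order_trans[OF _ abs_ge_self]\<close>)
    have bound: "norm (correlation u k y) \<le> l * A + l powr (1 - q) * I y" if "l > 0" for l
    proof -
      have "norm (correlation u k y) \<le> (\<integral>x. norm (u x *\<^sub>R k (x - y)) \<partial>lborel)"
        unfolding correlation_def by (rule integral_norm_bound)
      also have "\<dots> \<le> (\<integral>x. l * norm (k (x - y)) + l powr (1 - q) * (\<bar>u x\<bar> powr q * norm (k (x - y))) \<partial>lborel)"
        by (rule integral_mono[OF integrable_norm[OF intg]]) (use ky iy dom[OF that] in auto)
      also have "\<dots> = l * (\<integral>x. norm (k (x - y)) \<partial>lborel) + l powr (1 - q) * I y"
        unfolding I_def using ky iy by simp
      also have "\<dots> \<le> l * A + l powr (1 - q) * I y" using kA that by simp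
      finally show ?thesis .
    qed
    have I0: "I y \<ge> 0" unfolding I_def by simp
    show ?thesis
    proof (cases "I y = 0")
      case True
      \<comment> \<open>Here the second summand of the bound is zero, so \<open>l\<close> may tend to zero.\<close>
      have "norm (correlation u k y) \<le> e" if "e > 0" for e
        using bound[of "e / A"] A that True by simp
      then have "norm (correlation u k y) = 0"
        by (meson dense_le_bounded field_le_epsilon norm_ge_zero not_less order_antisym add_0 less_eq_real_def)
      then show ?thesis using intg I0 by simp
    next
      case False
      \<comment> \<open>The value of \<open>l\<close> for which both summands of the bound are equal to \<open>l * A\<close>.\<close>
      define l where "l = (I y / A) powr (1 / q)"
      have l: "l > 0" "l powr q = I y / A" using False I0 A q by (auto simp: l_def powr_powr)
      have "l powr (1 - q) * I y = l * A"
        using l A by (simp add: powr_diff field_simps)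
      then have "norm (correlation u k y) \<le> 2 * A * l" using bound[OF l(1)] by simp
      then have "norm (correlation u k y) powr q \<le> (2 * A * l) powr q"
        using q by (intro powr_mono2) auto
      also have "\<dots> = 2 powr q * A powr (q - 1) * I y"
        using l A by (simp add: powr_mult powr_diff)
      finally show ?thesis using intg by simp
    qed
  qed
  show "AE y in lborel. integrable lborel (\<lambda>x. u x *\<^sub>R k (x - y))"
    using AEI by eventually_elim (use pt in blast)
  have AEb: "AE y in lborel. norm (correlation u k y) powr q \<le> 2 powr q * A powr (q - 1) * I y"
    using AEI by eventually_elim (use pt in blast)
  show int: "integrable lborel (\<lambda>y. norm (correlation u k y) powr q)"
    by (rule Bochner_Integration.integrable_bound[where f="\<lambda>y. 2 powr q * A powr (q - 1) * I y"])
      (use I AEb in \<open>auto elim!: eventually_mono intro: order_trans[OF _ abs_ge_self]\<close>)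
  have "(\<integral>y. norm (correlation u k y) powr q \<partial>lborel) \<le> (\<integral>y. 2 powr q * A powr (q - 1) * I y \<partial>lborel)"
    by (rule integral_mono_AE) (use int I AEb in auto)
  also have "\<dots> \<le> 2 powr q * A powr (q - 1) * ((\<integral>x. \<bar>u x\<bar> powr q \<partial>lborel) * A)"
    using intI by (simp add: mult_left_mono)
  also have "\<dots> = (2 * A) powr q * (\<integral>x. \<bar>u x\<bar> powr q \<partial>lborel)"
    using A by (simp add: powr_mult powr_diff)
  finally show "(\<integral>y. norm (correlation u k y) powr q \<partial>lborel) \<le> (2 * A) powr q * (\<integral>x. \<bar>u x\<bar> powr q \<partial>lborel)" .
qed

lemma Young_infinity:
  fixes u :: "'a::euclidean_space \<Rightarrow> real" and k :: "'a \<Rightarrow> 'a"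
  assumes [measurable]: "u \<in> borel_measurable borel"
    and u: "AE x in lborel. \<bar>u x\<bar> \<le> B"
    and k: "integrable lborel k"
  shows "norm (correlation u k y) \<le> (\<integral>x. norm (k x) \<partial>lborel) * B"
proof -
  have [measurable]: "k \<in> borel_measurable borel" using k by auto
  have ky: "integrable lborel (\<lambda>x. norm (k (x - y)))" using integrable_shift_iff[of "\<lambda>x. norm (k x)" y] k by simp
  have dom: "AE x in lborel. norm (u x *\<^sub>R k (x - y)) \<le> B * norm (k (x - y))"
    using u by eventually_elim (auto intro: mult_right_mono)
  have int: "integrable lborel (\<lambda>x. norm (u x *\<^sub>R k (x - y)))"
    by (rule Bochner_Integration.integrable_bound[where f="\<lambda>x. B * norm (k (x - y))"])
      (use ky dom in \<open>auto elim!: eventually_mono intro: order_trans[OF _ abs_ge_self]\<close>)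
  have "norm (correlation u k y) \<le> (\<integral>x. norm (u x *\<^sub>R k (x - y)) \<partial>lborel)"
    unfolding correlation_def by (rule integral_norm_bound)
  also have "\<dots> \<le> (\<integral>x. B * norm (k (x - y)) \<partial>lborel)"
    by (rule integral_mono_AE) (use int ky dom in auto)
  finally show ?thesis using integral_shift[of "\<lambda>x. norm (k x)" y] by (simp add: mult.commute)
qed

text \<open>Fubini's theorem. The absolute double integral is finite because \<open>\<integral> \<bar>\<Phi> y \<bullet> k (x - y)\<bar> dy\<close> is a bounded integrable
  function of \<open>x\<close> and thus pairs with \<open>u\<close>.\<close>

lemma correlation_duality:
  fixes u :: "'a::euclidean_space \<Rightarrow> real" and k :: "'a \<Rightarrow> 'a"
  assumes u: "u \<in> Lp_space lborel p" "1 \<le> p" and k: "integrable lborel k"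
    and \<Phi>: "integrable lborel \<Phi>" "\<And>x. norm (\<Phi> x) \<le> B"
  shows "integrable lborel (\<lambda>x. u x * (\<integral>y. \<Phi> y \<bullet> k (x - y) \<partial>lborel))"
    and "(\<integral>x. u x * (\<integral>y. \<Phi> y \<bullet> k (x - y) \<partial>lborel) \<partial>lborel) = (\<integral>y. correlation u k y \<bullet> \<Phi> y \<partial>lborel)"
proof -
  have [measurable]: "u \<in> borel_measurable borel" "k \<in> borel_measurable borel" "\<Phi> \<in> borel_measurable borel"
    using u(1) k \<Phi> by (auto dest: Lp_spaceD_measurable)
  have B: "B \<ge> 0" using \<Phi>(2)[of 0] norm_ge_zero by (rule order_trans[rotated])
  have nk: "integrable lborel (\<lambda>x. norm (k (x - y)))" "integrable lborel (\<lambda>x. norm (k (y - x)))" for y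
    using integrable_shift_iff[of "\<lambda>x. norm (k x)" y] integrable_reflect_iff[of "\<lambda>x. norm (k x)" y] k by auto
  have sec: "integrable lborel (\<lambda>y. \<Phi> y \<bullet> k (x - y))" for x
    by (rule Bochner_Integration.integrable_bound[where f="\<lambda>y. B * norm (k (x - y))"])
      (use nk B in \<open>auto intro!: order_trans[OF Cauchy_Schwarz_ineq2] mult_right_mono \<Phi>(2)\<close>)
  define W where "W x = (\<integral>y. \<bar>\<Phi> y \<bullet> k (x - y)\<bar> \<partial>lborel)" for x
  have [measurable]: "W \<in> borel_measurable borel" unfolding W_def[abs_def] by measurable
  have W_le: "W x \<le> (\<integral>y. norm (\<Phi> y) * norm (k (x - y)) \<partial>lborel)"
    "integrable lborel (\<lambda>y. norm (\<Phi> y) * norm (k (x - y)))" for x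
  proof -
    show i: "integrable lborel (\<lambda>y. norm (\<Phi> y) * norm (k (x - y)))"
      by (rule Bochner_Integration.integrable_bound[where f="\<lambda>y. B * norm (k (x - y))"])
        (use nk B in \<open>auto simp: abs_mult intro!: mult_right_mono \<Phi>(2)\<close>)
    show "W x \<le> (\<integral>y. norm (\<Phi> y) * norm (k (x - y)) \<partial>lborel)"
      unfolding W_def by (rule integral_mono) (use i sec Cauchy_Schwarz_ineq2 in auto)
  qed
  have W_bd: "\<bar>W x\<bar> \<le> B * (\<integral>y. norm (k y) \<partial>lborel)" for x
  proof -
    have "W x \<le> (\<integral>y. B * norm (k (x - y)) \<partial>lborel)"
      by (rule order_trans[OF W_le(1)], rule integral_mono)
        (use nk B W_le in \<open>auto intro!: mult_right_mono \<Phi>(2)\<close>)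
    then show ?thesis using integral_reflect[of "\<lambda>y. norm (k y)" x] by (simp add: W_def)
  qed
  have pair: "integrable (lborel \<Otimes>\<^sub>M lborel) (\<lambda>(y, x). norm (\<Phi> y) * norm (k (x - y)))"
    using integrable_pair_shift[of "\<lambda>y. norm (\<Phi> y)" "\<lambda>z. norm (k (- z))"] \<Phi>(1) k
      integrable_reflect_iff[of "\<lambda>z. norm (k z)" 0] by simp
  have W_int: "integrable lborel W"
    by (rule Bochner_Integration.integrable_bound[OF lborel_pair.integrable_snd[OF pair]])
      (use W_le(1) in \<open>auto simp: W_def intro!: order_trans[OF _ abs_ge_self]\<close>)
  have uW: "integrable lborel (\<lambda>x. norm (u x) * W x)"
    by (rule Lp_mult_integrable[OF u W_int W_bd])
  have full: "integrable (lborel \<Otimes>\<^sub>M lborel) (\<lambda>(x, y). u x * (\<Phi> y \<bullet> k (x - y)))"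
  proof (rule lborel_pair.Fubini_integrable)
    show "integrable lborel (\<lambda>x. \<integral>y. norm (case (x, y) of (x, y) \<Rightarrow> u x * (\<Phi> y \<bullet> k (x - y))) \<partial>lborel)"
      using uW by (simp add: abs_mult W_def)
    show "AE x in lborel. integrable lborel (\<lambda>y. case (x, y) of (x, y) \<Rightarrow> u x * (\<Phi> y \<bullet> k (x - y)))"
      using sec by auto
  qed measurable
  show "integrable lborel (\<lambda>x. u x * (\<integral>y. \<Phi> y \<bullet> k (x - y) \<partial>lborel))"
    using lborel_pair.integrable_fst[OF full] by simp
  have uk: "AE y in lborel. correlation u k y \<bullet> \<Phi> y = (\<integral>x. u x * (\<Phi> y \<bullet> k (x - y)) \<partial>lborel)"
  proof -
    have "AE y in lborel. integrable lborel (\<lambda>x. u x *\<^sub>R k (x - y))"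
    proof (cases "p = \<infinity>")
      case True
      then obtain C where C: "AE x in lborel. norm (u x) \<le> C" using Lp_space_infinityE u by blast
      have "integrable lborel (\<lambda>x. u x *\<^sub>R k (x - y))" for y
        by (rule Bochner_Integration.integrable_bound[where f="\<lambda>x. C * norm (k (x - y))"])
          (use nk C in \<open>auto elim!: eventually_mono intro!: order_trans[OF mult_right_mono abs_ge_self]\<close>)
      then show ?thesis by simp
    next
      case False
      have "1 \<le> enn2real p" using False u(2)
        by (metis enn2real_1 enn2real_mono infinity_ennreal_def top.not_eq_extremum)
      then show ?thesis
        using False u(1) k by (intro Young(1)[where q="enn2real p" and A="(\<integral>x. norm (k x) \<partial>lborel) + 1"])
         (auto simp: Lp_space_def add_nonneg_pos)
    qed
    then show ?thesis
    proof eventually_elim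
      case (elim y)
      then have "correlation u k y \<bullet> \<Phi> y = (\<integral>x. (u x *\<^sub>R k (x - y)) \<bullet> \<Phi> y \<partial>lborel)"
        unfolding correlation_def by (intro integral_inner_left[symmetric])
      then show ?case by (simp add: inner_commute)
    qed
  qed
  have "(\<integral>x. u x * (\<integral>y. \<Phi> y \<bullet> k (x - y) \<partial>lborel) \<partial>lborel) = (\<integral>y. (\<integral>x. u x * (\<Phi> y \<bullet> k (x - y)) \<partial>lborel) \<partial>lborel)"
    using lborel_pair.Fubini_integral[OF full] by simp
  also have "\<dots> = (\<integral>y. correlation u k y \<bullet> \<Phi> y \<partial>lborel)"
    by (rule integral_cong_AE) (use uk in auto)
  finally show "(\<integral>x. u x * (\<integral>y. \<Phi> y \<bullet> k (x - y) \<partial>lborel) \<partial>lborel) = (\<integral>y. correlation u k y \<bullet> \<Phi> y \<partial>lborel)" .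
qed

lemma powr_sum_le:
  fixes a b q :: real
  assumes "a \<ge> 0" "b \<ge> 0" "q \<ge> 1"
  shows "(a + b) powr q \<le> 2 powr q * (a powr q + b powr q)"
proof -
  have "(a + b) powr q \<le> (2 * max a b) powr q" using assms by (intro powr_mono2) auto
  also have "\<dots> = 2 powr q * max a b powr q" using assms by (simp add: powr_mult)
  also have "\<dots> \<le> 2 powr q * (a powr q + b powr q)" by (auto simp: max_def)
  finally show ?thesis .
qed

lemma powr_diff_integral_le:
  fixes f g :: "'a \<Rightarrow> 'b::euclidean_space"
  assumes [measurable]: "f \<in> borel_measurable M" "g \<in> borel_measurable M" and q: "q \<ge> 1"
    and f: "integrable M (\<lambda>x. norm (f x) powr q)" and g: "integrable M (\<lambda>x. norm (g x) powr q)"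
  shows "integrable M (\<lambda>x. norm (f x - g x) powr q)"
    and "(\<integral>x. norm (f x - g x) powr q \<partial>M)
      \<le> 2 powr q * ((\<integral>x. norm (f x) powr q \<partial>M) + (\<integral>x. norm (g x) powr q \<partial>M))"
proof -
  have le: "norm (f x - g x) powr q \<le> 2 powr q * (norm (f x) powr q + norm (g x) powr q)" for x
  proof -
    have "norm (f x - g x) powr q \<le> (norm (f x) + norm (g x)) powr q"
      using q by (intro powr_mono2 norm_triangle_ineq4) auto
    then show ?thesis using powr_sum_le[of "norm (f x)" "norm (g x)" q] q by simp
  qed
  show i: "integrable M (\<lambda>x. norm (f x - g x) powr q)"
    by (rule Bochner_Integration.integrable_bound
        [where f="\<lambda>x. 2 powr q * (norm (f x) powr q + norm (g x) powr q)"])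
      (use f g le in \<open>auto intro!: AE_I2 order_trans[OF _ abs_ge_self]\<close>)
  have "(\<integral>x. norm (f x - g x) powr q \<partial>M) \<le> (\<integral>x. 2 powr q * (norm (f x) powr q + norm (g x) powr q) \<partial>M)"
    by (rule integral_mono[OF i]) (use f g le in auto)
  then show "(\<integral>x. norm (f x - g x) powr q \<partial>M)
      \<le> 2 powr q * ((\<integral>x. norm (f x) powr q \<partial>M) + (\<integral>x. norm (g x) powr q \<partial>M))"
    using f g by simp
qed

lemma one_le_enn2real: "1 \<le> p \<Longrightarrow> p \<noteq> \<infinity> \<Longrightarrow> 1 \<le> enn2real p"
  by (metis enn2real_1 enn2real_mono infinity_ennreal_def top.not_eq_extremum)

lemma Lp_space_diff:
  assumes "f \<in> Lp_space M p" "g \<in> Lp_space M p" "1 \<le> p"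
  shows "(\<lambda>x. f x - g x) \<in> Lp_space M p"
proof (cases "p = \<infinity>")
  case True
  have [measurable]: "f \<in> borel_measurable M" "g \<in> borel_measurable M"
    using assms by (auto dest: Lp_spaceD_measurable)
  obtain B where B: "B \<ge> 0" "AE x in M. norm (f x) \<le> B"
    using assms(1) Lp_space_infinityE unfolding True by blast
  obtain C where C: "C \<ge> 0" "AE x in M. norm (g x) \<le> C"
    using assms(2) Lp_space_infinityE unfolding True by blast
  show ?thesis unfolding True
  proof (rule Lp_space_infinityI)
    show "AE x in M. norm (f x - g x) \<le> B + C"
      using B(2) C(2) by eventually_elim (meson norm_triangle_ineq4 order_trans add_mono)
  qed (use B C in auto)
next
  case False
  then show ?thesis
    using assms powr_diff_integral_le(1)[of f M g "enn2real p"] one_le_enn2real[of p]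
    by (auto simp: Lp_space_def)
qed

lemma correlation_Lp:
  assumes u: "u \<in> Lp_space lborel p" "1 \<le> p" and k: "integrable lborel k"
  shows "correlation u k \<in> Lp_space lborel p"
proof -
  have [measurable]: "u \<in> borel_measurable borel" "k \<in> borel_measurable borel"
    using u k by (auto dest: Lp_spaceD_measurable)
  show ?thesis
  proof (cases "p = \<infinity>")
    case True
    then obtain B where "B \<ge> 0" "AE x in lborel. norm (u x) \<le> B"
      using u Lp_space_infinityE by blast
    then have B: "B \<ge> 0" "AE x in lborel. \<bar>u x\<bar> \<le> B" by simp_all
    show ?thesis unfolding True
      by (rule Lp_space_infinityI[where B="(\<integral>x. norm (k x) \<partial>lborel) * B"])
        (use B Young_infinity[OF _ B(2) k] in auto)
  next
    case False
    have "integrable lborel (\<lambda>x. norm (correlation u k x) powr enn2real p)"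
      using u False k one_le_enn2real[OF u(2) False]
      by (intro Young(2)[where A="(\<integral>x. norm (k x) \<partial>lborel) + 1"]) (auto simp: Lp_space_def add_nonneg_pos)
    then show ?thesis using False by (simp add: Lp_space_def)
  qed
qed

lemma Lp_inner_integrable:
  fixes g \<Phi> :: "'a \<Rightarrow> 'b::euclidean_space"
  assumes g: "g \<in> Lp_space M p" "1 \<le> p"
    and \<Phi>: "integrable M \<Phi>" "\<And>x. norm (\<Phi> x) \<le> B"
  shows "integrable M (\<lambda>x. g x \<bullet> \<Phi> x)"
proof -
  have [measurable]: "g \<in> borel_measurable M" "\<Phi> \<in> borel_measurable M"
    using g \<Phi> by (auto dest: Lp_spaceD_measurable)
  show ?thesis
    by (rule Bochner_Integration.integrable_bound[OF Lp_mult_integrable[OF g, of "\<lambda>x. norm (\<Phi> x)"]])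
      (use \<Phi> Cauchy_Schwarz_ineq2 in auto)
qed

section \<open>Bounds for test fields\<close>

lemma test_field_continuous: "\<Phi> \<in> test_fields \<Longrightarrow> continuous_on UNIV \<Phi>"
  unfolding test_fields_def by (auto dest: spec[of _ 0])

lemma test_field_support:
  assumes "\<Phi> \<in> test_fields"
  obtains R where "R > 0" "\<And>x. norm x > R \<Longrightarrow> \<Phi> x = 0"
proof -
  have "bounded {x. \<Phi> x \<noteq> 0}"
    using assms unfolding test_fields_def
    by (auto intro: bounded_subset[OF compact_imp_bounded closure_subset])
  then obtain R where "R > 0" "\<forall>x\<in>{x. \<Phi> x \<noteq> 0}. norm x \<le> R" using bounded_pos by blast
  then show thesis using that[of R] by force
qed

lemma test_field_bounded:
  assumes "\<Phi> \<in> test_fields"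
  obtains B where "B \<ge> 0" "\<And>x. norm (\<Phi> x) \<le> B"
proof -
  obtain R where R: "R > 0" "\<And>x. norm x > R \<Longrightarrow> \<Phi> x = 0" using test_field_support assms by blast
  obtain B where B: "B > 0" "\<And>x. norm (\<Phi> x) \<le> B"
    using compactly_supported_continuous_bounded[OF test_field_continuous[OF assms], of R] R(2) by blast
  then show thesis using that[of B] B by auto
qed

text \<open>The partial derivatives are continuous, hence bounded on the ball, and they bound the operator norm of the
  derivative; the ball is convex.\<close>

lemma Ck_1_lipschitz_on_cball:
  fixes \<Phi> :: "'a::euclidean_space \<Rightarrow> 'b::euclidean_space"
  assumes "Ck 1 \<Phi>"
  obtains L where "L \<ge> 0" "\<And>x y. norm x \<le> R \<Longrightarrow> norm y \<le> R \<Longrightarrow> norm (\<Phi> x - \<Phi> y) \<le> L * norm (x - y)"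
proof -
  define D where "D x = frechet_derivative \<Phi> (at x)" for x
  have der: "(\<Phi> has_derivative D x) (at x)" for x
    using assms by (simp add: D_def frechet_derivative_works)
  have cont: "continuous_on UNIV (\<lambda>x. D x v)" for v using assms by (simp add: D_def)
  have "\<exists>M\<ge>0. \<forall>x. norm x \<le> R \<longrightarrow> norm (D x b) \<le> M" for b
  proof -
    obtain M where "M > 0" "\<And>x. norm x \<le> R \<Longrightarrow> norm (D x b) \<le> M"
      by (rule continuous_bounded_on_cball[OF cont[of b], of R]) (rule that)
    then show ?thesis by (intro exI[of _ M]) auto
  qed
  then obtain M where M: "\<And>b. M b \<ge> 0" "\<And>b x. norm x \<le> R \<Longrightarrow> norm (D x b) \<le> M b" by metis
  define L where "L = (\<Sum>b\<in>Basis. M b)"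
  have on: "onorm (D x) \<le> L" if "norm x \<le> R" for x
  proof (rule onorm_le)
    fix v
    have lin: "linear (D x)" using der has_derivative_linear by blast
    have "D x v = D x (\<Sum>b\<in>Basis. (v \<bullet> b) *\<^sub>R b)" by (simp add: euclidean_representation)
    also have "\<dots> = (\<Sum>b\<in>Basis. (v \<bullet> b) *\<^sub>R D x b)" by (simp add: linear_sum[OF lin] linear_scale[OF lin])
    also have "norm \<dots> \<le> (\<Sum>b\<in>Basis. norm v * M b)"
      by (rule sum_norm_le) (use M that Basis_le_norm in \<open>auto intro!: mult_mono\<close>)
    finally show "norm (D x v) \<le> L * norm v" by (simp add: L_def sum_distrib_left mult.commute)
  qed
  have "norm (\<Phi> x - \<Phi> y) \<le> L * norm (x - y)" if "norm x \<le> R" "norm y \<le> R" for x y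
    by (rule differentiable_bound[where S="cball 0 R" and f'=D])
      (use that on der in \<open>auto intro: has_derivative_at_withinI\<close>)
  then show thesis using that[of L] M by (simp add: L_def sum_nonneg)
qed

text \<open>The factor \<open>min 1 \<bar>x - y\<bar>\<close> is the one against which the kernel is integrable: the Lipschitz bound serves near
  the diagonal, the uniform bound far away from it.\<close>

lemma test_field_modulus:
  assumes "\<Phi> \<in> test_fields"
  obtains C where "C \<ge> 0" "\<And>x y. norm (\<Phi> x - \<Phi> y) \<le> C * min 1 (norm (x - y))"
proof -
  obtain R where R: "R > 0" "\<And>x. norm x > R \<Longrightarrow> \<Phi> x = 0" using test_field_support assms by blast
  obtain B where B: "B \<ge> 0" "\<And>x. norm (\<Phi> x) \<le> B" using test_field_bounded assms by blast
  have "Ck 1 \<Phi>" using assms by (simp add: test_fields_def del: Ck.simps)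
  then obtain L where L: "L \<ge> 0"
    "\<And>x y. norm x \<le> R + 1 \<Longrightarrow> norm y \<le> R + 1 \<Longrightarrow> norm (\<Phi> x - \<Phi> y) \<le> L * norm (x - y)"
    using Ck_1_lipschitz_on_cball by blast
  have "norm (\<Phi> x - \<Phi> y) \<le> (L + 2 * B) * min 1 (norm (x - y))" for x y
  proof (cases "norm (x - y) \<le> 1")
    case True
    \<comment> \<open>If one of the two points lies in the support, both lie in the ball of radius \<open>R + 1\<close>.\<close>
    have "norm (\<Phi> x - \<Phi> y) \<le> L * norm (x - y)"
    proof (cases "norm x \<le> R \<or> norm y \<le> R")
      case True
      have "norm x \<le> norm y + norm (x - y)" "norm y \<le> norm x + norm (x - y)"
        using norm_triangle_sub norm_triangle_sub[of y x] by (auto simp: norm_minus_commute)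
      then show ?thesis using True \<open>norm (x - y) \<le> 1\<close> by (intro L) linarith+
    qed (use R L in auto)
    also have "\<dots> \<le> (L + 2 * B) * norm (x - y)" using B by (intro mult_right_mono) auto
    finally show ?thesis using True by (simp add: min_def)
  next
    case False
    have "norm (\<Phi> x - \<Phi> y) \<le> 2 * B" using norm_triangle_ineq4[of "\<Phi> x" "\<Phi> y"] B(2)[of x] B(2)[of y] by linarith
    then show ?thesis using False L by (simp add: min_def)
  qed
  then show thesis using that[of "L + 2 * B"] B L by auto
qed

lemma test_field_integrable:
  assumes "\<Phi> \<in> test_fields"
  shows "integrable lborel \<Phi>"
proof -
  obtain R where R: "R > 0" "\<And>x. norm x > R \<Longrightarrow> \<Phi> x = 0" using test_field_support assms by blast
  obtain B where B: "B \<ge> 0" "\<And>x. norm (\<Phi> x) \<le> B" using test_field_bounded assms by blast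
  have [measurable]: "\<Phi> \<in> borel_measurable borel"
    by (rule borel_measurable_continuous_onI[OF test_field_continuous[OF assms]])
  have le: "norm (\<Phi> x) \<le> norm (B * indicator (cball 0 R) x)" for x
    using B R by (cases "norm x \<le> R") auto
  show ?thesis
  proof (rule Bochner_Integration.integrable_bound)
    show "integrable lborel (\<lambda>x. B * indicator (cball (0::'a) R) x)"
      by (intro integrable_mult_right integrable_indicator_cball)
  qed (use le in simp_all)
qed

section \<open>The nonlocal divergence and the change of the kernel\<close>

definition odd_levy_field :: "('a::euclidean_space \<Rightarrow> 'a) \<Rightarrow> bool" where
  "odd_levy_field \<kappa> \<longleftrightarrow> \<kappa> \<in> borel_measurable borel \<and> (\<forall>z. \<kappa> (- z) = - \<kappa> z) \<and>
     integrable lborel (\<lambda>z. min 1 (norm z) * norm (\<kappa> z))"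

definition div_field :: "('a::euclidean_space \<Rightarrow> 'a) \<Rightarrow> ('a \<Rightarrow> 'a) \<Rightarrow> 'a \<Rightarrow> real" where
  "div_field \<kappa> \<Phi> x = (\<integral>z. (\<Phi> x - \<Phi> (x - z)) \<bullet> \<kappa> z \<partial>lborel)"

lemma odd_levy_field_measurable: "odd_levy_field \<kappa> \<Longrightarrow> \<kappa> \<in> borel_measurable borel"
  by (simp add: odd_levy_field_def)

lemma difference_le:
  fixes \<Phi> :: "'a::euclidean_space \<Rightarrow> 'a"
  assumes C: "\<And>x y. norm (\<Phi> x - \<Phi> y) \<le> C * min 1 (norm (x - y))"
  shows "\<bar>(\<Phi> x - \<Phi> (x - z)) \<bullet> \<kappa> z\<bar> \<le> C * (min 1 (norm z) * norm (\<kappa> z))"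
proof -
  have "\<bar>(\<Phi> x - \<Phi> (x - z)) \<bullet> \<kappa> z\<bar> \<le> norm (\<Phi> x - \<Phi> (x - z)) * norm (\<kappa> z)" by (rule Cauchy_Schwarz_ineq2)
  also have "\<dots> \<le> (C * min 1 (norm z)) * norm (\<kappa> z)"
    using C[of x "x - z"] by (intro mult_right_mono) auto
  finally show ?thesis by (simp add: mult.assoc)
qed

lemma
  fixes \<Phi> :: "'a::euclidean_space \<Rightarrow> 'a"
  assumes \<kappa>: "odd_levy_field \<kappa>" and [measurable]: "\<Phi> \<in> borel_measurable borel"
    and C: "\<And>x y. norm (\<Phi> x - \<Phi> y) \<le> C * min 1 (norm (x - y))"
  shows div_field_integrand_integrable: "integrable lborel (\<lambda>z. (\<Phi> x - \<Phi> (x - z)) \<bullet> \<kappa> z)"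
    and div_field_bounded: "\<bar>div_field \<kappa> \<Phi> x\<bar> \<le> C * (\<integral>z. min 1 (norm z) * norm (\<kappa> z) \<partial>lborel)"
proof -
  have [measurable]: "\<kappa> \<in> borel_measurable borel" using \<kappa> by (rule odd_levy_field_measurable)
  have m: "integrable lborel (\<lambda>z. min 1 (norm z) * norm (\<kappa> z))" using \<kappa> by (simp add: odd_levy_field_def)
  show i: "integrable lborel (\<lambda>z. (\<Phi> x - \<Phi> (x - z)) \<bullet> \<kappa> z)"
    by (rule Bochner_Integration.integrable_bound[where f="\<lambda>z. C * (min 1 (norm z) * norm (\<kappa> z))"])
      (use m difference_le[where \<Phi>=\<Phi> and C=C, OF C] in \<open>auto intro!: AE_I2 order_trans[OF _ abs_ge_self]\<close>)
  have "\<bar>div_field \<kappa> \<Phi> x\<bar> \<le> (\<integral>z. \<bar>(\<Phi> x - \<Phi> (x - z)) \<bullet> \<kappa> z\<bar> \<partial>lborel)"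
    unfolding div_field_def by (rule integral_abs_bound)
  also have "\<dots> \<le> (\<integral>z. C * (min 1 (norm z) * norm (\<kappa> z)) \<partial>lborel)"
    by (rule integral_mono) (use i m difference_le[where \<Phi>=\<Phi> and C=C, OF C] in auto)
  finally show "\<bar>div_field \<kappa> \<Phi> x\<bar> \<le> C * (\<integral>z. min 1 (norm z) * norm (\<kappa> z) \<partial>lborel)" by simp
qed

lemma div_field_measurable:
  assumes [measurable]: "\<kappa> \<in> borel_measurable borel" "\<Phi> \<in> borel_measurable borel"
  shows "div_field \<kappa> \<Phi> \<in> borel_measurable borel"
  unfolding div_field_def[abs_def] by measurable

lemma test_field_measurable: "\<Phi> \<in> test_fields \<Longrightarrow> \<Phi> \<in> borel_measurable borel"
  by (rule borel_measurable_continuous_onI[OF test_field_continuous])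

text \<open>If \<open>\<Phi>\<close> vanishes outside a ball with indicator \<open>ind\<close>, then the integrand is dominated by
  \<open>C * min 1 \<bar>z\<bar> * \<bar>\<kappa> z\<bar> * (ind x + ind (x - z))\<close>, whose double integral is finite.\<close>

lemma div_field_integrable:
  fixes \<Phi> :: "'a::euclidean_space \<Rightarrow> 'a"
  assumes \<kappa>: "odd_levy_field \<kappa>" and \<Phi>: "\<Phi> \<in> test_fields"
  shows "integrable lborel (div_field \<kappa> \<Phi>)"
proof -
  have [measurable]: "\<kappa> \<in> borel_measurable borel" using \<kappa> by (rule odd_levy_field_measurable)
  have [measurable]: "\<Phi> \<in> borel_measurable borel" using \<Phi> by (rule test_field_measurable)
  obtain C where C: "C \<ge> 0" "\<And>x y. norm (\<Phi> x - \<Phi> y) \<le> C * min 1 (norm (x - y))"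
    using test_field_modulus[OF \<Phi>] by blast
  obtain R where R: "R > 0" "\<And>x. norm x > R \<Longrightarrow> \<Phi> x = 0" using test_field_support \<Phi> by blast
  define F where "F z = C * (min 1 (norm z) * norm (\<kappa> z))" for z
  have F: "integrable lborel F" using \<kappa> unfolding F_def by (simp add: odd_levy_field_def)
  have [measurable]: "F \<in> borel_measurable borel" using F by auto
  define ind :: "'a \<Rightarrow> real" where "ind = indicator (cball 0 R)"
  have ind: "integrable lborel ind" unfolding ind_def by (rule integrable_indicator_cball)
  have [measurable]: "ind \<in> borel_measurable borel" using ind by auto
  have "integrable (lborel \<Otimes>\<^sub>M lborel) (\<lambda>(z, x). F z * ind x)"
    by (rule lborel_pair.Fubini_integrable) (use F ind in \<open>auto simp: abs_mult\<close>)
  moreover have "integrable (lborel \<Otimes>\<^sub>M lborel) (\<lambda>(z, x). F z * ind (x - z))"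
    using integrable_pair_shift[OF F, of "\<lambda>x. ind (- x)"] integrable_reflect_iff[of ind 0] ind by simp
  ultimately have G: "integrable (lborel \<Otimes>\<^sub>M lborel) (\<lambda>(z, x). F z * ind x + F z * ind (x - z))"
    by (simp add: case_prod_beta' )
  have le: "\<bar>(\<Phi> x - \<Phi> (x - z)) \<bullet> \<kappa> z\<bar> \<le> F z * ind x + F z * ind (x - z)" for x z
  proof (cases "norm x \<le> R \<or> norm (x - z) \<le> R")
    case True
    have "\<bar>(\<Phi> x - \<Phi> (x - z)) \<bullet> \<kappa> z\<bar> \<le> F z"
      unfolding F_def using difference_le[where \<Phi>=\<Phi> and C=C] C by blast
    moreover have "F z \<ge> 0" using C by (simp add: F_def)
    ultimately show ?thesis using True by (auto simp: ind_def indicator_def)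
  qed (use R in \<open>auto simp: ind_def F_def C\<close>)
  have "integrable (lborel \<Otimes>\<^sub>M lborel) (\<lambda>(z, x). (\<Phi> x - \<Phi> (x - z)) \<bullet> \<kappa> z)"
    by (rule Bochner_Integration.integrable_bound[OF G])
      (use le in \<open>auto intro!: AE_I2 order_trans[OF _ abs_ge_self]\<close>)
  from lborel_pair.integrable_snd[OF this] show ?thesis by (simp add: div_field_def[abs_def])
qed

lemma Lp_mult_div_field_integrable:
  assumes u: "u \<in> Lp_space lborel p" "1 \<le> p" and \<kappa>: "odd_levy_field \<kappa>" and \<Phi>: "\<Phi> \<in> test_fields"
  shows "integrable lborel (\<lambda>x. u x * div_field \<kappa> \<Phi> x)"
proof -
  obtain C where C: "C \<ge> 0" "\<And>x y. norm (\<Phi> x - \<Phi> y) \<le> C * min 1 (norm (x - y))"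
    using test_field_modulus[OF \<Phi>] by blast
  have [measurable]: "u \<in> borel_measurable borel" using u by (auto dest: Lp_spaceD_measurable)
  have [measurable]: "div_field \<kappa> \<Phi> \<in> borel_measurable borel"
    by (rule div_field_measurable[OF odd_levy_field_measurable[OF \<kappa>] test_field_measurable[OF \<Phi>]])
  have "integrable lborel (\<lambda>x. norm (u x) * div_field \<kappa> \<Phi> x)"
    by (rule Lp_mult_integrable[OF u div_field_integrable[OF \<kappa> \<Phi>]
          div_field_bounded[OF \<kappa> test_field_measurable[OF \<Phi>] C(2)]])
  then show ?thesis
    by (rule Bochner_Integration.integrable_bound) (auto simp: abs_mult)
qed

text \<open>For the integrable field \<open>k = \<kappa>1 - \<kappa>2\<close> the two terms of the difference \<open>\<Phi> x - \<Phi> (x - z)\<close> may be integrated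
  separately, and the first one contributes \<open>\<Phi> x \<bullet> \<integral> k = 0\<close> by oddness.\<close>

lemma div_field_change_kernel:
  fixes \<Phi> :: "'a::euclidean_space \<Rightarrow> 'a"
  assumes \<kappa>1: "odd_levy_field \<kappa>1" and \<kappa>2: "odd_levy_field \<kappa>2"
    and k: "integrable lborel (\<lambda>z. \<kappa>1 z - \<kappa>2 z)" and \<Phi>: "\<Phi> \<in> test_fields"
  shows "div_field \<kappa>1 \<Phi> x - div_field \<kappa>2 \<Phi> x = - (\<integral>y. \<Phi> y \<bullet> (\<kappa>1 (x - y) - \<kappa>2 (x - y)) \<partial>lborel)"
proof -
  define k' where "k' z = \<kappa>1 z - \<kappa>2 z" for z
  have [measurable]: "\<kappa>1 \<in> borel_measurable borel" "\<kappa>2 \<in> borel_measurable borel"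
    using \<kappa>1 \<kappa>2 by (auto dest: odd_levy_field_measurable)
  have [measurable]: "k' \<in> borel_measurable borel" unfolding k'_def[abs_def] by measurable
  have [measurable]: "\<Phi> \<in> borel_measurable borel" using \<Phi> by (rule test_field_measurable)
  obtain C where C: "C \<ge> 0" "\<And>x y. norm (\<Phi> x - \<Phi> y) \<le> C * min 1 (norm (x - y))"
    using test_field_modulus[OF \<Phi>] by blast
  obtain B where B: "B \<ge> 0" "\<And>x. norm (\<Phi> x) \<le> B" using test_field_bounded \<Phi> by blast
  have k: "integrable lborel k'" using k by (simp add: k'_def[abs_def])
  have odd: "k' (- z) = - k' z" for z using \<kappa>1 \<kappa>2 by (simp add: k'_def odd_levy_field_def)
  have "(\<integral>z. k' z \<partial>lborel) = (\<integral>z. k' (0 - z) \<partial>lborel)" by (rule integral_reflect[symmetric]) simp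
  also have "\<dots> = - (\<integral>z. k' z \<partial>lborel)" by (simp add: odd)
  finally have zero: "(\<integral>z. k' z \<partial>lborel) = 0"
    by (metis add.inverse_inverse eq_neg_iff_add_eq_0 scaleR_2 scaleR_eq_0_iff zero_neq_numeral)
  have iP: "integrable lborel (\<lambda>z. \<Phi> (x - z) \<bullet> k' z)"
    by (rule Bochner_Integration.integrable_bound[where f="\<lambda>z. B * norm (k' z)"])
      (use k B in \<open>auto intro!: order_trans[OF Cauchy_Schwarz_ineq2] mult_right_mono\<close>)
  have "div_field \<kappa>1 \<Phi> x - div_field \<kappa>2 \<Phi> x
      = (\<integral>z. (\<Phi> x - \<Phi> (x - z)) \<bullet> \<kappa>1 z - (\<Phi> x - \<Phi> (x - z)) \<bullet> \<kappa>2 z \<partial>lborel)"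
    unfolding div_field_def
    using div_field_integrand_integrable[OF \<kappa>1 _ C(2)] div_field_integrand_integrable[OF \<kappa>2 _ C(2)] by simp
  also have "\<dots> = (\<integral>z. \<Phi> x \<bullet> k' z - \<Phi> (x - z) \<bullet> k' z \<partial>lborel)"
    by (simp add: k'_def inner_diff algebra_simps)
  also have "\<dots> = \<Phi> x \<bullet> (\<integral>z. k' z \<partial>lborel) - (\<integral>z. \<Phi> (x - z) \<bullet> k' z \<partial>lborel)"
    using k iP by simp
  also have "(\<integral>z. \<Phi> (x - z) \<bullet> k' z \<partial>lborel) = (\<integral>y. \<Phi> (x - (x - y)) \<bullet> k' (x - y) \<partial>lborel)"
    by (rule integral_reflect[where f="\<lambda>z. \<Phi> (x - z) \<bullet> k' z", symmetric]) measurable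
  finally have "div_field \<kappa>1 \<Phi> x - div_field \<kappa>2 \<Phi> x = - (\<integral>y. \<Phi> y \<bullet> k' (x - y) \<partial>lborel)"
    by (simp add: zero)
  then show ?thesis by (simp add: k'_def)
qed

text \<open>A relation, as the gradient of \<open>u\<close> is determined only up to null sets.\<close>

definition weak_grad :: "('a::euclidean_space \<Rightarrow> 'a) \<Rightarrow> ('a \<Rightarrow> real) \<Rightarrow> ('a \<Rightarrow> 'a) \<Rightarrow> bool" where
  "weak_grad \<kappa> u g \<longleftrightarrow> (\<forall>\<Phi>\<in>test_fields. - (\<integral>x. u x * div_field \<kappa> \<Phi> x \<partial>lborel) = (\<integral>x. g x \<bullet> \<Phi> x \<partial>lborel))"

lemma weak_grad_change_kernel:
  fixes u :: "'a::euclidean_space \<Rightarrow> real"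
  assumes \<kappa>1: "odd_levy_field \<kappa>1" and \<kappa>2: "odd_levy_field \<kappa>2"
    and k: "integrable lborel (\<lambda>z. \<kappa>1 z - \<kappa>2 z)"
    and u: "u \<in> Lp_space lborel p" and p: "1 \<le> p" and g: "g \<in> Lp_space lborel p" and wg: "weak_grad \<kappa>1 u g"
  shows "weak_grad \<kappa>2 u (\<lambda>y. g y - correlation u (\<lambda>z. \<kappa>1 z - \<kappa>2 z) y)"
  unfolding weak_grad_def
proof
  fix \<Phi> :: "'a \<Rightarrow> 'a" assume \<Phi>: "\<Phi> \<in> test_fields"
  define k' where "k' z = \<kappa>1 z - \<kappa>2 z" for z
  have k': "integrable lborel k'" using k by (simp add: k'_def[abs_def])
  obtain B where B: "\<And>x. norm (\<Phi> x) \<le> B" using test_field_bounded \<Phi> by blast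
  note \<Phi>_int = test_field_integrable[OF \<Phi>]
  note dual = correlation_duality[OF u p k' \<Phi>_int B]
  have "(\<integral>x. u x * div_field \<kappa>2 \<Phi> x \<partial>lborel)
      = (\<integral>x. u x * div_field \<kappa>1 \<Phi> x + u x * (\<integral>y. \<Phi> y \<bullet> k' (x - y) \<partial>lborel) \<partial>lborel)"
  proof (rule Bochner_Integration.integral_cong[OF refl])
    fix x
    have "div_field \<kappa>2 \<Phi> x = div_field \<kappa>1 \<Phi> x + (\<integral>y. \<Phi> y \<bullet> k' (x - y) \<partial>lborel)"
      using div_field_change_kernel[OF \<kappa>1 \<kappa>2 k \<Phi>, of x] by (simp add: k'_def)
    then show "u x * div_field \<kappa>2 \<Phi> x = u x * div_field \<kappa>1 \<Phi> x + u x * (\<integral>y. \<Phi> y \<bullet> k' (x - y) \<partial>lborel)"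
      by (simp add: distrib_left)
  qed
  also have "\<dots> = (\<integral>x. u x * div_field \<kappa>1 \<Phi> x \<partial>lborel) + (\<integral>y. correlation u k' y \<bullet> \<Phi> y \<partial>lborel)"
    using Lp_mult_div_field_integrable[OF u p \<kappa>1 \<Phi>] dual by simp
  finally have "- (\<integral>x. u x * div_field \<kappa>2 \<Phi> x \<partial>lborel)
      = (\<integral>x. g x \<bullet> \<Phi> x \<partial>lborel) - (\<integral>y. correlation u k' y \<bullet> \<Phi> y \<partial>lborel)"
    using wg \<Phi> by (simp add: weak_grad_def)
  also have "\<dots> = (\<integral>x. (g x - correlation u k' x) \<bullet> \<Phi> x \<partial>lborel)"
    using Lp_inner_integrable[OF g p \<Phi>_int B]
      Lp_inner_integrable[OF correlation_Lp[OF u p k'] p \<Phi>_int B]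
    by (simp add: inner_diff_left)
  finally show "- (\<integral>x. u x * div_field \<kappa>2 \<Phi> x \<partial>lborel)
      = (\<integral>x. (g x - correlation u (\<lambda>z. \<kappa>1 z - \<kappa>2 z) x) \<bullet> \<Phi> x \<partial>lborel)"
    by (simp add: k'_def[abs_def])
qed

lemma weak_grad_unique:
  fixes u :: "'a::euclidean_space \<Rightarrow> real"
  assumes g: "g \<in> Lp_space lborel p" "weak_grad \<kappa> u g"
    and g': "g' \<in> Lp_space lborel p" "weak_grad \<kappa> u g'" and p: "1 \<le> p"
  shows "AE x in lborel. g x = g' x"
proof -
  define d where "d x = g x - g' x" for x
  have d: "d \<in> Lp_space lborel p" unfolding d_def[abs_def] by (rule Lp_space_diff[OF g(1) g'(1) p])
  have "AE x in lborel. d x = 0"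
  proof (rule vanishing_on_test_fields_imp_AE_zero)
    show "d \<in> borel_measurable borel" using d by (auto dest: Lp_spaceD_measurable)
    show "integrable lborel (\<lambda>x. indicator (cball 0 R) x * norm (d x))" for R
    proof -
      have "integrable lborel (\<lambda>x. norm (d x) * indicator (cball 0 R) x)"
        by (rule Lp_mult_integrable[OF d p integrable_indicator_cball, where B=1])
          (simp add: indicator_def)
      then show ?thesis by (simp add: mult.commute)
    qed
    fix \<Phi> :: "'a \<Rightarrow> 'a" assume \<Phi>: "\<Phi> \<in> test_fields"
    obtain B where B: "\<And>x. norm (\<Phi> x) \<le> B" using test_field_bounded \<Phi> by blast
    have "(\<integral>x. d x \<bullet> \<Phi> x \<partial>lborel) = (\<integral>x. g x \<bullet> \<Phi> x \<partial>lborel) - (\<integral>x. g' x \<bullet> \<Phi> x \<partial>lborel)"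
      unfolding d_def inner_diff_left
      by (intro Bochner_Integration.integral_diff Lp_inner_integrable[OF g(1) p test_field_integrable[OF \<Phi>] B]
        Lp_inner_integrable[OF g'(1) p test_field_integrable[OF \<Phi>] B])
    also have "\<dots> = 0" 
      using bspec[OF g(2)[unfolded weak_grad_def] \<Phi>] bspec[OF g'(2)[unfolded weak_grad_def] \<Phi>] by simp
    finally show "(\<integral>x. d x \<bullet> \<Phi> x \<partial>lborel) = 0" .
  qed
  then show ?thesis by (simp add: d_def)
qed

section \<open>Injectivity of the nonlocal gradient\<close>

text \<open>Up to a factor of modulus one, the component in direction \<open>a\<close> of the Fourier symbol of the nonlocal
  gradient: the even part of the exponential does not contribute because \<open>\<kappa>\<close> is odd.\<close>

definition sine_transform :: "('a::euclidean_space \<Rightarrow> 'a) \<Rightarrow> 'a \<Rightarrow> 'a \<Rightarrow> real" where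
  "sine_transform \<kappa> a \<xi> = (\<integral>z. sin (z \<bullet> \<xi>) * (\<kappa> z \<bullet> a) \<partial>lborel)"

lemma abs_sin_inner_le: "\<bar>sin (z \<bullet> \<xi>)\<bar> \<le> (1 + norm \<xi>) * min 1 (norm (z::'a::euclidean_space))"
proof -
  have "\<bar>sin (z \<bullet> \<xi>)\<bar> \<le> norm z * norm \<xi>"
    using abs_sin_x_le_abs_x[of "z \<bullet> \<xi>"] Cauchy_Schwarz_ineq2[of z \<xi>] by linarith
  also have "\<dots> \<le> (1 + norm \<xi>) * norm z" by (simp add: algebra_simps)
  finally have "\<bar>sin (z \<bullet> \<xi>)\<bar> \<le> (1 + norm \<xi>) * norm z" .
  moreover have "\<bar>sin (z \<bullet> \<xi>)\<bar> \<le> 1 + norm \<xi>"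
    by (rule order_trans[OF abs_sin_le_one]) simp
  ultimately show ?thesis by (simp add: min_def)
qed

lemma abs_sine_integrand_le:
  "\<bar>sin (z \<bullet> \<xi>) * (\<kappa> z \<bullet> a)\<bar> \<le> ((1 + norm \<xi>) * norm a) * (min 1 (norm z) * norm (\<kappa> (z::'a::euclidean_space)))"
proof -
  have "\<bar>sin (z \<bullet> \<xi>)\<bar> * \<bar>\<kappa> z \<bullet> a\<bar> \<le> ((1 + norm \<xi>) * min 1 (norm z)) * (norm (\<kappa> z) * norm a)"
    by (intro mult_mono abs_sin_inner_le Cauchy_Schwarz_ineq2) auto
  then show ?thesis by (simp add: abs_mult mult_ac)
qed

lemma sine_integrand_integrable:
  assumes "odd_levy_field \<kappa>"
  shows "integrable lborel (\<lambda>z. sin (z \<bullet> \<xi>) * (\<kappa> z \<bullet> a))"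
proof -
  have [measurable]: "\<kappa> \<in> borel_measurable borel" using assms by (rule odd_levy_field_measurable)
  show ?thesis
    by (rule Bochner_Integration.integrable_bound
        [where f="\<lambda>z. ((1 + norm \<xi>) * norm a) * (min 1 (norm z) * norm (\<kappa> z))"])
      (use assms abs_sine_integrand_le[of _ \<xi> \<kappa> a] in
        \<open>auto simp: odd_levy_field_def intro!: AE_I2 order_trans[OF _ abs_ge_self]\<close>)
qed

lemma isCont_sine_transform:
  assumes "odd_levy_field \<kappa>"
  shows "isCont (sine_transform \<kappa> a) \<xi>"
  unfolding continuous_at_sequentially
proof (intro allI impI)
  fix X assume X: "X \<longlonglongrightarrow> \<xi>"
  have [measurable]: "\<kappa> \<in> borel_measurable borel" using assms by (rule odd_levy_field_measurable)
  obtain M where M: "\<And>n. norm (X n) \<le> M" using X convergent_imp_Bseq[of X] by (auto simp: convergent_def Bseq_def)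
  show "(sine_transform \<kappa> a \<circ> X) \<longlonglongrightarrow> sine_transform \<kappa> a \<xi>"
    unfolding sine_transform_def o_def
  proof (rule integral_dominated_convergence
      [where w="\<lambda>z. ((1 + M) * norm a) * (min 1 (norm z) * norm (\<kappa> z))"])
    show "integrable lborel (\<lambda>z. ((1 + M) * norm a) * (min 1 (norm z) * norm (\<kappa> z)))"
      using assms by (simp add: odd_levy_field_def)
    show "AE z in lborel. (\<lambda>n. sin (z \<bullet> X n) * (\<kappa> z \<bullet> a)) \<longlonglongrightarrow> sin (z \<bullet> \<xi>) * (\<kappa> z \<bullet> a)"
      by (intro AE_I2 tendsto_intros X)
    show "AE z in lborel. norm (sin (z \<bullet> X n) * (\<kappa> z \<bullet> a)) \<le> ((1 + M) * norm a) * (min 1 (norm z) * norm (\<kappa> z))" for n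
    proof (rule AE_I2)
      fix z
      have "norm (sin (z \<bullet> X n) * (\<kappa> z \<bullet> a)) \<le> ((1 + norm (X n)) * norm a) * (min 1 (norm z) * norm (\<kappa> z))"
        using abs_sine_integrand_le[of z "X n" \<kappa> a] by simp
      also have "\<dots> \<le> ((1 + M) * norm a) * (min 1 (norm z) * norm (\<kappa> z))"
        using M[of n] by (intro mult_right_mono) auto
      finally show "norm (sin (z \<bullet> X n) * (\<kappa> z \<bullet> a)) \<le> ((1 + M) * norm a) * (min 1 (norm z) * norm (\<kappa> z))" .
    qed
  qed measurable
qed

text \<open>The weight \<open>1 - t\<close> is chosen such that the integral has the sign of \<open>s\<close>: multiplied by \<open>s\<close>, it is
  \<open>1 - sin s / s > 0\<close>.\<close>

lemma triangle_weighted_sine: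
  fixes s :: real
  assumes "s \<noteq> 0"
  shows "(\<integral>t. indicator {0..1} t *\<^sub>R ((1 - t) * sin (t * s)) \<partial>lborel) = 1 / s - sin s / s\<^sup>2"
proof -
  have "has_bochner_integral lborel (\<lambda>t. indicator {0..1} t *\<^sub>R ((1 - t) * sin (t * s)))
     ((- (1 - 1) * cos (1 * s) / s - sin (1 * s) / s\<^sup>2) - (- (1 - 0) * cos (0 * s) / s - sin (0 * s) / s\<^sup>2))"
  proof (rule has_bochner_integral_FTC_Icc[where F="\<lambda>t. - (1 - t) * cos (t * s) / s - sin (t * s) / s\<^sup>2"])
    fix t :: real
    show "((\<lambda>t. - (1 - t) * cos (t * s) / s - sin (t * s) / s\<^sup>2) has_vector_derivative (1 - t) * sin (t * s)) (at t within {0..1})"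
      unfolding has_real_derivative_iff_has_vector_derivative[symmetric]
      using assms by (auto intro!: derivative_eq_intros simp: field_simps power2_eq_square)
  qed (auto intro!: continuous_intros)
  then show ?thesis
    by (simp add: has_bochner_integral_iff)
qed

lemma abs_sin_less: 
  fixes s :: real
  assumes "s \<noteq> 0" shows "\<bar>sin s\<bar> < \<bar>s\<bar>"
proof (cases "sin (s / 2) = 0")
  case True
  then show ?thesis using assms sin_double[of "s / 2"] by simp
next
  case False
  then have "(cos (s / 2))\<^sup>2 < 1" using sin_cos_squared_add[of "s / 2"] zero_less_power2 by (smt (verit))
  then have "\<bar>cos (s / 2)\<bar> < 1" by (simp add: abs_square_less_1)
  then have "2 * \<bar>sin (s / 2)\<bar> * \<bar>cos (s / 2)\<bar> < 2 * \<bar>sin (s / 2)\<bar> * 1"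
    using False by (intro mult_strict_left_mono) auto
  also have "\<dots> \<le> \<bar>s\<bar>" using abs_sin_x_le_abs_x[of "s / 2"] by simp
  finally show ?thesis using sin_double[of "s / 2"] by (simp add: abs_mult)
qed

text \<open>Averaging the transform over the segment of the frequencies \<open>t *\<^sub>R e\<close>, \<open>0 \<le> t \<le> 1\<close>, with weight \<open>1 - t\<close>
  gives by Fubini the integral of \<open>c z * (1 - sin (z \<bullet> e) / (z \<bullet> e))\<close>. The integrand is nonnegative, and
  positive for almost all small \<open>z\<close>.\<close>

lemma sine_transform_nonzero:
  fixes \<kappa> :: "'a::euclidean_space \<Rightarrow> 'a"
  assumes \<kappa>: "odd_levy_field \<kappa>" and c: "\<And>z. \<kappa> z = c z *\<^sub>R z" "\<And>z. c z \<ge> 0"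
    and pos: "\<epsilon> > 0" "AE z in lborel. norm z < \<epsilon> \<longrightarrow> c z > 0" and e: "e \<in> Basis"
  shows "\<exists>t. sine_transform \<kappa> e (t *\<^sub>R e) \<noteq> 0"
proof (rule ccontr)
  assume "\<not> ?thesis"
  then have S0: "sine_transform \<kappa> e (t *\<^sub>R e) = 0" for t by blast
  have [measurable]: "\<kappa> \<in> borel_measurable borel" using \<kappa> by (rule odd_levy_field_measurable)
  define m where "m = (\<integral>z. min 1 (norm z) * norm (\<kappa> z) \<partial>lborel)"
  define F :: "real \<Rightarrow> 'a \<Rightarrow> real" where
    "F t z = (indicator {0..1} t * (1 - t)) * (sin (z \<bullet> (t *\<^sub>R e)) * (\<kappa> z \<bullet> e))" for t z
  have F_int: "integrable lborel (F t)" for t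
    unfolding F_def by (rule integrable_mult_right[OF sine_integrand_integrable[OF \<kappa>]])
  have F_le: "norm (F t z) \<le> (2 * indicator {0..1} t) * (min 1 (norm z) * norm (\<kappa> z))" for t z
  proof (cases "t \<in> {0..1}")
    case True
    have "\<bar>F t z\<bar> = (1 - t) * \<bar>sin (z \<bullet> (t *\<^sub>R e)) * (\<kappa> z \<bullet> e)\<bar>" using True by (simp add: F_def abs_mult)
    also have "\<dots> \<le> 1 * (((1 + norm (t *\<^sub>R e)) * norm e) * (min 1 (norm z) * norm (\<kappa> z)))"
      using True by (intro mult_mono abs_sine_integrand_le) auto
    also have "\<dots> \<le> 2 * (min 1 (norm z) * norm (\<kappa> z))"
      using True e by (auto intro!: mult_right_mono)
    finally show ?thesis using True by simp
  qed (simp add: F_def)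
  have mF[measurable]: "(\<lambda>(t, z). F t z) \<in> borel_measurable (lborel \<Otimes>\<^sub>M lborel)"
    unfolding F_def by measurable
  have "integrable (lborel \<Otimes>\<^sub>M lborel) (\<lambda>(t :: real, z). (2 * indicator {0..1} t) * (min 1 (norm z) * norm (\<kappa> z)))"
  proof (rule lborel_pair.Fubini_integrable)
    have "integrable lborel (indicator {0..1} :: real \<Rightarrow> real)"
      by (rule integrable_real_indicator) auto
    then show "integrable lborel (\<lambda>t. \<integral>z. norm (case (t :: real, z) of (t, z) \<Rightarrow>
        (2 * indicator {0..1} t) * (min 1 (norm z) * norm (\<kappa> z))) \<partial>lborel)"
      by (simp add: abs_mult)
    show "AE t in lborel. integrable lborel (\<lambda>z. case (t :: real, z) of (t, z) \<Rightarrow>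
        (2 * indicator {0..1} t) * (min 1 (norm z) * norm (\<kappa> z)))"
      using \<kappa> by (simp add: odd_levy_field_def)
  qed measurable
  then have pair: "integrable (lborel \<Otimes>\<^sub>M lborel) (\<lambda>(t, z). F t z)"
    by (rule Bochner_Integration.integrable_bound)
      (use F_le in \<open>auto intro!: AE_I2 order_trans[OF _ abs_ge_self]\<close>)
  define W where "W z = (\<integral>t. F t z \<partial>lborel)" for z
  have W: "integrable lborel W" unfolding W_def using lborel_pair.integrable_snd[OF pair] .
  have "(\<integral>z. W z \<partial>lborel) = (\<integral>t. (\<integral>z. F t z \<partial>lborel) \<partial>lborel)"
    unfolding W_def by (rule lborel_pair.Fubini_integral[OF pair])
  also have "(\<integral>z. F t z \<partial>lborel) = 0" for t
    using S0[of t] by (simp add: F_def sine_transform_def)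
  then have "(\<integral>t. (\<integral>z. F t z \<partial>lborel) \<partial>lborel) = 0" by simp
  finally have W0: "(\<integral>z. W z \<partial>lborel) = 0" .
  have W_eq: "W z = c z * (1 - sin (z \<bullet> e) / (z \<bullet> e))" if "z \<bullet> e \<noteq> 0" for z
  proof -
    have "W z = (\<integral>t. (\<kappa> z \<bullet> e) * (indicator {0..1} t *\<^sub>R ((1 - t) * sin (t * (z \<bullet> e)))) \<partial>lborel)"
      unfolding W_def F_def by (simp add: mult_ac)
    also have "\<dots> = (\<kappa> z \<bullet> e) * (1 / (z \<bullet> e) - sin (z \<bullet> e) / (z \<bullet> e)\<^sup>2)"
      unfolding triangle_weighted_sine[OF that, symmetric] by (rule integral_mult_right_zero)
    also have "\<dots> = c z * (1 - sin (z \<bullet> e) / (z \<bullet> e))"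
      using that by (simp add: c field_simps power2_eq_square)
    finally show ?thesis .
  qed
  have W_zero: "W z = 0" if "z \<bullet> e = 0" for z
    using that by (simp add: W_def F_def)
  have sinc: "1 - sin s / s > 0" if "s \<noteq> 0" for s :: real
  proof -
    have "\<bar>sin s\<bar> < \<bar>s\<bar>" using that by (rule abs_sin_less)
    then have "\<bar>sin s / s\<bar> < 1" using that by (simp add: abs_divide)
    then show ?thesis by linarith
  qed
  have "AE z in lborel. W z = 0"
  proof (subst integral_nonneg_eq_0_iff_AE[symmetric, OF W])
    show "AE z in lborel. 0 \<le> W z"
    proof (rule AE_I2)
      fix z show "0 \<le> W z" using W_eq[of z] W_zero[of z] c(2)[of z] sinc[of "z \<bullet> e"]
        by (cases "z \<bullet> e = 0") (auto intro!: mult_nonneg_nonneg)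
    qed
  qed (fact W0)
  moreover have "AE z in lborel. z \<bullet> e \<noteq> 0"
  proof -
    have "e \<noteq> 0" using e by auto
    then have "negligible {z. e \<bullet> z = 0}" by (intro negligible_hyperplane) auto
    then have "{z. e \<bullet> z = 0} \<in> null_sets lebesgue" by (simp add: negligible_iff_null_sets)
    then have "AE z in lebesgue. z \<notin> {z. e \<bullet> z = 0}" by (rule AE_not_in)
    then show ?thesis by (simp add: AE_completion_iff inner_commute)
  qed
  ultimately have "AE z in lborel. z \<notin> ball (0::'a) \<epsilon>"
    using pos(2)
  proof eventually_elim
    case (elim z)
    then show ?case using W_eq[of z] sinc[of "z \<bullet> e"] by auto
  qed
  then have "ball (0::'a) \<epsilon> \<in> null_sets lborel" by (subst AE_iff_null_sets) auto
  then have "emeasure lborel (ball (0::'a) \<epsilon>) = 0" by auto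
  then have "measure lborel (ball (0::'a) \<epsilon>) = 0" by (simp add: measure_def)
  then show False using content_ball_pos[OF pos(1), of "0::'a"] by simp
qed

lemma cutoff_eq_scaled: "cutoff R x = cutoff 1 (x /\<^sub>R R)"
  by (simp add: cutoff_def divide_inverse)

text \<open>The point is uniformity in \<open>R\<close>: large cutoffs are dilations of the one with \<open>R = 1\<close>.\<close>

lemma cutoff_modulus:
  obtains L where "L \<ge> 0" "\<And>R x y. R \<ge> 1 \<Longrightarrow> \<bar>cutoff R x - cutoff R (y::'a::euclidean_space)\<bar> \<le> L * min 1 (norm (x - y))"
proof -
  obtain b :: 'a where b: "b \<in> Basis" using nonempty_Basis by blast
  define \<phi> where "\<phi> x = (cutoff 1 x * 1) *\<^sub>R b" for x :: 'a
  have "\<phi> \<in> test_fields"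
    unfolding \<phi>_def[abs_def] by (rule test_field_cutoff[OF elementary.const]) simp
  then obtain L where L: "L \<ge> 0" "\<And>x y. norm (\<phi> x - \<phi> y) \<le> L * min 1 (norm (x - y))"
    using test_field_modulus by blast
  have L': "\<bar>cutoff 1 x - cutoff 1 y\<bar> \<le> L * min 1 (norm (x - y))" for x y :: 'a
    using L(2)[of x y] b by (simp add: \<phi>_def scaleR_diff_left[symmetric])
  have "\<bar>cutoff R x - cutoff R y\<bar> \<le> L * min 1 (norm (x - y))" if "R \<ge> 1" for R and x y :: 'a
  proof -
    have "\<bar>cutoff R x - cutoff R y\<bar> \<le> L * min 1 (norm (x /\<^sub>R R - y /\<^sub>R R))"
      by (subst (1 2) cutoff_eq_scaled) (rule L')
    also have "\<dots> \<le> L * min 1 (norm (x - y))"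
    proof (intro mult_left_mono L min.mono order_refl)
      have "norm (x /\<^sub>R R - y /\<^sub>R R) = norm (x - y) / R"
        using that by (simp add: scaleR_diff_right[symmetric] divide_inverse mult.commute)
      also have "\<dots> \<le> norm (x - y) / 1" by (rule divide_left_mono) (use that in auto)
      finally show "norm (x /\<^sub>R R - y /\<^sub>R R) \<le> norm (x - y)" by simp
    qed
    finally show ?thesis .
  qed
  then show thesis using that L by blast
qed

lemma abs_sin_diff_le: "\<bar>sin x - sin y\<bar> \<le> \<bar>x - (y::real)\<bar>"
proof -
  have "\<bar>sin x - sin y\<bar> = 2 * \<bar>sin ((x - y) / 2)\<bar> * \<bar>cos ((x + y) / 2)\<bar>"
    by (simp add: sin_diff_sin abs_mult)
  also have "\<dots> \<le> 2 * \<bar>(x - y) / 2\<bar> * 1"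
    by (intro mult_mono mult_left_mono abs_sin_x_le_abs_x) auto
  finally show ?thesis by simp
qed

lemma cut_off_wave_modulus:
  obtains C where "C \<ge> 0" "\<And>R x y. R \<ge> 1 \<Longrightarrow>
    norm ((cutoff R x * sin (x \<bullet> \<xi> + c)) *\<^sub>R a - (cutoff R y * sin (y \<bullet> \<xi> + c)) *\<^sub>R a)
      \<le> C * min 1 (norm (x - (y::'a::euclidean_space)))"
proof -
  obtain L where L: "L \<ge> 0"
    "\<And>R x y. R \<ge> 1 \<Longrightarrow> \<bar>cutoff R x - cutoff R (y::'a)\<bar> \<le> L * min 1 (norm (x - y))"
    using cutoff_modulus by blast
  have s: "\<bar>sin (x \<bullet> \<xi> + c) - sin (y \<bullet> \<xi> + c)\<bar> \<le> (2 + norm \<xi>) * min 1 (norm (x - y))" for x y :: 'a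
  proof -
    have "\<bar>sin (x \<bullet> \<xi> + c) - sin (y \<bullet> \<xi> + c)\<bar> \<le> \<bar>(x - y) \<bullet> \<xi>\<bar>"
      using abs_sin_diff_le[of "x \<bullet> \<xi> + c" "y \<bullet> \<xi> + c"] by (simp add: inner_diff_left)
    also have "\<dots> \<le> norm (x - y) * norm \<xi>" by (rule Cauchy_Schwarz_ineq2)
    finally have 1: "\<bar>sin (x \<bullet> \<xi> + c) - sin (y \<bullet> \<xi> + c)\<bar> \<le> (2 + norm \<xi>) * norm (x - y)"
      using norm_ge_zero[of "x - y"] unfolding distrib_right mult.commute[of "norm \<xi>"] by linarith
    have "\<bar>sin (x \<bullet> \<xi> + c) - sin (y \<bullet> \<xi> + c)\<bar> \<le> 2"
      using abs_triangle_ineq4[of "sin (x \<bullet> \<xi> + c)" "sin (y \<bullet> \<xi> + c)"]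
        abs_sin_le_one[of "x \<bullet> \<xi> + c"] abs_sin_le_one[of "y \<bullet> \<xi> + c"] by linarith
    then have "\<bar>sin (x \<bullet> \<xi> + c) - sin (y \<bullet> \<xi> + c)\<bar> \<le> 2 + norm \<xi>"
      by (rule order_trans) simp
    then show ?thesis using 1 by (simp add: min_def)
  qed
  show thesis
  proof (rule that[of "(L + (2 + norm \<xi>)) * norm a"])
    fix R :: real and x y :: 'a assume R: "R \<ge> 1"
    let ?m = "min 1 (norm (x - y))"
    have "cutoff R x * sin (x \<bullet> \<xi> + c) - cutoff R y * sin (y \<bullet> \<xi> + c)
        = (cutoff R x - cutoff R y) * sin (x \<bullet> \<xi> + c) + cutoff R y * (sin (x \<bullet> \<xi> + c) - sin (y \<bullet> \<xi> + c))"
      by (simp add: algebra_simps)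
    also have "\<bar>\<dots>\<bar> \<le> \<bar>cutoff R x - cutoff R y\<bar> * \<bar>sin (x \<bullet> \<xi> + c)\<bar>
        + \<bar>cutoff R y\<bar> * \<bar>sin (x \<bullet> \<xi> + c) - sin (y \<bullet> \<xi> + c)\<bar>"
      by (rule order_trans[OF abs_triangle_ineq]) (simp add: abs_mult)
    also have "\<dots> \<le> (L * ?m) * 1 + 1 * ((2 + norm \<xi>) * ?m)"
      by (intro add_mono mult_mono L R s cutoff_abs_le_1) (use L in auto)
    also have "\<dots> = (L + (2 + norm \<xi>)) * ?m" by (simp add: algebra_simps)
    finally have "\<bar>cutoff R x * sin (x \<bullet> \<xi> + c) - cutoff R y * sin (y \<bullet> \<xi> + c)\<bar> * norm a
       \<le> ((L + (2 + norm \<xi>)) * ?m) * norm a" by (rule mult_right_mono) simp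
    then show "norm ((cutoff R x * sin (x \<bullet> \<xi> + c)) *\<^sub>R a - (cutoff R y * sin (y \<bullet> \<xi> + c)) *\<^sub>R a)
       \<le> (L + (2 + norm \<xi>)) * norm a * ?m"
      by (simp add: scaleR_diff_left[symmetric] mult_ac)
  qed (use L in auto)
qed

text \<open>Plane waves are eigenfunctions: with \<open>\<theta> = x \<bullet> \<xi> + c\<close> and \<open>s = z \<bullet> \<xi>\<close>,
  \<open>sin \<theta> - sin (\<theta> - s) = sin \<theta> * (1 - cos s) + cos \<theta> * sin s\<close>, and the first summand is even in \<open>z\<close> whereas
  \<open>\<kappa>\<close> is odd. Adding the values of the integrand at \<open>z\<close> and \<open>- z\<close> removes it.\<close>

lemma wave_divergence:
  fixes \<kappa> :: "'a::euclidean_space \<Rightarrow> 'a"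
  assumes \<kappa>: "odd_levy_field \<kappa>"
    and i: "integrable lborel (\<lambda>z. (sin (x \<bullet> \<xi> + c) - sin ((x - z) \<bullet> \<xi> + c)) * (a \<bullet> \<kappa> z))"
  shows "(\<integral>z. (sin (x \<bullet> \<xi> + c) - sin ((x - z) \<bullet> \<xi> + c)) * (a \<bullet> \<kappa> z) \<partial>lborel)
    = cos (x \<bullet> \<xi> + c) * sine_transform \<kappa> a \<xi>"
proof -
  have [measurable]: "\<kappa> \<in> borel_measurable borel" using \<kappa> by (rule odd_levy_field_measurable)
  define f where "f z = (sin (x \<bullet> \<xi> + c) - sin ((x - z) \<bullet> \<xi> + c)) * (a \<bullet> \<kappa> z)" for z
  have [measurable]: "f \<in> borel_measurable borel" unfolding f_def[abs_def] by measurable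
  have odd: "\<kappa> (- z) = - \<kappa> z" for z using \<kappa> by (simp add: odd_levy_field_def)
  have f: "integrable lborel f" using i by (simp add: f_def[abs_def])
  have fr: "integrable lborel (\<lambda>z. f (- z))" using integrable_reflect_iff[of f 0] f by simp
  have refl: "(\<integral>z. f (- z) \<partial>lborel) = (\<integral>z. f z \<partial>lborel)" using integral_reflect[of f 0] by simp
  have sum: "f z + f (- z) = 2 * cos (x \<bullet> \<xi> + c) * (sin (z \<bullet> \<xi>) * (\<kappa> z \<bullet> a))" for z
  proof -
    define \<theta> s where "\<theta> = x \<bullet> \<xi> + c" and "s = z \<bullet> \<xi>"
    have 1: "(x - z) \<bullet> \<xi> + c = \<theta> - s" "(x + z) \<bullet> \<xi> + c = \<theta> + s"
      by (simp_all add: \<theta>_def s_def inner_diff_left inner_add_left)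
    show ?thesis
      unfolding f_def odd minus_minus diff_minus_eq_add 1 \<theta>_def[symmetric] s_def[symmetric]
      by (simp add: sin_diff sin_add algebra_simps inner_commute)
  qed
  have "2 * (\<integral>z. f z \<partial>lborel) = (\<integral>z. f z + f (- z) \<partial>lborel)"
    using f fr refl by simp
  also have "\<dots> = 2 * (cos (x \<bullet> \<xi> + c) * sine_transform \<kappa> a \<xi>)"
    unfolding sum sine_transform_def by simp
  finally show ?thesis by (simp add: f_def[abs_def])
qed

text \<open>Plane waves are not compactly supported, so they are first cut off at radius \<open>n\<close>. The moduli of the cut off
  waves are bounded uniformly in \<open>n\<close>, so dominated convergence applies both inside the divergence and to its
  pairing with \<open>u\<close>. In the limit the cutoff becomes the constant \<open>c0 > 0\<close>, its value at the origin.\<close>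

lemma wave_orthogonality:
  fixes \<kappa> :: "'a::euclidean_space \<Rightarrow> 'a"
  assumes \<kappa>: "odd_levy_field \<kappa>" and u: "integrable lborel u"
    and zero: "\<And>\<Phi>. \<Phi> \<in> test_fields \<Longrightarrow> (\<integral>x. u x * div_field \<kappa> \<Phi> x \<partial>lborel) = 0"
    and S: "sine_transform \<kappa> a \<xi> \<noteq> 0"
  shows "(\<integral>x. u x * cos (x \<bullet> \<xi> + c) \<partial>lborel) = 0"
proof -
  have [measurable]: "\<kappa> \<in> borel_measurable borel" using \<kappa> by (rule odd_levy_field_measurable)
  have [measurable]: "u \<in> borel_measurable borel" using u by auto
  have m: "integrable lborel (\<lambda>z. min 1 (norm z) * norm (\<kappa> z))" using \<kappa> by (simp add: odd_levy_field_def)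
  define \<Phi> where "\<Phi> n x = (cutoff (real (Suc n)) x * sin (x \<bullet> \<xi> + c)) *\<^sub>R a" for n and x :: 'a
  have \<Phi>: "\<Phi> n \<in> test_fields" for n
    unfolding \<Phi>_def[abs_def] by (rule test_field_cutoff[OF elementary.sine]) simp
  have [measurable]: "\<Phi> n \<in> borel_measurable borel" for n using test_field_measurable[OF \<Phi>] .
  have [measurable]: "div_field \<kappa> (\<Phi> n) \<in> borel_measurable borel" for n
    by (rule div_field_measurable) auto
  obtain C where "C \<ge> 0" and C_R: "\<And>R x y. R \<ge> 1 \<Longrightarrow>
    norm ((cutoff R x * sin (x \<bullet> \<xi> + c)) *\<^sub>R a - (cutoff R y * sin (y \<bullet> \<xi> + c)) *\<^sub>R a)
      \<le> C * min 1 (norm (x - y))"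
    by (rule cut_off_wave_modulus[of \<xi> c a]) (rule that)
  then have C: "C \<ge> 0" "norm (\<Phi> n x - \<Phi> n y) \<le> C * min 1 (norm (x - y))" for n x y
    unfolding \<Phi>_def by (simp, intro C_R) simp
  define c0 where "c0 = cutoff 1 (0::'a)"
  have "c0 > 0" unfolding c0_def by (rule cutoff_pos) simp
  have lim\<Phi>: "(\<lambda>n. \<Phi> n x) \<longlonglongrightarrow> (c0 * sin (x \<bullet> \<xi> + c)) *\<^sub>R a" for x
  proof -
    have "(\<lambda>n. inverse (real (Suc n)) *\<^sub>R x) \<longlonglongrightarrow> 0 *\<^sub>R x"
      by (intro tendsto_intros LIMSEQ_inverse_real_of_nat)
    moreover have "continuous_on UNIV (cutoff 1 :: 'a \<Rightarrow> real)"
      by (rule elementary_continuous[OF elementary_cutoff])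
    then have "isCont (cutoff 1) (0::'a)" by (simp add: continuous_on_eq_continuous_at)
    ultimately have "(\<lambda>n. cutoff 1 (inverse (real (Suc n)) *\<^sub>R x)) \<longlonglongrightarrow> c0"
      unfolding c0_def by (intro isCont_tendsto_compose[of _ "cutoff 1"]) auto
    then have "(\<lambda>n. cutoff (real (Suc n)) x) \<longlonglongrightarrow> c0"
      by (subst cutoff_eq_scaled)
    then show ?thesis unfolding \<Phi>_def by (intro tendsto_intros)
  qed
  define F where "F x z = ((c0 * sin (x \<bullet> \<xi> + c)) *\<^sub>R a - (c0 * sin ((x - z) \<bullet> \<xi> + c)) *\<^sub>R a) \<bullet> \<kappa> z" for x z
  have dom: "norm ((\<Phi> n x - \<Phi> n (x - z)) \<bullet> \<kappa> z) \<le> C * (min 1 (norm z) * norm (\<kappa> z))" for n x z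
    using difference_le[of "\<Phi> n" C x z \<kappa>] C(2) by simp
  have F: "integrable lborel (F x)" "(\<lambda>n. div_field \<kappa> (\<Phi> n) x) \<longlonglongrightarrow> (\<integral>z. F x z \<partial>lborel)" for x
  proof -
    have 1: "AE z in lborel. (\<lambda>n. (\<Phi> n x - \<Phi> n (x - z)) \<bullet> \<kappa> z) \<longlonglongrightarrow> F x z"
      unfolding F_def by (intro AE_I2 tendsto_intros lim\<Phi>)
    have 2: "F x \<in> borel_measurable lborel" "\<And>n. (\<lambda>z. (\<Phi> n x - \<Phi> n (x - z)) \<bullet> \<kappa> z) \<in> borel_measurable lborel"
      "integrable lborel (\<lambda>z. C * (min 1 (norm z) * norm (\<kappa> z)))"
      "\<And>n. AE z in lborel. norm ((\<Phi> n x - \<Phi> n (x - z)) \<bullet> \<kappa> z) \<le> C * (min 1 (norm z) * norm (\<kappa> z))"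
      unfolding F_def[abs_def] using m dom by auto
    show "integrable lborel (F x)"
      by (rule integrable_dominated_convergence[OF 2(1) 2(2) 2(3) 1 2(4)])
    show "(\<lambda>n. div_field \<kappa> (\<Phi> n) x) \<longlonglongrightarrow> (\<integral>z. F x z \<partial>lborel)"
      unfolding div_field_def by (rule integral_dominated_convergence[OF 2(1) 2(2) 2(3) 1 2(4)])
  qed
  have F_eq: "(\<integral>z. F x z \<partial>lborel) = c0 * (cos (x \<bullet> \<xi> + c) * sine_transform \<kappa> a \<xi>)" for x
  proof -
    have eq: "F x z = c0 * ((sin (x \<bullet> \<xi> + c) - sin ((x - z) \<bullet> \<xi> + c)) * (a \<bullet> \<kappa> z))" for z
      by (simp add: F_def inner_diff_left algebra_simps)
    have "integrable lborel (\<lambda>z. (sin (x \<bullet> \<xi> + c) - sin ((x - z) \<bullet> \<xi> + c)) * (a \<bullet> \<kappa> z))"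
      using F(1)[of x] \<open>c0 > 0\<close> unfolding eq[abs_def] by simp
    from wave_divergence[OF \<kappa> this] show ?thesis unfolding eq by simp
  qed
  define K where "K = C * (\<integral>z. min 1 (norm z) * norm (\<kappa> z) \<partial>lborel)"
  have "(\<lambda>n. \<integral>x. u x * div_field \<kappa> (\<Phi> n) x \<partial>lborel) \<longlonglongrightarrow> (\<integral>x. u x * (c0 * (cos (x \<bullet> \<xi> + c) * sine_transform \<kappa> a \<xi>)) \<partial>lborel)"
  proof (rule integral_dominated_convergence[where w="\<lambda>x. \<bar>u x\<bar> * K"])
    show "AE x in lborel. (\<lambda>n. u x * div_field \<kappa> (\<Phi> n) x) \<longlonglongrightarrow> u x * (c0 * (cos (x \<bullet> \<xi> + c) * sine_transform \<kappa> a \<xi>))"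
      by (intro AE_I2 tendsto_mult_left F(2)[unfolded F_eq])
    show "AE x in lborel. norm (u x * div_field \<kappa> (\<Phi> n) x) \<le> \<bar>u x\<bar> * K" for n
      unfolding K_def using div_field_bounded[OF \<kappa> _ C(2), of n]
      by (intro AE_I2) (auto simp: abs_mult intro!: mult_left_mono)
  qed (use u in auto)
  then have "(\<integral>x. u x * (c0 * (cos (x \<bullet> \<xi> + c) * sine_transform \<kappa> a \<xi>)) \<partial>lborel) = 0"
    by (simp add: zero[OF \<Phi>] LIMSEQ_const_iff)
  moreover have "(\<integral>x. u x * (c0 * (cos (x \<bullet> \<xi> + c) * sine_transform \<kappa> a \<xi>)) \<partial>lborel)
      = (c0 * sine_transform \<kappa> a \<xi>) * (\<integral>x. u x * cos (x \<bullet> \<xi> + c) \<partial>lborel)"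
    by (subst integral_mult_right_zero[symmetric]) (simp add: mult_ac)
  ultimately show ?thesis using S \<open>c0 > 0\<close> by simp
qed

text \<open>Differentiation of the vanishing wave integral in the direction \<open>v\<close> of the frequency, which is allowed
  under the integral because \<open>w\<close> has bounded support.\<close>

lemma wave_moment_step:
  fixes w :: "'a::euclidean_space \<Rightarrow> real"
  assumes w: "integrable lborel w" and supp: "\<And>x. norm x > R \<Longrightarrow> w x = 0"
    and U: "open U" and zero: "\<And>\<xi> c. \<xi> \<in> U \<Longrightarrow> (\<integral>x. w x * cos (x \<bullet> \<xi> + c) \<partial>lborel) = 0"
    and \<xi>: "\<xi> \<in> U"
  shows "(\<integral>x. (w x * (x \<bullet> v)) * cos (x \<bullet> \<xi> + c) \<partial>lborel) = 0"
proof -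
  have [measurable]: "w \<in> borel_measurable borel" using w by auto
  \<comment> \<open>The derivative of \<open>cos (_ + d)\<close> is \<open>- sin (_ + d) = cos (_ + c)\<close>.\<close>
  define d where "d = c - pi / 2"
  define t where "t n = inverse (real (Suc n))" for n
  have t: "t n > 0" "t \<longlonglongrightarrow> 0" for n
    unfolding t_def[abs_def] using LIMSEQ_inverse_real_of_nat by auto
  have "(\<lambda>n. \<xi> + t n *\<^sub>R v) \<longlonglongrightarrow> \<xi> + 0 *\<^sub>R v" by (intro tendsto_intros t)
  then have inU: "\<forall>\<^sub>F n in sequentially. \<xi> + t n *\<^sub>R v \<in> U"
    using topological_tendstoD[OF _ U] \<xi> by auto
  define D where "D n x = w x * ((cos (x \<bullet> (\<xi> + t n *\<^sub>R v) + d) - cos (x \<bullet> \<xi> + d)) / t n)" for n x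
  have ev: "\<forall>\<^sub>F n in sequentially. (\<integral>x. D n x \<partial>lborel) = 0"
    using inU
  proof eventually_elim
    case (elim n)
    have i: "integrable lborel (\<lambda>x. w x * cos (x \<bullet> \<eta> + d))" for \<eta>
      by (rule integrable_mult_continuous[OF w supp]) (auto intro!: continuous_intros)
    have "(\<integral>x. D n x \<partial>lborel) = (\<integral>x. (w x * cos (x \<bullet> (\<xi> + t n *\<^sub>R v) + d) - w x * cos (x \<bullet> \<xi> + d)) / t n \<partial>lborel)"
      by (simp add: D_def right_diff_distrib)
    also have "\<dots> = ((\<integral>x. w x * cos (x \<bullet> (\<xi> + t n *\<^sub>R v) + d) \<partial>lborel) - (\<integral>x. w x * cos (x \<bullet> \<xi> + d) \<partial>lborel)) / t n"
      using i by simp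
    also have "\<dots> = 0" using zero[OF elim] zero[OF \<xi>] by simp
    finally show ?case .
  qed
  have "(\<lambda>n. \<integral>x. D n x \<partial>lborel) \<longlonglongrightarrow> (\<integral>x. w x * (- sin (x \<bullet> \<xi> + d) * (x \<bullet> v)) \<partial>lborel)"
  proof (rule integral_dominated_convergence[where w="\<lambda>x. \<bar>w x\<bar> * (norm x * norm v)"])
    show "integrable lborel (\<lambda>x. \<bar>w x\<bar> * (norm x * norm v))"
      by (rule integrable_mult_continuous[where R=R]) (use w supp in \<open>auto intro!: continuous_intros\<close>)
    show "D n \<in> borel_measurable lborel" for n unfolding D_def by measurable
    show "AE x in lborel. norm (D n x) \<le> \<bar>w x\<bar> * (norm x * norm v)" for n
    proof (rule AE_I2)
      fix x
      have "\<bar>cos (x \<bullet> (\<xi> + t n *\<^sub>R v) + d) - cos (x \<bullet> \<xi> + d)\<bar> \<le> \<bar>t n * (x \<bullet> v)\<bar>"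
        using abs_sin_diff_le[of "x \<bullet> (\<xi> + t n *\<^sub>R v) + d + pi / 2" "x \<bullet> \<xi> + d + pi / 2"]
        by (simp add: sin_add inner_add_right)
      then have "\<bar>(cos (x \<bullet> (\<xi> + t n *\<^sub>R v) + d) - cos (x \<bullet> \<xi> + d)) / t n\<bar> \<le> \<bar>x \<bullet> v\<bar>"
        using t(1)[of n] by (simp add: abs_mult field_simps)
      also have "\<dots> \<le> norm x * norm v" by (rule Cauchy_Schwarz_ineq2)
      finally show "norm (D n x) \<le> \<bar>w x\<bar> * (norm x * norm v)"
        unfolding D_def real_norm_def abs_mult[of "w x"] by (rule mult_left_mono) simp
    qed
    show "AE x in lborel. (\<lambda>n. D n x) \<longlonglongrightarrow> w x * (- sin (x \<bullet> \<xi> + d) * (x \<bullet> v))"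
    proof (rule AE_I2)
      fix x
      have "((\<lambda>s. cos (x \<bullet> (\<xi> + s *\<^sub>R v) + d)) has_real_derivative - sin (x \<bullet> \<xi> + d) * (x \<bullet> v)) (at 0)"
        by (auto intro!: derivative_eq_intros simp: inner_add_right)
      then have "((\<lambda>s. (cos (x \<bullet> (\<xi> + s *\<^sub>R v) + d) - cos (x \<bullet> \<xi> + d)) / s) \<longlongrightarrow> - sin (x \<bullet> \<xi> + d) * (x \<bullet> v)) (at 0)"
        by (simp add: has_field_derivative_iff)
      moreover have "filterlim t (at 0) sequentially"
        using t by (auto simp: filterlim_at intro!: always_eventually) (metis less_irrefl)
      ultimately have "(\<lambda>n. (cos (x \<bullet> (\<xi> + t n *\<^sub>R v) + d) - cos (x \<bullet> \<xi> + d)) / t n) \<longlonglongrightarrow> - sin (x \<bullet> \<xi> + d) * (x \<bullet> v)"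
        by (rule filterlim_compose)
      then show "(\<lambda>n. D n x) \<longlonglongrightarrow> w x * (- sin (x \<bullet> \<xi> + d) * (x \<bullet> v))"
        unfolding D_def by (intro tendsto_mult_left)
    qed
  qed measurable
  then have "(\<integral>x. w x * (- sin (x \<bullet> \<xi> + d) * (x \<bullet> v)) \<partial>lborel) = 0"
    using LIMSEQ_unique tendsto_eventually[OF ev] by blast
  moreover have "- sin (x \<bullet> \<xi> + d) = cos (x \<bullet> \<xi> + c)" for x
    using sin_diff[of "x \<bullet> \<xi> + c" "pi / 2"] by (simp add: d_def add_diff_eq)
  ultimately show ?thesis by (simp add: mult_ac)
qed

text \<open>A product of polynomials is handled by applying the induction hypothesis for the second factor to \<open>u\<close> times the first;
  therefore \<open>u\<close> is generalised.\<close>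

lemma wave_moments_zero:
  fixes u P :: "'a::euclidean_space \<Rightarrow> real"
  assumes P: "real_polynomial_function P" and U: "open U"
    and u: "integrable lborel u" "\<And>x. norm x > R \<Longrightarrow> u x = 0"
    and zero: "\<And>\<xi> c. \<xi> \<in> U \<Longrightarrow> (\<integral>x. u x * cos (x \<bullet> \<xi> + c) \<partial>lborel) = 0"
  shows "\<And>\<xi> c. \<xi> \<in> U \<Longrightarrow> (\<integral>x. (u x * P x) * cos (x \<bullet> \<xi> + c) \<partial>lborel) = 0"
  using P u zero
proof (induction P arbitrary: u rule: real_polynomial_function.induct)
  case (linear f)
  then have "f x = x \<bullet> adjoint f 1" for x
    using adjoint_works[of f x 1] by (auto simp: bounded_linear.linear)
  then show ?case
    using wave_moment_step[OF linear.prems(2,3) U linear.prems(4,1), where R=R and v="adjoint f 1" and c=c] by simp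
next
  case (const b)
  have "(\<integral>x. (u x * b) * cos (x \<bullet> \<xi> + c) \<partial>lborel) = b * (\<integral>x. u x * cos (x \<bullet> \<xi> + c) \<partial>lborel)"
    by (subst integral_mult_right_zero[symmetric]) (simp add: mult_ac)
  then show ?case using const by simp
next
  case (add f g)
  have "continuous_on UNIV f" "continuous_on UNIV g"
    using add.hyps by (auto intro: elementary_continuous elementary_polynomial)
  then have i: "integrable lborel (\<lambda>x. u x * (f x * cos (x \<bullet> \<xi> + c)))" "integrable lborel (\<lambda>x. u x * (g x * cos (x \<bullet> \<xi> + c)))"
    by (auto intro!: integrable_mult_continuous[OF add.prems(2,3)] continuous_intros)
  have "(\<integral>x. (u x * (f x + g x)) * cos (x \<bullet> \<xi> + c) \<partial>lborel)
     = (\<integral>x. u x * (f x * cos (x \<bullet> \<xi> + c)) + u x * (g x * cos (x \<bullet> \<xi> + c)) \<partial>lborel)"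
    by (simp add: algebra_simps)
  also have "\<dots> = (\<integral>x. (u x * f x) * cos (x \<bullet> \<xi> + c) \<partial>lborel) + (\<integral>x. (u x * g x) * cos (x \<bullet> \<xi> + c) \<partial>lborel)"
    using i by (simp add: mult.assoc)
  also have "\<dots> = 0" using add.IH[OF add.prems] by simp
  finally show ?case .
next
  case (mult f g)
  have cf: "continuous_on UNIV f" using mult.hyps by (auto intro: elementary_continuous elementary_polynomial)
  have "integrable lborel (\<lambda>x. u x * f x)"
    by (rule integrable_mult_continuous[where R=R]) (use mult.prems cf in auto)
  then have "(\<integral>x. ((u x * f x) * g x) * cos (x \<bullet> \<xi> + c) \<partial>lborel) = 0"
    by (intro mult.IH(2)[OF mult.prems(1)]) (auto simp: mult.prems intro: mult.IH(1)[OF _ mult.prems(2-4)])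
  then show ?case by (simp add: mult_ac)
qed

text \<open>The sine transform is nonzero at some frequency, by continuity on an open set \<open>U\<close>, where all waves are orthogonal
  to \<open>u\<close>. At one frequency in \<open>U\<close> the vanishing moments give that \<open>u\<close> times the wave is zero for every phase, and
  the phases \<open>0\<close> and \<open>- pi / 2\<close> have no common zero.\<close>

lemma weak_grad_zero_imp_AE_zero:
  fixes \<kappa> :: "'a::euclidean_space \<Rightarrow> 'a"
  assumes \<kappa>: "odd_levy_field \<kappa>" and c: "\<And>z. \<kappa> z = c z *\<^sub>R z" "\<And>z. c z \<ge> 0"
    and pos: "\<epsilon> > 0" "AE z in lborel. norm z < \<epsilon> \<longrightarrow> c z > 0"
    and u: "integrable lborel u" "\<And>x. norm x > R \<Longrightarrow> u x = 0"
    and zero: "\<And>\<Phi>. \<Phi> \<in> test_fields \<Longrightarrow> (\<integral>x. u x * div_field \<kappa> \<Phi> x \<partial>lborel) = 0"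
  shows "AE x in lborel. u x = 0"
proof -
  obtain e :: 'a where e: "e \<in> Basis" using nonempty_Basis by blast
  define U where "U = {\<xi>. sine_transform \<kappa> e \<xi> \<noteq> 0}"
  have "continuous_on UNIV (sine_transform \<kappa> e)"
    using isCont_sine_transform[OF \<kappa>] by (simp add: continuous_on_eq_continuous_at)
  then have "open U" unfolding U_def
    by (intro open_Collect_neq) auto
  obtain \<xi> where \<xi>: "\<xi> \<in> U" using sine_transform_nonzero[OF \<kappa> c pos e] by (auto simp: U_def)
  have wave: "(\<integral>x. u x * cos (x \<bullet> \<xi> + b) \<partial>lborel) = 0" if "\<xi> \<in> U" for \<xi> b
    using wave_orthogonality[OF \<kappa> u(1) zero] that by (simp add: U_def)
  have AE0: "AE x in lborel. u x * cos (x \<bullet> \<xi> + b) = 0" for b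
  proof (rule polynomial_moments_zero_imp_AE_zero[where R=R])
    show "integrable lborel (\<lambda>x. u x * cos (x \<bullet> \<xi> + b))"
      by (rule integrable_mult_continuous[OF u]) (auto intro!: continuous_intros)
    fix P :: "'a \<Rightarrow> real" assume P: "real_polynomial_function P"
    show "(\<integral>x. u x * cos (x \<bullet> \<xi> + b) * P x \<partial>lborel) = 0"
      using wave_moments_zero[OF P \<open>open U\<close> u wave \<xi>, where c=b] by (simp add: mult_ac)
  qed (simp add: u)
  show ?thesis
    using AE0[of 0] AE0[of "- pi / 2"]
  proof eventually_elim
    case (elim x)
    have "cos (x \<bullet> \<xi> + - pi / 2) = sin (x \<bullet> \<xi>)" by (simp add: cos_add cos_diff)
    then show ?case using elim sin_cos_squared_add[of "x \<bullet> \<xi>"]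
      by (metis add.right_neutral mult_eq_0_iff power_zero_numeral zero_neq_one)
  qed
qed

section \<open>Compactness of correlation with an integrable kernel\<close>

text \<open>First \<open>k\<close> is truncated in size and support. The truncation is an almost everywhere limit of continuous
  functions \<open>g m\<close>; projecting these to a ball (by \<open>T\<close>) and cutting them off (by \<open>\<zeta>\<close>) makes them bounded and
  compactly supported without changing the limit, so they converge in \<open>L\<^sup>1\<close>.\<close>

lemma integrable_approx_continuous_compact_support:
  fixes k :: "'a::euclidean_space \<Rightarrow> 'b::euclidean_space"
  assumes k: "integrable lborel k" and \<eta>: "\<eta> > 0"
  obtains k' M where "continuous_on UNIV k'" "M > 0" "\<And>z. norm z > M \<Longrightarrow> k' z = 0" "integrable lborel k'"
    "(\<integral>z. norm (k z - k' z) \<partial>lborel) \<le> \<eta>"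
proof -
  have [measurable]: "k \<in> borel_measurable borel" using k by auto
  define kn where "kn n z = (if norm z \<le> real n \<and> norm (k z) \<le> real n then k z else 0)" for n z
  have [measurable]: "kn n \<in> borel_measurable borel" for n unfolding kn_def by measurable
  have "(\<lambda>n. \<integral>z. norm (k z - kn n z) \<partial>lborel) \<longlonglongrightarrow> integral\<^sup>L lborel (\<lambda>z::'a. 0)"
  proof (rule integral_dominated_convergence[where w="\<lambda>z. norm (k z)"])
    show "AE z in lborel. (\<lambda>n. norm (k z - kn n z)) \<longlonglongrightarrow> 0"
    proof (rule AE_I2)
      fix z
      obtain N :: nat where N: "max (norm z) (norm (k z)) \<le> real N" using real_arch_simple by blast
      have "\<forall>\<^sub>F n in sequentially. norm (k z - kn n z) = 0"
        using eventually_ge_at_top[of N] by eventually_elim (use N in \<open>auto simp: kn_def\<close>)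
      then show "(\<lambda>n. norm (k z - kn n z)) \<longlonglongrightarrow> 0" by (rule tendsto_eventually)
    qed
    show "AE z in lborel. norm (norm (k z - kn n z)) \<le> norm (k z)" for n
      by (rule AE_I2) (simp add: kn_def)
  qed (use k in auto)
  then have "\<forall>\<^sub>F n in sequentially. (\<integral>z. norm (k z - kn n z) \<partial>lborel) < \<eta> / 2"
    using order_tendstoD(2)[of _ 0 sequentially "\<eta> / 2"] \<eta> by simp
  then have "\<forall>\<^sub>F n in sequentially. n \<ge> 1 \<and> (\<integral>z. norm (k z - kn n z) \<partial>lborel) < \<eta> / 2"
    using eventually_ge_at_top[of 1] by eventually_elim simp
  then obtain n where n: "n \<ge> 1" "(\<integral>z. norm (k z - kn n z) \<partial>lborel) < \<eta> / 2"
    using eventually_happens by fastforce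
  have kn_bd: "norm (kn n z) \<le> real n" "norm z > real n \<Longrightarrow> kn n z = 0" for z by (auto simp: kn_def)
  have kn_int: "integrable lborel (kn n)"
    by (rule Bochner_Integration.integrable_bound[OF k]) (auto simp: kn_def)
  have "kn n measurable_on UNIV"
    by (subst measurable_on_iff_borel_measurable) (simp_all add: lebesgue_on_UNIV_eq measurable_completion)
  then obtain N g where N: "negligible N" and g: "\<And>m. continuous_on UNIV (g m)"
    and lim: "\<And>z. z \<notin> N \<Longrightarrow> (\<lambda>m. g m z) \<longlonglongrightarrow> kn n z"
    unfolding measurable_on_def by auto
  have AE_N: "AE z in lborel. z \<notin> N"
    using N AE_not_in[of N lebesgue] by (simp add: AE_completion_iff negligible_iff_null_sets)
  define T :: "'b \<Rightarrow> 'b" where "T v = (real n / max (real n) (norm v)) *\<^sub>R v" for v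
  define \<zeta> :: "'a \<Rightarrow> real" where "\<zeta> z = max 0 (min 1 (real n + 1 - norm z))" for z
  have n0: "real n > 0" using n by simp
  have T_cont: "isCont T v" for v unfolding T_def[abs_def] by (intro continuous_intros) (use n0 in auto)
  have T_le: "norm (T v) \<le> real n" for v
  proof -
    have "norm v \<le> max (real n) (norm v)" by simp
    then have "real n * norm v \<le> real n * max (real n) (norm v)" using n0 by (intro mult_left_mono) auto
    then show ?thesis using n0 by (simp add: T_def field_simps max_def split: if_splits)
  qed
  have T_id: "norm v \<le> real n \<Longrightarrow> T v = v" for v using n0 by (simp add: T_def)
  define h where "h m z = \<zeta> z *\<^sub>R T (g m z)" for m z
  have h_cont: "continuous_on UNIV (h m)" for m
  proof -
    have "continuous_on UNIV (\<lambda>z. T (g m z))"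
      using continuous_on_compose2[OF continuous_at_imp_continuous_on[of UNIV T] g[of m]] T_cont by auto
    then show ?thesis unfolding h_def \<zeta>_def by (intro continuous_intros)
  qed
  have [measurable]: "h m \<in> borel_measurable borel" for m by (rule borel_measurable_continuous_onI[OF h_cont])
  have h_0: "norm z > real n + 1 \<Longrightarrow> h m z = 0" for m z by (simp add: h_def \<zeta>_def)
  have h_le: "norm (h m z) \<le> real n * indicator (cball 0 (real n + 1)) z" for m z
  proof (cases "norm z \<le> real n + 1")
    case True
    have "norm (h m z) = \<zeta> z * norm (T (g m z))" by (simp add: h_def \<zeta>_def)
    also have "\<dots> \<le> 1 * real n" by (intro mult_mono T_le) (auto simp: \<zeta>_def)
    finally show ?thesis using True by simp
  qed (simp add: h_0)
  have kn_le: "norm (kn n z) \<le> real n * indicator (cball 0 (real n + 1)) z" for z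
    using kn_bd[of z] by (cases "norm z \<le> real n") auto
  have dom_int: "integrable lborel (\<lambda>z. 2 * (real n * indicator (cball (0::'a) (real n + 1)) z))"
    by (intro integrable_mult_right integrable_indicator_cball)
  have "(\<lambda>m. \<integral>z. norm (kn n z - h m z) \<partial>lborel) \<longlonglongrightarrow> integral\<^sup>L lborel (\<lambda>z::'a. 0)"
  proof (rule integral_dominated_convergence[OF _ _ dom_int])
    show "AE z in lborel. (\<lambda>m. norm (kn n z - h m z)) \<longlonglongrightarrow> 0"
      using AE_N
    proof eventually_elim
      case (elim z)
      have "(\<lambda>m. T (g m z)) \<longlonglongrightarrow> T (kn n z)"
        by (rule isCont_tendsto_compose[OF T_cont lim[OF elim]])
      then have "(\<lambda>m. norm (kn n z - h m z)) \<longlonglongrightarrow> norm (kn n z - \<zeta> z *\<^sub>R T (kn n z))"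
        unfolding h_def by (intro tendsto_intros)
      moreover have "\<zeta> z *\<^sub>R T (kn n z) = kn n z"
        using kn_bd[of z] T_id[of "kn n z"] by (cases "norm z \<le> real n") (auto simp: \<zeta>_def)
      ultimately show ?case by simp
    qed
    show "AE z in lborel. norm (norm (kn n z - h m z)) \<le> 2 * (real n * indicator (cball 0 (real n + 1)) z)" for m
    proof (rule AE_I2)
      fix z
      show "norm (norm (kn n z - h m z)) \<le> 2 * (real n * indicator (cball 0 (real n + 1)) z)"
        using norm_triangle_ineq4[of "kn n z" "h m z"] kn_le[of z] h_le[of m z] by simp
    qed
  qed measurable
  then have "\<forall>\<^sub>F m in sequentially. (\<integral>z. norm (kn n z - h m z) \<partial>lborel) < \<eta> / 2"
    using order_tendstoD(2)[of _ 0 sequentially "\<eta> / 2"] \<eta> by simp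
  then obtain m where m: "(\<integral>z. norm (kn n z - h m z) \<partial>lborel) < \<eta> / 2"
    using eventually_happens by fastforce
  have h_int: "integrable lborel (h m)"
  proof (rule Bochner_Integration.integrable_bound)
    show "integrable lborel (\<lambda>z. real n * indicator (cball (0::'a) (real n + 1)) z)"
      by (intro integrable_mult_right integrable_indicator_cball)
  qed (use h_le in \<open>auto intro!: AE_I2 order_trans[OF _ abs_ge_self]\<close>)
  have "(\<integral>z. norm (k z - h m z) \<partial>lborel) \<le> (\<integral>z. norm (k z - kn n z) + norm (kn n z - h m z) \<partial>lborel)"
  proof (rule integral_mono)
    fix z show "norm (k z - h m z) \<le> norm (k z - kn n z) + norm (kn n z - h m z)"
      using norm_triangle_ineq[of "k z - kn n z" "kn n z - h m z"] by simp
  qed (use k kn_int h_int in auto)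
  also have "\<dots> = (\<integral>z. norm (k z - kn n z) \<partial>lborel) + (\<integral>z. norm (kn n z - h m z) \<partial>lborel)"
    using k kn_int h_int by simp
  finally have "(\<integral>z. norm (k z - h m z) \<partial>lborel) \<le> \<eta>" using n m by linarith
  then show thesis
    using that[of "h m" "real n + 1"] h_cont h_0 h_int n0 by auto
qed

text \<open>The correlations inherit boundedness and the modulus of continuity of \<open>k\<close>, uniformly in \<open>n\<close>, and vanish outside the
  ball of radius \<open>R + M\<close>. So Arzela-Ascoli applies on that ball.\<close>

lemma correlation_compact:
  fixes u :: "nat \<Rightarrow> 'a::euclidean_space \<Rightarrow> real" and k :: "'a \<Rightarrow> 'a"
  assumes k: "continuous_on UNIV k" "M > 0" "\<And>z. norm z > M \<Longrightarrow> k z = 0"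
    and u: "\<And>n. integrable lborel (u n)" and R: "R > 0" "\<And>n x. norm x > R \<Longrightarrow> u n x = 0"
    and B: "\<And>n. (\<integral>x. \<bar>u n x\<bar> \<partial>lborel) \<le> B" and q: "q \<ge> 1"
  obtains r :: "nat \<Rightarrow> nat" where "strict_mono r"
    "\<And>e. e > 0 \<Longrightarrow> \<exists>N. \<forall>i\<ge>N. \<forall>j\<ge>N.
       (\<integral>y. norm (correlation (u (r i)) k y - correlation (u (r j)) k y) powr q \<partial>lborel) < e"
proof -
  have [measurable]: "u n \<in> borel_measurable borel" for n using u by auto
  have [measurable]: "k \<in> borel_measurable borel" by (rule borel_measurable_continuous_onI[OF k(1)])
  have B0: "B \<ge> 0" using B[of 0] by (rule order_trans[rotated]) simp
  obtain K where K: "K > 0" and k_bd: "\<And>z. norm (k z) \<le> K"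
    using compactly_supported_continuous_bounded[OF k(1), of M] k(3) by blast
  let ?S = "cball (0::'a) (R + M)"
  let ?F = "\<lambda>n y. correlation (u n) k y"
  have int: "integrable lborel (\<lambda>x. u n x *\<^sub>R k (x - y))" for n y
    by (rule Bochner_Integration.integrable_bound[where f="\<lambda>x. K * u n x"])
      (use u k_bd K in \<open>auto simp: abs_mult mult.commute[of K] intro!: mult_left_mono\<close>)
  have F_0: "?F n y = 0" if "norm y > R + M" for n y
  proof -
    have "u n x *\<^sub>R k (x - y) = 0" for x
    proof (cases "norm x > R")
      case False
      have "norm y \<le> norm x + norm (x - y)" using norm_triangle_sub[of y x] by (simp add: norm_minus_commute)
      then have "norm (x - y) > M" using that False by linarith
      then show ?thesis using k(3) by simp
    qed (simp add: R)
    then show ?thesis unfolding correlation_def by (simp only: Bochner_Integration.integral_zero)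
  qed
  have diff: "norm (?F n y - ?F n y') \<le> e * B"
    if "\<And>x. norm x \<le> R \<Longrightarrow> norm (k (x - y) - k (x - y')) \<le> e" "e \<ge> 0" for n y y' e
  proof -
    have "?F n y - ?F n y' = (\<integral>x. u n x *\<^sub>R (k (x - y) - k (x - y')) \<partial>lborel)"
      unfolding correlation_def using int by (simp add: scaleR_diff_right)
    also have "norm \<dots> \<le> (\<integral>x. norm (u n x *\<^sub>R (k (x - y) - k (x - y'))) \<partial>lborel)"
      by (rule integral_norm_bound)
    also have "\<dots> \<le> (\<integral>x. e * \<bar>u n x\<bar> \<partial>lborel)"
    proof (rule integral_mono)
      show "integrable lborel (\<lambda>x. norm (u n x *\<^sub>R (k (x - y) - k (x - y'))))"
        by (rule integrable_norm)
          (use Bochner_Integration.integrable_diff[OF int[of n y] int[of n y']] in \<open>simp flip: scaleR_diff_right\<close>)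
      show "integrable lborel (\<lambda>x. e * \<bar>u n x\<bar>)" using u by auto
      fix x show "norm (u n x *\<^sub>R (k (x - y) - k (x - y'))) \<le> e * \<bar>u n x\<bar>"
        using that(1)[of x] R(2)[of x n] by (cases "norm x \<le> R") (auto simp: mult.commute[of e] intro!: mult_left_mono)
    qed
    also have "\<dots> \<le> e * B" using B[of n] that(2) by (simp add: mult_left_mono)
    finally show ?thesis .
  qed
  have "\<exists>g r. continuous_on ?S g \<and> strict_mono (r :: nat \<Rightarrow> nat) \<and>
     (\<forall>e>0. \<exists>N. \<forall>n y. n \<ge> N \<and> y \<in> ?S \<longrightarrow> norm (?F (r n) y - g y) < e)"
  proof (rule Arzela_Ascoli[of ?S ?F "2 * K * B"])
    show "compact ?S" by simp
    fix n y
    have "norm y \<le> R + M \<Longrightarrow> norm (?F n y) \<le> 2 * K * B"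
    proof -
      obtain b :: 'a where b: "b \<in> Basis" using nonempty_Basis by blast
      \<comment> \<open>At this point the correlation is zero, so the estimate for differences bounds the values.\<close>
      define y' where "y' = (R + M + 1) *\<^sub>R b"
      have "norm y' > R + M" using b R k by (simp add: y'_def)
      then have "?F n y' = 0" by (rule F_0)
      moreover have "norm (k (x - y) - k (x - y')) \<le> 2 * K" for x
        using norm_triangle_ineq4[of "k (x - y)" "k (x - y')"] k_bd[of "x - y"] k_bd[of "x - y'"] by linarith
      ultimately show "norm (?F n y) \<le> 2 * K * B" using diff[of y y' "2 * K" n] K by simp
    qed
    then show "y \<in> ?S \<Longrightarrow> norm (?F n y) \<le> 2 * K * B" by simp
  next
    fix y e :: real and x :: 'a assume x: "x \<in> ?S" and e: "0 < (e::real)"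
    have "uniformly_continuous_on (cball 0 (2 * R + M)) k"
      by (intro compact_uniformly_continuous continuous_on_subset[OF k(1)]) auto
    moreover define e' where "e' = e / (B + 1)"
    have e': "e' > 0" using e B0 by (simp add: e'_def)
    ultimately obtain d where d: "d > 0"
      "\<And>a b. a \<in> cball 0 (2 * R + M) \<Longrightarrow> b \<in> cball 0 (2 * R + M) \<Longrightarrow> dist b a < d \<Longrightarrow> dist (k b) (k a) < e'"
      unfolding uniformly_continuous_on_def by blast
    have "norm (?F n x - ?F n y) < e" if y: "y \<in> ?S" "norm (x - y) < d" for n y
    proof -
      have "norm (k (z - x) - k (z - y)) \<le> e'" if "norm z \<le> R" for z
      proof -
        have "norm (z - x) \<le> 2 * R + M" "norm (z - y) \<le> 2 * R + M"
          using norm_triangle_ineq4[of z x] norm_triangle_ineq4[of z y] that x y by auto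
        moreover have "dist (z - x) (z - y) < d" using y(2) by (simp add: dist_norm norm_minus_commute)
        ultimately have "dist (k (z - x)) (k (z - y)) < e'"
          unfolding mem_cball_0[symmetric] by (intro d(2))
        then show ?thesis by (simp add: dist_norm)
      qed
      then have "norm (?F n x - ?F n y) \<le> e' * B" using diff e' by simp
      also have "\<dots> < e' * (B + 1)" using e' by simp
      also have "\<dots> = e" using B0 by (simp add: e'_def)
      finally show ?thesis .
    qed
    then show "\<exists>d>0. \<forall>n y. y \<in> ?S \<and> norm (x - y) < d \<longrightarrow> norm (?F n x - ?F n y) < e"
      using d(1) by blast
  next
    fix g and r :: "nat \<Rightarrow> nat"
    assume "continuous_on ?S g" "strict_mono r"
      and "\<And>e. 0 < e \<Longrightarrow> \<exists>N. \<forall>n y. n \<ge> N \<and> y \<in> ?S \<longrightarrow> norm (?F (r n) y - g y) < e"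
    then show ?thesis by blast
  qed
  then obtain g and r :: "nat \<Rightarrow> nat" where r: "strict_mono r"
    and unif: "\<And>e. e > 0 \<Longrightarrow> \<exists>N. \<forall>n y. n \<ge> N \<and> y \<in> ?S \<longrightarrow> norm (?F (r n) y - g y) < e" by blast
  show thesis
  proof (rule that[OF r])
    fix e :: real assume e: "e > 0"
    define V where "V = measure lborel ?S"
    have V: "V \<ge> 0" by (simp add: V_def)
    \<comment> \<open>Chosen such that \<open>(2 * \<delta>) powr q * V < e\<close>.\<close>
    define \<delta> where "\<delta> = (e / (V + 1)) powr (1 / q) / 2"
    have \<delta>: "\<delta> > 0" using e V by (simp add: \<delta>_def)
    have \<delta>q: "(2 * \<delta>) powr q = e / (V + 1)" using e V q by (simp add: \<delta>_def powr_powr)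
    obtain N where N: "\<And>n y. n \<ge> N \<Longrightarrow> y \<in> ?S \<Longrightarrow> norm (?F (r n) y - g y) < \<delta>"
      using unif[OF \<delta>] by blast
    have "(\<integral>y. norm (?F (r i) y - ?F (r j) y) powr q \<partial>lborel) < e" if "i \<ge> N" "j \<ge> N" for i j
    proof -
      have le: "norm (?F (r i) y - ?F (r j) y) powr q \<le> (2 * \<delta>) powr q * indicator ?S y" for y
      proof (cases "y \<in> ?S")
        case True
        have "norm (?F (r i) y - ?F (r j) y) \<le> 2 * \<delta>"
          using norm_triangle_ineq4[of "?F (r i) y - g y" "?F (r j) y - g y"] N[OF that(1) True] N[OF that(2) True]
          by simp
        then have "norm (?F (r i) y - ?F (r j) y) powr q \<le> (2 * \<delta>) powr q" using q by (intro powr_mono2) auto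
        then show ?thesis using True by simp
      qed (simp add: F_0)
      have "(\<integral>y. norm (?F (r i) y - ?F (r j) y) powr q \<partial>lborel) \<le> (\<integral>y. (2 * \<delta>) powr q * indicator ?S y \<partial>lborel)"
      proof (rule integral_mono)
        show i: "integrable lborel (\<lambda>y. (2 * \<delta>) powr q * indicator ?S y)"
          by (intro integrable_mult_right integrable_indicator_cball)
        show "integrable lborel (\<lambda>y. norm (?F (r i) y - ?F (r j) y) powr q)"
          by (rule Bochner_Integration.integrable_bound[OF i])
            (use le in \<open>auto intro!: AE_I2 order_trans[OF _ abs_ge_self]\<close>)
      qed (rule le)
      also have "\<dots> = (e / (V + 1)) * V" by (simp add: \<delta>q V_def)
      also have "\<dots> < e" using e V by (simp add: field_simps)
      finally show ?thesis .
    qed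
    then show "\<exists>N. \<forall>i\<ge>N. \<forall>j\<ge>N. (\<integral>y. norm (?F (r i) y - ?F (r j) y) powr q \<partial>lborel) < e" by blast
  qed
qed

lemma interpolation_small:
  fixes q b c e :: real
  assumes "e > 0" "b \<ge> 0" "c \<ge> 0"
  obtains l \<delta> where "l > 0" "\<delta> > 0" "\<And>a. a < \<delta> \<Longrightarrow> l * b + l powr (1 - q) * (c * a) < e"
proof -
  define l where "l = e / (2 * (b + 1))"
  define \<delta> where "\<delta> = e / (2 * (l powr (1 - q) * (c + 1)))"
  have l: "l > 0" and \<delta>: "\<delta> > 0" using assms by (simp_all add: l_def \<delta>_def)
  have "l * b + l powr (1 - q) * (c * a) < e" if "a < \<delta>" for a
  proof -
    have "l * (b + 1) = e / 2" using assms(2) by (simp add: l_def field_simps add_eq_0_iff)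
    then have 1: "l * b < e / 2" using l by (simp add: distrib_left)
    have "c * a \<le> (c + 1) * \<delta>"
      using that assms \<delta> by (intro order_trans[OF mult_left_mono[of a \<delta> c]]) (auto simp: mult_right_mono)
    then have "l powr (1 - q) * (c * a) \<le> l powr (1 - q) * ((c + 1) * \<delta>)" by (intro mult_left_mono) auto
    also have "\<dots> = (l powr (1 - q) * (c + 1)) * \<delta>" by simp
    also have "\<dots> = e / 2"
    proof -
      have "l powr (1 - q) * (c + 1) \<noteq> 0" using assms l by simp
      then show ?thesis unfolding \<delta>_def by (metis mult.commute nonzero_mult_divide_mult_cancel_left times_divide_eq_right)
    qed
    finally show ?thesis using 1 by linarith
  qed
  then show thesis using that l \<delta> by blast
qed

text \<open>Fatou's lemma for real-valued functions.\<close>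

lemma integral_limit_le:
  fixes f :: "nat \<Rightarrow> 'a \<Rightarrow> real"
  assumes f: "\<And>j. integrable M (f j)" "\<And>j x. f j x \<ge> 0" and [measurable]: "g \<in> borel_measurable M"
    and lim: "AE x in M. (\<lambda>j. f j x) \<longlonglongrightarrow> g x"
    and le: "\<forall>\<^sub>F j in sequentially. (\<integral>x. f j x \<partial>M) \<le> c" and c: "c \<ge> 0"
  shows "integrable M g" "(\<integral>x. g x \<partial>M) \<le> c"
proof -
  have [measurable]: "f j \<in> borel_measurable M" for j using f by auto
  have g0: "AE x in M. g x \<ge> 0"
    using lim by eventually_elim (use f(2) in \<open>auto intro: LIMSEQ_le_const\<close>)
  have "(\<integral>\<^sup>+x. ennreal (g x) \<partial>M) = (\<integral>\<^sup>+x. liminf (\<lambda>j. ennreal (f j x)) \<partial>M)"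
    by (rule nn_integral_cong_AE, use lim in eventually_elim)
      (metis tendsto_ennrealI lim_imp_Liminf sequentially_bot)
  also have "\<dots> \<le> liminf (\<lambda>j. \<integral>\<^sup>+x. ennreal (f j x) \<partial>M)"
    by (rule nn_integral_liminf) measurable
  also have "\<dots> \<le> ennreal c"
  proof (rule Liminf_le)
    show "\<forall>\<^sub>F j in sequentially. (\<integral>\<^sup>+x. ennreal (f j x) \<partial>M) \<le> ennreal c"
      using le by eventually_elim (use f in \<open>auto simp: nn_integral_eq_integral intro: ennreal_leI\<close>)
  qed simp
  finally have *: "(\<integral>\<^sup>+x. ennreal (g x) \<partial>M) \<le> ennreal c" .
  show i: "integrable M g"
    by (rule integrableI_nonneg) (use g0 * in \<open>auto intro: le_less_trans\<close>)
  show "(\<integral>x. g x \<partial>M) \<le> c"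
    using * c by (subst (asm) nn_integral_eq_integral[OF i g0]) (simp add: integral_nonneg_AE[OF g0])
qed

section \<open>The Poincare inequality under a change of the kernel\<close>

lemma Lp_space_ennreal:
  assumes "q \<ge> 1"
  shows "f \<in> Lp_space M (ennreal q) \<longleftrightarrow> f \<in> borel_measurable M \<and> integrable M (\<lambda>x. norm (f x) powr q)"
  using assms by (simp add: Lp_space_def)

text \<open>Continuity of the pairing at zero, where \<open>le_add_powr\<close> plays the role of Hoelder's inequality.\<close>

lemma Lp_pairing_small:
  fixes \<omega> :: "'a \<Rightarrow> real"
  assumes q: "q \<ge> 1" and \<omega>: "integrable M \<omega>" "\<And>x. \<bar>\<omega> x\<bar> \<le> B" and e: "e > 0"
  obtains \<delta> where "\<delta> > 0"
    "\<And>f :: 'a \<Rightarrow> 'b::euclidean_space. f \<in> Lp_space M (ennreal q) \<Longrightarrow> (\<integral>x. norm (f x) powr q \<partial>M) < \<delta>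
       \<Longrightarrow> (\<integral>x. norm (f x) * \<bar>\<omega> x\<bar> \<partial>M) < e"
proof -
  have B: "B \<ge> 0" using \<omega>(2)[of undefined] by linarith
  obtain l \<delta> where l: "l > 0" and \<delta>: "\<delta> > 0"
    and small: "\<And>a. a < \<delta> \<Longrightarrow> l * (\<integral>x. \<bar>\<omega> x\<bar> \<partial>M) + l powr (1 - q) * (B * a) < e"
    using interpolation_small[OF e, of "\<integral>x. \<bar>\<omega> x\<bar> \<partial>M" B q] B by auto
  show thesis
  proof (rule that[OF \<delta>])
    fix f :: "'a \<Rightarrow> 'b" assume f: "f \<in> Lp_space M (ennreal q)" and X: "(\<integral>x. norm (f x) powr q \<partial>M) < \<delta>"
    have fq: "integrable M (\<lambda>x. norm (f x) powr q)" using f Lp_space_ennreal[OF q] by blast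
    have "1 \<le> ennreal q" using q by simp
    have "(\<integral>x. norm (f x) * \<bar>\<omega> x\<bar> \<partial>M) \<le> (\<integral>x. l * \<bar>\<omega> x\<bar> + l powr (1 - q) * (B * norm (f x) powr q) \<partial>M)"
    proof (rule integral_mono)
      show "integrable M (\<lambda>x. norm (f x) * \<bar>\<omega> x\<bar>)"
        by (rule Lp_mult_integrable[OF f \<open>1 \<le> ennreal q\<close>, of _ B]) (use \<omega> in auto)
      show "integrable M (\<lambda>x. l * \<bar>\<omega> x\<bar> + l powr (1 - q) * (B * norm (f x) powr q))"
        using \<omega> fq by auto
      fix x
      have "norm (f x) * \<bar>\<omega> x\<bar> \<le> (l + l powr (1 - q) * norm (f x) powr q) * \<bar>\<omega> x\<bar>"
        using le_add_powr[of "norm (f x)" l q] l q by (intro mult_right_mono) auto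
      also have "\<dots> = l * \<bar>\<omega> x\<bar> + l powr (1 - q) * (\<bar>\<omega> x\<bar> * norm (f x) powr q)" by (simp add: algebra_simps)
      also have "\<dots> \<le> l * \<bar>\<omega> x\<bar> + l powr (1 - q) * (B * norm (f x) powr q)"
        using \<omega>(2)[of x] by (intro add_left_mono mult_left_mono mult_right_mono) auto
      finally show "norm (f x) * \<bar>\<omega> x\<bar> \<le> l * \<bar>\<omega> x\<bar> + l powr (1 - q) * (B * norm (f x) powr q)" .
    qed
    also have "\<dots> = l * (\<integral>x. \<bar>\<omega> x\<bar> \<partial>M) + l powr (1 - q) * (B * (\<integral>x. norm (f x) powr q \<partial>M))"
      using \<omega> fq by simp
    also have "\<dots> < e" by (rule small[OF X])
    finally show "(\<integral>x. norm (f x) * \<bar>\<omega> x\<bar> \<partial>M) < e" .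
  qed
qed

lemma weak_grad_diff:
  assumes p: "1 \<le> p" and \<kappa>: "odd_levy_field \<kappa>"
    and u: "u \<in> Lp_space lborel p" "g \<in> Lp_space lborel p" "weak_grad \<kappa> u g"
    and v: "v \<in> Lp_space lborel p" "h \<in> Lp_space lborel p" "weak_grad \<kappa> v h"
  shows "weak_grad \<kappa> (\<lambda>x. u x - v x) (\<lambda>x. g x - h x)"
  unfolding weak_grad_def
proof
  fix \<Phi> :: "'a \<Rightarrow> 'a" assume \<Phi>: "\<Phi> \<in> test_fields"
  obtain B where B: "\<And>x. norm (\<Phi> x) \<le> B" using test_field_bounded \<Phi> by blast
  note i = Lp_inner_integrable[OF _ p test_field_integrable[OF \<Phi>] B]
  have "- (\<integral>x. (u x - v x) * div_field \<kappa> \<Phi> x \<partial>lborel)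
      = - (\<integral>x. u x * div_field \<kappa> \<Phi> x \<partial>lborel) - - (\<integral>x. v x * div_field \<kappa> \<Phi> x \<partial>lborel)"
    using Lp_mult_div_field_integrable[OF u(1) p \<kappa> \<Phi>] Lp_mult_div_field_integrable[OF v(1) p \<kappa> \<Phi>]
    by (simp add: left_diff_distrib)
  also have "\<dots> = (\<integral>x. g x \<bullet> \<Phi> x \<partial>lborel) - (\<integral>x. h x \<bullet> \<Phi> x \<partial>lborel)"
    using bspec[OF u(3)[unfolded weak_grad_def] \<Phi>] bspec[OF v(3)[unfolded weak_grad_def] \<Phi>] by simp
  also have "\<dots> = (\<integral>x. (g x - h x) \<bullet> \<Phi> x \<partial>lborel)"
    using i[OF u(2)] i[OF v(2)] by (simp add: inner_diff_left)
  finally show "- (\<integral>x. (u x - v x) * div_field \<kappa> \<Phi> x \<partial>lborel) = (\<integral>x. (g x - h x) \<bullet> \<Phi> x \<partial>lborel)" .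
qed

lemma weak_grad_scale:
  assumes "weak_grad \<kappa> u g"
  shows "weak_grad \<kappa> (\<lambda>x. s * u x) (\<lambda>x. s *\<^sub>R g x)"
  using assms by (simp add: weak_grad_def mult.assoc flip: mult_minus_right)

lemma correlation_diff_kernel:
  assumes "integrable lborel (\<lambda>x. u x *\<^sub>R k (x - y))" "integrable lborel (\<lambda>x. u x *\<^sub>R l (x - y))"
  shows "correlation u (\<lambda>z. k z - l z) y = correlation u k y - correlation u l y"
  using assms by (simp add: correlation_def scaleR_diff_right)

text \<open>The Poincare inequality for the \<open>q\<close>-th powers of the norms, for Borel functions that vanish everywhere outside
  \<open>\<Omega>\<close>.\<close>

definition poincare_on :: "('a::euclidean_space \<Rightarrow> 'a) \<Rightarrow> real \<Rightarrow> 'a set \<Rightarrow> real \<Rightarrow> bool" where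
  "poincare_on \<kappa> q \<Omega> C \<longleftrightarrow> (\<forall>u g. u \<in> Lp_space lborel (ennreal q) \<and> (\<forall>x. x \<notin> \<Omega> \<longrightarrow> u x = 0) \<and>
     g \<in> Lp_space lborel (ennreal q) \<and> weak_grad \<kappa> u g \<longrightarrow>
     (\<integral>x. \<bar>u x\<bar> powr q \<partial>lborel) \<le> C * (\<integral>x. norm (g x) powr q \<partial>lborel))"

text \<open>The gradient for \<open>\<kappa>1\<close> is that for \<open>\<kappa>2\<close> minus the correlation with \<open>k0 = \<kappa>2 - \<kappa>1\<close>. Replace \<open>k0\<close> by \<open>k'\<close>
  up to an \<open>L\<^sup>1\<close> error \<open>\<eta>\<close>: by Young's inequality the error contributes a small multiple of the norm of \<open>u\<close>, which
  is absorbed on the left hand side.\<close>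

lemma poincare_up_to_regular_correlation:
  fixes \<kappa>1 \<kappa>2 :: "'a::euclidean_space \<Rightarrow> 'a"
  assumes \<kappa>1: "odd_levy_field \<kappa>1" and \<kappa>2: "odd_levy_field \<kappa>2"
    and k: "integrable lborel (\<lambda>z. \<kappa>2 z - \<kappa>1 z)" and q: "q \<ge> 1" and C: "C \<ge> 0"
    and P: "poincare_on \<kappa>1 q \<Omega> C"
  obtains k' M C' where "continuous_on UNIV k'" "M > 0" "\<And>z. norm z > M \<Longrightarrow> k' z = 0" "integrable lborel k'" "1 \<le> C'"
    "\<forall>u g. u \<in> Lp_space lborel (ennreal q) \<and> (\<forall>x. x \<notin> \<Omega> \<longrightarrow> u x = 0) \<and> g \<in> Lp_space lborel (ennreal q)
        \<and> weak_grad \<kappa>2 u g \<longrightarrow> (\<integral>x. \<bar>u x\<bar> powr q \<partial>lborel)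
          \<le> C' * ((\<integral>x. norm (g x) powr q \<partial>lborel) + (\<integral>y. norm (correlation u k' y) powr q \<partial>lborel))"
proof -
  define k0 where "k0 z = \<kappa>2 z - \<kappa>1 z" for z
  have k0: "integrable lborel k0" using k by (simp add: k0_def[abs_def])
  have p1: "1 \<le> ennreal q" using q by simp
  \<comment> \<open>The choice for which the absorbed term has a factor of at most \<open>1 / 2\<close>.\<close>
  define \<eta> where "\<eta> = (1 / (2 * (C + 1) * 4 powr q)) powr (1 / q) / 2"
  have \<eta>: "\<eta> > 0" using C by (simp add: \<eta>_def)
  have \<eta>q: "(2 * \<eta>) powr q = 1 / (2 * (C + 1) * 4 powr q)" using C q by (simp add: \<eta>_def powr_powr)
  obtain k' M where k': "continuous_on UNIV k'" "M > 0" "\<And>z. norm z > M \<Longrightarrow> k' z = 0" "integrable lborel k'"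
    "(\<integral>z. norm (k0 z - k' z) \<partial>lborel) \<le> \<eta>"
    by (rule integrable_approx_continuous_compact_support[OF k0 \<eta>]) (rule that)
  define d where "d z = k' z - k0 z" for z
  have d: "integrable lborel d" "(\<integral>z. norm (d z) \<partial>lborel) \<le> \<eta>"
    using k' k0 by (auto simp: d_def[abs_def] norm_minus_commute)
  show thesis
  proof (rule that[where C' = "2 * (C + 1) * 4 powr q", OF k'(1-4)], goal_cases)
    case 2
    have "1 * 1 \<le> (2 * (C + 1)) * 4 powr q" using C q by (intro mult_mono ge_one_powr_ge_zero) auto
    then show ?case by simp
  next
    case 3
    show ?case
    proof (intro allI impI, elim conjE)
      fix u g assume u: "u \<in> Lp_space lborel (ennreal q)" "\<forall>x. x \<notin> \<Omega> \<longrightarrow> u x = 0"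
        and g: "g \<in> Lp_space lborel (ennreal q)" and wg: "weak_grad \<kappa>2 u g"
      define X G K where "X = (\<integral>x. \<bar>u x\<bar> powr q \<partial>lborel)" and "G = (\<integral>x. norm (g x) powr q \<partial>lborel)"
        and "K = (\<integral>y. norm (correlation u k' y) powr q \<partial>lborel)"
      have nonneg: "X \<ge> 0" "G \<ge> 0" "K \<ge> 0" by (simp_all add: X_def G_def K_def)
      have [measurable]: "u \<in> borel_measurable borel" "g \<in> borel_measurable borel"
        using u g by (auto dest: Lp_spaceD_measurable)
      have [measurable]: "k' \<in> borel_measurable borel" "d \<in> borel_measurable borel" "k0 \<in> borel_measurable borel"
        using k' d k0 by auto
      have uq: "integrable lborel (\<lambda>x. \<bar>u x\<bar> powr q)" and gq: "integrable lborel (\<lambda>x. norm (g x) powr q)"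
        using u g by (simp_all add: Lp_space_ennreal[OF q])
      have cq: "integrable lborel (\<lambda>y. norm (correlation u k y) powr q)" if "integrable lborel k" for k
        using correlation_Lp[OF u(1) p1 that] Lp_space_ennreal[OF q] by blast
      have Yd: "(\<integral>y. norm (correlation u d y) powr q \<partial>lborel) \<le> (2 * \<eta>) powr q * X"
        unfolding X_def by (rule Young(3)[OF _ uq q d(1) d(2) \<eta>]) simp
      have AEi: "AE y in lborel. integrable lborel (\<lambda>x. u x *\<^sub>R k (x - y))" if "integrable lborel k" for k :: "'a \<Rightarrow> 'a"
        by (rule Young(1)[OF _ uq q that, where A = "(\<integral>z. norm (k z) \<partial>lborel) + 1"]) (auto intro: add_nonneg_pos)
      have split: "AE y in lborel. correlation u k0 y = correlation u k' y - correlation u d y"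
        using AEi[OF k'(4)] AEi[OF d(1)]
      proof eventually_elim
        case (elim y)
        have "k0 = (\<lambda>z. k' z - d z)" by (simp add: d_def fun_eq_iff)
        then show ?case using correlation_diff_kernel[OF elim] by simp
      qed
      have "(\<integral>y. norm (correlation u k0 y) powr q \<partial>lborel)
          = (\<integral>y. norm (correlation u k' y - correlation u d y) powr q \<partial>lborel)"
        by (rule integral_cong_AE) (use split in auto)
      also have "\<dots> \<le> 2 powr q * (K + (\<integral>y. norm (correlation u d y) powr q \<partial>lborel))"
        unfolding K_def by (rule powr_diff_integral_le(2)) (use q cq k' d in auto)
      also have "\<dots> \<le> 2 powr q * (K + (2 * \<eta>) powr q * X)" using Yd by (intro mult_left_mono) auto
      finally have c0: "(\<integral>y. norm (correlation u k0 y) powr q \<partial>lborel) \<le> 2 powr q * (K + (2 * \<eta>) powr q * X)" .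
      define h where "h y = g y - correlation u k0 y" for y
      have "weak_grad \<kappa>1 u h"
        unfolding h_def k0_def by (rule weak_grad_change_kernel[OF \<kappa>2 \<kappa>1 k u(1) p1 g wg])
      moreover have "h \<in> Lp_space lborel (ennreal q)"
        unfolding h_def by (intro Lp_space_diff[OF g correlation_Lp[OF u(1) p1 k0] p1])
      ultimately have "X \<le> C * (\<integral>x. norm (h x) powr q \<partial>lborel)"
        unfolding X_def using P u by (auto simp: poincare_on_def)
      also have "\<dots> \<le> C * (2 powr q * (G + (\<integral>y. norm (correlation u k0 y) powr q \<partial>lborel)))"
        unfolding h_def G_def by (intro mult_left_mono powr_diff_integral_le(2)) (use q cq k0 gq C in auto)
      also have "\<dots> \<le> C * (2 powr q * (G + 2 powr q * (K + (2 * \<eta>) powr q * X)))"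
        using c0 C by (intro mult_left_mono add_left_mono) auto
      also have "\<dots> = C * 2 powr q * G + C * 4 powr q * K + (C * 4 powr q * (2 * \<eta>) powr q) * X"
        using powr_mult[of 2 2 q] by (simp add: algebra_simps)
      also have "\<dots> \<le> C * 4 powr q * G + C * 4 powr q * K + (1 / 2) * X"
      proof (intro add_mono mult_right_mono mult_left_mono powr_mono2)
        have "C * 4 powr q * (2 * \<eta>) powr q = C / (2 * (C + 1))" unfolding \<eta>q by simp
        also have "\<dots> \<le> 1 / 2" using C by (simp add: field_simps)
        finally show "C * 4 powr q * (2 * \<eta>) powr q \<le> 1 / 2" .
      qed (use C q nonneg in auto)
      finally have "X \<le> 2 * C * 4 powr q * (G + K)" by (simp add: algebra_simps)
      also have "\<dots> \<le> 2 * (C + 1) * 4 powr q * (G + K)"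
        using nonneg C by (intro mult_right_mono) auto
      finally show "(\<integral>x. \<bar>u x\<bar> powr q \<partial>lborel)
         \<le> 2 * (C + 1) * 4 powr q * ((\<integral>x. norm (g x) powr q \<partial>lborel) + (\<integral>y. norm (correlation u k' y) powr q \<partial>lborel))"
        by (simp add: X_def G_def K_def)
    qed
  qed
qed

lemma Lp_bounded_support_integrable:
  fixes u :: "'a::euclidean_space \<Rightarrow> real"
  assumes q: "q \<ge> 1" and u: "u \<in> Lp_space lborel (ennreal q)" and supp: "\<And>x. norm x > R \<Longrightarrow> u x = 0"
  shows "integrable lborel u"
    and "(\<integral>x. \<bar>u x\<bar> \<partial>lborel) \<le> measure lborel (cball (0::'a) R) + (\<integral>x. \<bar>u x\<bar> powr q \<partial>lborel)"
proof -
  have [measurable]: "u \<in> borel_measurable borel" using u by (auto dest: Lp_spaceD_measurable)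
  have uq: "integrable lborel (\<lambda>x. \<bar>u x\<bar> powr q)" using u by (simp add: Lp_space_ennreal[OF q])
  have le: "\<bar>u x\<bar> \<le> indicator (cball 0 R) x + \<bar>u x\<bar> powr q" for x
    using le_add_powr[of "\<bar>u x\<bar>" 1 q] q supp[of x] by (cases "norm x \<le> R") auto
  have i: "integrable lborel (\<lambda>x. indicator (cball 0 R) x + \<bar>u x\<bar> powr q)"
    by (intro Bochner_Integration.integrable_add integrable_indicator_cball uq)
  show iu: "integrable lborel u"
    by (rule Bochner_Integration.integrable_bound[OF i]) (use le in \<open>auto intro!: AE_I2 order_trans[OF _ abs_ge_self]\<close>)
  have "(\<integral>x. \<bar>u x\<bar> \<partial>lborel) \<le> (\<integral>x. indicator (cball 0 R) x + \<bar>u x\<bar> powr q \<partial>lborel)"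
    by (rule integral_mono) (use iu i le in auto)
  also have "\<dots> = (\<integral>x. indicator (cball (0::'a) R) x \<partial>lborel) + (\<integral>x. \<bar>u x\<bar> powr q \<partial>lborel)"
    by (rule Bochner_Integration.integral_add[OF integrable_indicator_cball uq])
  finally show "(\<integral>x. \<bar>u x\<bar> \<partial>lborel) \<le> measure lborel (cball (0::'a) R) + (\<integral>x. \<bar>u x\<bar> powr q \<partial>lborel)" by simp
qed

text \<open>Completeness. On a bounded set a Cauchy sequence in \<open>L\<^sup>q\<close> is Cauchy in \<open>L\<^sup>1\<close>, so a subsequence converges almost everywhere,
  and Fatou's lemma carries the Cauchy estimate over to the limit.\<close>

lemma Lp_Cauchy_limit:
  fixes v :: "nat \<Rightarrow> 'a::euclidean_space \<Rightarrow> real"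
  assumes q: "q \<ge> 1" and v: "\<And>i. v i \<in> Lp_space lborel (ennreal q)" and supp: "\<And>i x. x \<notin> \<Omega> \<Longrightarrow> v i x = 0"
    and R: "\<Omega> \<subseteq> cball 0 R"
    and cauchy: "\<And>e. e > 0 \<Longrightarrow> \<exists>N. \<forall>i\<ge>N. \<forall>j\<ge>N. (\<integral>x. \<bar>v i x - v j x\<bar> powr q \<partial>lborel) < e"
  obtains w where "w \<in> Lp_space lborel (ennreal q)" "\<And>x. x \<notin> \<Omega> \<Longrightarrow> w x = 0"
    "\<And>e. e > 0 \<Longrightarrow> \<exists>N. \<forall>i\<ge>N. (\<integral>x. \<bar>v i x - w x\<bar> powr q \<partial>lborel) < e"
proof -
  have p1: "1 \<le> ennreal q" using q by simp
  have [measurable]: "v i \<in> borel_measurable borel" for i using v[of i] by (auto dest: Lp_spaceD_measurable)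
  have supp': "norm x > R \<Longrightarrow> v i x = 0" for i x using supp R by (force simp: subset_iff)
  have d: "(\<lambda>x. v i x - v j x) \<in> Lp_space lborel (ennreal q)" for i j by (rule Lp_space_diff[OF v v p1])
  have dq: "integrable lborel (\<lambda>x. \<bar>v i x - v j x\<bar> powr q)" for i j
    using d[of i j] by (simp add: Lp_space_ennreal[OF q])
  have vint: "integrable lborel (v i)" for i by (rule Lp_bounded_support_integrable(1)[OF q v supp'])
  have L1: "\<exists>N. \<forall>i\<ge>N. \<forall>j\<ge>N. (\<integral>x. norm (v i x - v j x) \<partial>lborel) < e" if e: "e > 0" for e
  proof -
    have ind1: "\<bar>indicator (cball (0::'a) R) x :: real\<bar> \<le> 1" for x by (simp add: indicator_def)
    obtain \<delta> where \<delta>: "\<delta> > 0" "\<And>f :: 'a \<Rightarrow> real. f \<in> Lp_space lborel (ennreal q) \<Longrightarrow> (\<integral>x. norm (f x) powr q \<partial>lborel) < \<delta>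
       \<Longrightarrow> (\<integral>x. norm (f x) * \<bar>indicator (cball (0::'a) R) x\<bar> \<partial>lborel) < e"
      by (rule Lp_pairing_small[where 'b=real, OF q integrable_indicator_cball[of "0::'a" R] ind1 e]) (rule that)
    obtain N where N: "\<And>i j. i \<ge> N \<Longrightarrow> j \<ge> N \<Longrightarrow> (\<integral>x. \<bar>v i x - v j x\<bar> powr q \<partial>lborel) < \<delta>"
      using cauchy[OF \<delta>(1)] by blast
    have "norm (v i x - v j x) * \<bar>indicator (cball 0 R) x\<bar> = norm (v i x - v j x)" for i j x
      using supp'[of x] by (cases "norm x \<le> R") auto
    then have "(\<integral>x. norm (v i x - v j x) \<partial>lborel) < e" if "i \<ge> N" "j \<ge> N" for i j
      using \<delta>(2)[OF d[of i j]] N[OF that] by (simp only: real_norm_def)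
    then show ?thesis by blast
  qed
  obtain s where s: "strict_mono s" "AE x in lborel. Cauchy (\<lambda>i. v (s i) x)"
    using cauchy_L1_AE_cauchy_subseq[OF vint L1] by blast
  define w where "w x = lim (\<lambda>i. v (s i) x)" for x
  have [measurable]: "w \<in> borel_measurable borel" unfolding w_def[abs_def] by measurable
  have w0: "w x = 0" if "x \<notin> \<Omega>" for x using supp[OF that] by (simp add: w_def)
  have lim: "AE x in lborel. (\<lambda>j. v (s j) x) \<longlonglongrightarrow> w x"
    using s(2) by eventually_elim (simp add: w_def Cauchy_convergent_iff convergent_LIMSEQ_iff)
  have close: "integrable lborel (\<lambda>x. \<bar>v i x - w x\<bar> powr q) \<and> (\<integral>x. \<bar>v i x - w x\<bar> powr q \<partial>lborel) \<le> e"
    if i: "\<And>j. j \<ge> i \<Longrightarrow> (\<integral>x. \<bar>v i x - v j x\<bar> powr q \<partial>lborel) < e" and e: "e > 0" for i e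
  proof -
    have "AE x in lborel. (\<lambda>j. \<bar>v i x - v (s j) x\<bar> powr q) \<longlonglongrightarrow> \<bar>v i x - w x\<bar> powr q"
      using lim by eventually_elim (intro tendsto_powr' tendsto_intros, use q in auto)
    moreover have "\<forall>\<^sub>F j in sequentially. (\<integral>x. \<bar>v i x - v (s j) x\<bar> powr q \<partial>lborel) \<le> e"
      using eventually_ge_at_top[of i]
    proof eventually_elim
      case (elim j)
      then have "s j \<ge> i" using seq_suble[OF s(1), of j] by linarith
      then show ?case using i by (simp add: less_imp_le)
    qed
    ultimately show ?thesis
      using integral_limit_le[of lborel "\<lambda>j x. \<bar>v i x - v (s j) x\<bar> powr q" "\<lambda>x. \<bar>v i x - w x\<bar> powr q" e] dq e by auto
  qed
  have ev: "\<exists>N. \<forall>i\<ge>N. integrable lborel (\<lambda>x. \<bar>v i x - w x\<bar> powr q) \<and> (\<integral>x. \<bar>v i x - w x\<bar> powr q \<partial>lborel) \<le> e" if e: "e > 0" for e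
  proof -
    obtain N where N: "\<And>i j. i \<ge> N \<Longrightarrow> j \<ge> N \<Longrightarrow> (\<integral>x. \<bar>v i x - v j x\<bar> powr q \<partial>lborel) < e"
      using cauchy[OF e] by blast
    show ?thesis using close[OF N e] by (intro exI[of _ N]) auto
  qed
  show thesis
  proof (rule that)
    obtain i where "integrable lborel (\<lambda>x. \<bar>v i x - w x\<bar> powr q)" using ev[of 1] by auto
    then have "(\<lambda>x. v i x - w x) \<in> Lp_space lborel (ennreal q)" by (simp add: Lp_space_ennreal[OF q])
    from Lp_space_diff[OF v[of i] this p1] show "w \<in> Lp_space lborel (ennreal q)" by simp
    show "\<exists>N. \<forall>i\<ge>N. (\<integral>x. \<bar>v i x - w x\<bar> powr q \<partial>lborel) < e" if e: "e > 0" for e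
    proof -
      obtain N where N: "\<And>i. i \<ge> N \<Longrightarrow> (\<integral>x. \<bar>v i x - w x\<bar> powr q \<partial>lborel) \<le> e / 2"
        using ev[of "e / 2"] e by auto
      have "(\<integral>x. \<bar>v i x - w x\<bar> powr q \<partial>lborel) < e" if "i \<ge> N" for i
        using N[OF that] \<open>e > 0\<close> by linarith
      then show ?thesis by blast
    qed
  qed (rule w0)
qed

text \<open>The weak gradient is closed: both the divergence of \<open>\<Phi>\<close> and \<open>\<Phi>\<close> itself are bounded and integrable, so the
  pairings with \<open>v i\<close> and \<open>g i\<close> converge.\<close>

lemma weak_grad_zero_of_limit:
  fixes v :: "nat \<Rightarrow> 'a::euclidean_space \<Rightarrow> real"
  assumes q: "q \<ge> 1" and \<kappa>: "odd_levy_field \<kappa>" and \<Phi>: "\<Phi> \<in> test_fields"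
    and v: "\<And>i. v i \<in> Lp_space lborel (ennreal q)" and g: "\<And>i. g i \<in> Lp_space lborel (ennreal q)"
    and wg: "\<And>i. weak_grad \<kappa> (v i) (g i)" and w: "w \<in> Lp_space lborel (ennreal q)"
    and vw: "\<And>e. e > 0 \<Longrightarrow> \<exists>N. \<forall>i\<ge>N. (\<integral>x. \<bar>v i x - w x\<bar> powr q \<partial>lborel) < e"
    and g0: "\<And>e. e > 0 \<Longrightarrow> \<exists>N. \<forall>i\<ge>N. (\<integral>x. norm (g i x) powr q \<partial>lborel) < e"
  shows "(\<integral>x. w x * div_field \<kappa> \<Phi> x \<partial>lborel) = 0"
proof -
  have p1: "1 \<le> ennreal q" using q by simp
  obtain B where B: "B \<ge> 0" "\<And>x. norm (\<Phi> x) \<le> B" using test_field_bounded \<Phi> by blast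
  have \<Phi>i: "integrable lborel (\<lambda>x. norm (\<Phi> x))" using test_field_integrable[OF \<Phi>] by auto
  obtain L where L: "L \<ge> 0" "\<And>x y. norm (\<Phi> x - \<Phi> y) \<le> L * min 1 (norm (x - y))"
    using test_field_modulus[OF \<Phi>] by blast
  note Db = div_field_bounded[OF \<kappa> test_field_measurable[OF \<Phi>] L(2)]
  note Di = div_field_integrable[OF \<kappa> \<Phi>]
  have "\<bar>\<integral>x. w x * div_field \<kappa> \<Phi> x \<partial>lborel\<bar> < e" if e: "e > 0" for e
  proof -
    have e2: "e / 2 > 0" using e by simp
    obtain \<delta>1 where \<delta>1: "\<delta>1 > 0" "\<And>f :: 'a \<Rightarrow> real. f \<in> Lp_space lborel (ennreal q) \<Longrightarrow> (\<integral>x. norm (f x) powr q \<partial>lborel) < \<delta>1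
       \<Longrightarrow> (\<integral>x. norm (f x) * \<bar>div_field \<kappa> \<Phi> x\<bar> \<partial>lborel) < e / 2"
      by (rule Lp_pairing_small[where 'b=real, OF q Di Db e2]) (rule that)
    have nB: "\<bar>norm (\<Phi> x)\<bar> \<le> B" for x using B by simp
    obtain \<delta>2 where \<delta>2: "\<delta>2 > 0" "\<And>f :: 'a \<Rightarrow> 'a. f \<in> Lp_space lborel (ennreal q) \<Longrightarrow> (\<integral>x. norm (f x) powr q \<partial>lborel) < \<delta>2
       \<Longrightarrow> (\<integral>x. norm (f x) * \<bar>norm (\<Phi> x)\<bar> \<partial>lborel) < e / 2"
      by (rule Lp_pairing_small[where 'b='a, OF q \<Phi>i nB e2]) (rule that)
    obtain N1 where N1: "\<And>i. i \<ge> N1 \<Longrightarrow> (\<integral>x. \<bar>v i x - w x\<bar> powr q \<partial>lborel) < \<delta>1" using vw[OF \<delta>1(1)] by blast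
    obtain N2 where N2: "\<And>i. i \<ge> N2 \<Longrightarrow> (\<integral>x. norm (g i x) powr q \<partial>lborel) < \<delta>2" using g0[OF \<delta>2(1)] by blast
    define i where "i = max N1 N2"
    have d: "(\<lambda>x. v i x - w x) \<in> Lp_space lborel (ennreal q)" by (rule Lp_space_diff[OF v w p1])
    have gi: "integrable lborel (\<lambda>x. g i x \<bullet> \<Phi> x)"
      by (rule Lp_inner_integrable[OF g p1 test_field_integrable[OF \<Phi>] B(2)])
    have 1: "\<bar>\<integral>x. (v i x - w x) * div_field \<kappa> \<Phi> x \<partial>lborel\<bar> < e / 2"
    proof -
      have "\<bar>\<integral>x. (v i x - w x) * div_field \<kappa> \<Phi> x \<partial>lborel\<bar> \<le> (\<integral>x. \<bar>(v i x - w x) * div_field \<kappa> \<Phi> x\<bar> \<partial>lborel)"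
        by (rule integral_abs_bound)
      also have "\<dots> = (\<integral>x. norm (v i x - w x) * \<bar>div_field \<kappa> \<Phi> x\<bar> \<partial>lborel)" by (simp add: abs_mult)
      also have "\<dots> < e / 2" using \<delta>1(2)[OF d] N1[of i] by (simp add: i_def)
      finally show ?thesis .
    qed
    have 2: "\<bar>\<integral>x. g i x \<bullet> \<Phi> x \<partial>lborel\<bar> < e / 2"
    proof -
      have "\<bar>\<integral>x. g i x \<bullet> \<Phi> x \<partial>lborel\<bar> \<le> (\<integral>x. \<bar>g i x \<bullet> \<Phi> x\<bar> \<partial>lborel)" by (rule integral_abs_bound)
      also have "\<dots> \<le> (\<integral>x. norm (g i x) * \<bar>norm (\<Phi> x)\<bar> \<partial>lborel)"
      proof (rule integral_mono)
        show "integrable lborel (\<lambda>x. norm (g i x) * \<bar>norm (\<Phi> x)\<bar>)"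
          by (rule Lp_mult_integrable[OF g p1, of _ B]) (use \<Phi>i B in auto)
      qed (use gi Cauchy_Schwarz_ineq2 in auto)
      also have "\<dots> < e / 2" using \<delta>2(2)[OF g] N2[of i] by (simp add: i_def)
      finally show ?thesis .
    qed
    have "(\<integral>x. w x * div_field \<kappa> \<Phi> x \<partial>lborel)
        = (\<integral>x. v i x * div_field \<kappa> \<Phi> x \<partial>lborel) - (\<integral>x. (v i x - w x) * div_field \<kappa> \<Phi> x \<partial>lborel)"
      using Lp_mult_div_field_integrable[OF v[of i] p1 \<kappa> \<Phi>] Lp_mult_div_field_integrable[OF w p1 \<kappa> \<Phi>]
      by (simp add: left_diff_distrib)
    also have "(\<integral>x. v i x * div_field \<kappa> \<Phi> x \<partial>lborel) = - (\<integral>x. g i x \<bullet> \<Phi> x \<partial>lborel)"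
      using bspec[OF wg[of i, unfolded weak_grad_def] \<Phi>] by simp
    finally show ?thesis using 1 2 by linarith
  qed
  then show ?thesis by (metis less_irrefl zero_less_abs_iff)
qed

text \<open>If no constant works, normalised counterexamples for the constants \<open>n + 1\<close> have a convergent subsequence; its
  limit has zero gradient and hence is zero by injectivity, against the normalisation. Constants of this form suffice, and
  they make the negation directly usable as a sequence.\<close>

lemma poincare_change_kernel:
  fixes \<kappa>1 \<kappa>2 :: "'a::euclidean_space \<Rightarrow> 'a"
  assumes \<kappa>1: "odd_levy_field \<kappa>1" and \<kappa>2: "odd_levy_field \<kappa>2"
    and k: "integrable lborel (\<lambda>z. \<kappa>2 z - \<kappa>1 z)"
    and c: "\<And>z. \<kappa>2 z = c z *\<^sub>R z" "\<And>z. c z \<ge> 0"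
    and pos: "\<epsilon> > 0" "AE z in lborel. norm z < \<epsilon> \<longrightarrow> c z > 0"
    and q: "q \<ge> 1" and C: "C \<ge> 0" and R: "R > 0" "\<Omega> \<subseteq> cball 0 R"
    and P: "poincare_on \<kappa>1 q \<Omega> C"
  shows "\<exists>n::nat. poincare_on \<kappa>2 q \<Omega> (real (Suc n))"
proof (rule ccontr)
  assume neg: "\<not> ?thesis"
  have p1: "1 \<le> ennreal q" using q by simp
  define Q where "Q n u g \<longleftrightarrow> u \<in> Lp_space lborel (ennreal q) \<and> (\<forall>x. x \<notin> \<Omega> \<longrightarrow> u x = 0) \<and> g \<in> Lp_space lborel (ennreal q)
        \<and> weak_grad \<kappa>2 u g \<and> (\<integral>x. \<bar>u x\<bar> powr q \<partial>lborel) = 1 \<and> (\<integral>x. norm (g x) powr q \<partial>lborel) \<le> inverse (real (Suc n))"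
    for n and u :: "'a \<Rightarrow> real" and g :: "'a \<Rightarrow> 'a"
  have ex: "\<exists>u g. Q n u g" for n
  proof -
    obtain u g where u: "u \<in> Lp_space lborel (ennreal q)" "\<forall>x. x \<notin> \<Omega> \<longrightarrow> u x = 0"
      and g: "g \<in> Lp_space lborel (ennreal q)" "weak_grad \<kappa>2 u g"
      and big: "(\<integral>x. \<bar>u x\<bar> powr q \<partial>lborel) > real (Suc n) * (\<integral>x. norm (g x) powr q \<partial>lborel)"
      using neg unfolding poincare_on_def by (meson not_le)
    define X where "X = (\<integral>x. \<bar>u x\<bar> powr q \<partial>lborel)"
    have "(\<integral>x. norm (g x) powr q \<partial>lborel) \<ge> 0" by simp
    then have X: "X > 0" using big unfolding X_def by (smt (verit) mult_nonneg_nonneg of_nat_0_le_iff)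
    define s where "s = X powr (- 1 / q)"
    have "s powr q = X powr (- 1)" using q unfolding s_def powr_powr by simp
    then have s: "s > 0" "s powr q = inverse X" using X by (simp_all add: s_def powr_minus)
    have uq: "integrable lborel (\<lambda>x. \<bar>u x\<bar> powr q)" and gq: "integrable lborel (\<lambda>x. norm (g x) powr q)"
      using u g by (simp_all add: Lp_space_ennreal[OF q])
    have eu: "\<bar>s * u x\<bar> powr q = inverse X * \<bar>u x\<bar> powr q" for x
      using s by (simp add: abs_mult powr_mult)
    have eg: "norm (s *\<^sub>R g x) powr q = inverse X * norm (g x) powr q" for x
      using s by (simp add: powr_mult)
    have "(\<lambda>x. s * u x) \<in> Lp_space lborel (ennreal q)" "(\<lambda>x. s *\<^sub>R g x) \<in> Lp_space lborel (ennreal q)"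
      using u g uq gq unfolding Lp_space_ennreal[OF q] real_norm_def eu eg by auto
    moreover have "weak_grad \<kappa>2 (\<lambda>x. s * u x) (\<lambda>x. s *\<^sub>R g x)" by (rule weak_grad_scale[OF g(2)])
    moreover have "(\<integral>x. \<bar>s * u x\<bar> powr q \<partial>lborel) = 1" unfolding eu using X by (simp add: X_def)
    moreover have "(\<integral>x. norm (s *\<^sub>R g x) powr q \<partial>lborel) \<le> inverse (real (Suc n))"
      unfolding eg using big X by (simp add: X_def field_simps)
    ultimately show ?thesis using u(2) unfolding Q_def by (intro exI[of _ "\<lambda>x. s * u x"] exI[of _ "\<lambda>x. s *\<^sub>R g x"]) simp
  qed
  obtain u g where ug: "\<And>n. Q n (u n) (g n)" using ex by metis
  have u: "u n \<in> Lp_space lborel (ennreal q)" "x \<notin> \<Omega> \<Longrightarrow> u n x = 0"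
    and g: "g n \<in> Lp_space lborel (ennreal q)" "weak_grad \<kappa>2 (u n) (g n)"
    and u1: "(\<integral>x. \<bar>u n x\<bar> powr q \<partial>lborel) = 1"
    and g1: "(\<integral>x. norm (g n x) powr q \<partial>lborel) \<le> inverse (real (Suc n))" for n x
    using ug[of n] by (simp_all add: Q_def)
  have supp: "norm x > R \<Longrightarrow> u n x = 0" for n x using u(2) R(2) by (force simp: subset_iff)
  obtain k' M C' where k': "continuous_on UNIV k'" "M > 0" "\<And>z. norm z > M \<Longrightarrow> k' z = 0" "integrable lborel k'"
    and C1: "1 \<le> C'"
    and est: "\<forall>u g. u \<in> Lp_space lborel (ennreal q) \<and> (\<forall>x. x \<notin> \<Omega> \<longrightarrow> u x = 0) \<and> g \<in> Lp_space lborel (ennreal q)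
        \<and> weak_grad \<kappa>2 u g \<longrightarrow> (\<integral>x. \<bar>u x\<bar> powr q \<partial>lborel)
          \<le> C' * ((\<integral>x. norm (g x) powr q \<partial>lborel) + (\<integral>y. norm (correlation u k' y) powr q \<partial>lborel))"
    by (rule poincare_up_to_regular_correlation[OF \<kappa>1 \<kappa>2 k q C P]) (rule that)
  have C': "C' > 0" using C1 by simp
  have u_int: "integrable lborel (u n)" for n by (rule Lp_bounded_support_integrable(1)[OF q u(1) supp])
  have u_L1: "(\<integral>x. \<bar>u n x\<bar> \<partial>lborel) \<le> measure lborel (cball (0::'a) R) + 1" for n
    using Lp_bounded_support_integrable(2)[where R=R, OF q u(1)[of n] supp] u1 by simp
  obtain r :: "nat \<Rightarrow> nat" where r: "strict_mono r"
    and comp: "\<And>e. e > 0 \<Longrightarrow> \<exists>N. \<forall>i\<ge>N. \<forall>j\<ge>N.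
       (\<integral>y. norm (correlation (u (r i)) k' y - correlation (u (r j)) k' y) powr q \<partial>lborel) < e"
    by (rule correlation_compact[OF k'(1-3) u_int R(1) supp u_L1 q]) (assumption | rule that)+
  have gr: "\<exists>N. \<forall>i\<ge>N. (\<integral>x. norm (g (r i) x) powr q \<partial>lborel) < e" if e: "e > 0" for e
  proof -
    obtain N where N: "inverse (real (Suc N)) < e" using reals_Archimedean[OF e] by blast
    have "(\<integral>x. norm (g (r i) x) powr q \<partial>lborel) < e" if "i \<ge> N" for i
    proof -
      have "inverse (real (Suc (r i))) \<le> inverse (real (Suc N))"
        using seq_suble[OF r, of i] that by (intro le_imp_inverse_le) auto
      then show ?thesis using g1[of "r i"] N by linarith
    qed
    then show ?thesis by blast
  qed
  have gq: "integrable lborel (\<lambda>x. norm (g n x) powr q)" "g n \<in> borel_measurable lborel" for n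
    using g(1)[of n] by (simp_all add: Lp_space_ennreal[OF q])
  have corr_diff: "correlation (\<lambda>x. u m x - u n x) k' y = correlation (u m) k' y - correlation (u n) k' y" for m n y
  proof -
    obtain K where K: "\<And>z. norm (k' z) \<le> K"
      using compactly_supported_continuous_bounded[OF k'(1), of M] k'(3) by blast
    have [measurable]: "k' \<in> borel_measurable borel" using k'(4) by auto
    have [measurable]: "u n \<in> borel_measurable borel" for n using u_int by auto
    have le: "norm (u n x *\<^sub>R k' (x - y)) \<le> norm (u n x * K)" for n x
      unfolding norm_scaleR real_norm_def abs_mult using K[of "x - y"] by (intro mult_left_mono) auto
    have "integrable lborel (\<lambda>x. u n x *\<^sub>R k' (x - y))" for n
      by (rule Bochner_Integration.integrable_bound[where f="\<lambda>x. u n x * K"]) (use u_int le in auto)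
    then show ?thesis by (simp add: correlation_def scaleR_diff_left)
  qed
  have cauchy: "\<exists>N. \<forall>i\<ge>N. \<forall>j\<ge>N. (\<integral>x. \<bar>u (r i) x - u (r j) x\<bar> powr q \<partial>lborel) < e" if e: "e > 0" for e
  proof -
    define e1 where "e1 = e / (2 * C')"
    have e1: "e1 > 0" using e C' by (simp add: e1_def)
    define e2 where "e2 = e1 / (2 * 2 powr q)"
    have e2: "e2 > 0" using e1 by (simp add: e2_def)
    obtain N1 where N1: "\<And>i j. i \<ge> N1 \<Longrightarrow> j \<ge> N1 \<Longrightarrow>
        (\<integral>y. norm (correlation (u (r i)) k' y - correlation (u (r j)) k' y) powr q \<partial>lborel) < e1"
      using comp[OF e1] by blast
    obtain N2 where N2: "\<And>i. i \<ge> N2 \<Longrightarrow> (\<integral>x. norm (g (r i) x) powr q \<partial>lborel) < e2" using gr[OF e2] by blast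
    have "(\<integral>x. \<bar>u (r i) x - u (r j) x\<bar> powr q \<partial>lborel) < e" if ij: "i \<ge> max N1 N2" "j \<ge> max N1 N2" for i j
    proof -
      have "(\<integral>x. norm (g (r i) x - g (r j) x) powr q \<partial>lborel)
          \<le> 2 powr q * ((\<integral>x. norm (g (r i) x) powr q \<partial>lborel) + (\<integral>x. norm (g (r j) x) powr q \<partial>lborel))"
        by (rule powr_diff_integral_le(2)) (use q gq in auto)
      also have "\<dots> < 2 powr q * (e2 + e2)"
        using N2[of i] N2[of j] ij by (intro mult_strict_left_mono add_strict_mono) auto
      also have "\<dots> = e1" by (simp add: e2_def)
      finally have G: "(\<integral>x. norm (g (r i) x - g (r j) x) powr q \<partial>lborel) < e1" .
      have "(\<integral>x. \<bar>u (r i) x - u (r j) x\<bar> powr q \<partial>lborel)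
        \<le> C' * ((\<integral>x. norm (g (r i) x - g (r j) x) powr q \<partial>lborel)
            + (\<integral>y. norm (correlation (\<lambda>x. u (r i) x - u (r j) x) k' y) powr q \<partial>lborel))"
        by (rule est[rule_format]) (use u g p1 in \<open>auto intro: Lp_space_diff weak_grad_diff[OF p1 \<kappa>2]\<close>)
      also have "\<dots> < C' * (e1 + e1)"
        unfolding corr_diff using G N1[of i j] ij C' by (intro mult_strict_left_mono add_strict_mono) auto
      also have "\<dots> = e" using C' by (simp add: e1_def)
      finally show ?thesis .
    qed
    then show ?thesis by blast
  qed
  obtain w where w: "w \<in> Lp_space lborel (ennreal q)" "\<And>x. x \<notin> \<Omega> \<Longrightarrow> w x = 0"
    and lim: "\<And>e. e > 0 \<Longrightarrow> \<exists>N. \<forall>i\<ge>N. (\<integral>x. \<bar>u (r i) x - w x\<bar> powr q \<partial>lborel) < e"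
    by (rule Lp_Cauchy_limit[of q "\<lambda>i. u (r i)" \<Omega> R, OF q u(1) u(2) R(2) cauchy]) (assumption | rule that)+
  have w_supp: "norm x > R \<Longrightarrow> w x = 0" for x using w(2) R(2) by (force simp: subset_iff)
  have "AE x in lborel. w x = 0"
  proof (rule weak_grad_zero_imp_AE_zero[OF \<kappa>2 c pos _ w_supp])
    show "integrable lborel w" by (rule Lp_bounded_support_integrable(1)[OF q w(1) w_supp])
    fix \<Phi> :: "'a \<Rightarrow> 'a" assume "\<Phi> \<in> test_fields"
    then show "(\<integral>x. w x * div_field \<kappa>2 \<Phi> x \<partial>lborel) = 0"
      by (rule weak_grad_zero_of_limit[OF q \<kappa>2 _ u(1) g(1) g(2) w(1) lim gr])
  qed
  moreover obtain i where "(\<integral>x. \<bar>u (r i) x - w x\<bar> powr q \<partial>lborel) < 1" using lim[of 1] by auto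
  moreover have "(\<integral>x. \<bar>u (r i) x - w x\<bar> powr q \<partial>lborel) = (\<integral>x. \<bar>u (r i) x\<bar> powr q \<partial>lborel)"
    if "AE x in lborel. w x = 0"
  proof (rule integral_cong_AE)
    have [measurable]: "u n \<in> borel_measurable borel" "w \<in> borel_measurable borel" for n
      using u(1)[of n] w(1) by (auto dest: Lp_spaceD_measurable)
    show "(\<lambda>x. \<bar>u (r i) x - w x\<bar> powr q) \<in> borel_measurable lborel"
      "(\<lambda>x. \<bar>u (r i) x\<bar> powr q) \<in> borel_measurable lborel" by measurable
    show "AE x in lborel. \<bar>u (r i) x - w x\<bar> powr q = \<bar>u (r i) x\<bar> powr q"
      using that by eventually_elim simp
  qed
  ultimately show False using u1 by simp
qed

section \<open>From Borel to Lebesgue measurable functions\<close>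

lemma borel_version:
  fixes f :: "'a::euclidean_space \<Rightarrow> 'b::euclidean_space"
  assumes "f \<in> borel_measurable lebesgue"
  obtains f' where "f' \<in> borel_measurable borel" "AE x in lborel. f x = f' x"
proof -
  have "\<exists>g\<in>borel_measurable lborel. AE x in lborel. f x \<bullet> b = g x" for b
    by (rule completion_ex_borel_measurable_real) (use assms in measurable)
  then obtain g where g: "\<And>b. g b \<in> borel_measurable lborel" "\<And>b. AE x in lborel. f x \<bullet> b = g b x"
    by metis
  define f' where "f' x = (\<Sum>b\<in>Basis. g b x *\<^sub>R b)" for x
  have "f' \<in> borel_measurable borel" unfolding f'_def[abs_def] using g(1) by simp
  moreover have "AE x in lborel. \<forall>b\<in>Basis. f x \<bullet> b = g b x"
    by (intro AE_finite_allI g finite_Basis)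
  then have "AE x in lborel. f x = f' x"
  proof eventually_elim
    case (elim x)
    then show ?case using euclidean_representation[of "f x"] by (simp add: f'_def)
  qed
  ultimately show thesis by (rule that)
qed

lemma measurable_lebesgue_of_AE_eq:
  fixes f :: "'a::euclidean_space \<Rightarrow> 'b::euclidean_space"
  assumes "f' \<in> borel_measurable borel" "AE x in lborel. f x = f' x"
  shows "f \<in> borel_measurable lebesgue"
proof (rule borel_measurable_AE)
  show "f' \<in> borel_measurable lebesgue" using assms(1) by (simp add: measurable_completion)
  show "AE x in lebesgue. f' x = f x" unfolding AE_completion_iff using assms(2) by eventually_elim simp
qed

lemma
  fixes f :: "'a::euclidean_space \<Rightarrow> 'b::euclidean_space"
  assumes [measurable]: "f' \<in> borel_measurable borel" and AE: "AE x in lborel. f x = f' x"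
  shows integral_lebesgue_AE_eq: "(\<integral>x. f x \<partial>lebesgue) = (\<integral>x. f' x \<partial>lborel)"
    and integrable_lebesgue_AE_eq: "integrable lebesgue f \<longleftrightarrow> integrable lborel f'"
proof -
  have f: "f \<in> borel_measurable lebesgue" by (rule measurable_lebesgue_of_AE_eq[OF assms])
  have f': "f' \<in> borel_measurable lebesgue" by (simp add: measurable_completion)
  have AE': "AE x in lebesgue. f x = f' x" unfolding AE_completion_iff by (rule AE)
  show "(\<integral>x. f x \<partial>lebesgue) = (\<integral>x. f' x \<partial>lborel)"
    using integral_cong_AE[OF f f' AE'] by (simp add: integral_completion)
  show "integrable lebesgue f \<longleftrightarrow> integrable lborel f'"
    using integrable_cong_AE[OF f f' AE'] by (simp add: integrable_completion)
qed

lemma AE_reflect: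
  assumes "AE z in lborel. P (z :: 'a::euclidean_space)"
  shows "AE y in lborel. P (x - y)"
proof -
  obtain N where N: "N \<in> null_sets lborel" "{z. \<not> P z} \<subseteq> N"
    using assms unfolding eventually_ae_filter by auto
  have [measurable]: "N \<in> sets borel" using N by auto
  have "emeasure lborel ((\<lambda>y. x - y) -` N) = emeasure (distr lborel borel (\<lambda>y. x - y)) N"
    by (simp add: emeasure_distr)
  also have "\<dots> = 0" unfolding lborel_distr_reflect using N(1) by (rule null_setsD1)
  finally have "(\<lambda>y. x - y) -` N \<in> null_sets lborel"
    using measurable_sets[of "\<lambda>y. x - y" borel borel N] by (auto simp: null_sets_def)
  then show ?thesis by (rule AE_I') (use N in auto)
qed

lemma Lp_transfer:
  fixes f :: "'a::euclidean_space \<Rightarrow> 'b::euclidean_space"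
  assumes [measurable]: "f' \<in> borel_measurable borel" and AE: "AE x in lborel. f x = f' x"
  shows "f \<in> Lp_space lebesgue p \<longleftrightarrow> f' \<in> Lp_space lborel p"
    and "Lp_norm lebesgue p f = Lp_norm lborel p f'"
proof -
  have f[measurable]: "f \<in> borel_measurable lebesgue" by (rule measurable_lebesgue_of_AE_eq[OF assms])
  have "(\<lambda>x. ennreal (norm (f x))) \<in> borel_measurable lebesgue" by measurable
  then have ess: "esssup lebesgue (\<lambda>x. ennreal (norm (f x))) = esssup lborel (\<lambda>x. ennreal (norm (f' x)))"
  proof (subst (1 2) esssup_eq_AE)
    have "(AE x in lborel. ennreal (norm (f x)) \<le> z) \<longleftrightarrow> (AE x in lborel. ennreal (norm (f' x)) \<le> z)" for z
      by (rule eventually_subst, use AE in eventually_elim) simp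
    then show "Inf {z. AE x in lebesgue. ennreal (norm (f x)) \<le> z} = Inf {z. AE x in lborel. ennreal (norm (f' x)) \<le> z}"
      unfolding AE_completion_iff by simp
  qed measurable
  have AEq: "AE x in lborel. norm (f x) powr r = norm (f' x) powr r" for r
    using AE by eventually_elim simp
  have int: "integrable lebesgue (\<lambda>x. norm (f x) powr r) \<longleftrightarrow> integrable lborel (\<lambda>x. norm (f' x) powr r)"
    "(\<integral>x. norm (f x) powr r \<partial>lebesgue) = (\<integral>x. norm (f' x) powr r \<partial>lborel)" for r
    by (rule integrable_lebesgue_AE_eq[OF _ AEq], simp) (rule integral_lebesgue_AE_eq[OF _ AEq], simp)
  show "f \<in> Lp_space lebesgue p \<longleftrightarrow> f' \<in> Lp_space lborel p"
    using f int(1) by (simp add: Lp_space_def ess)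
  show "Lp_norm lebesgue p f = Lp_norm lborel p f'"
    by (simp add: Lp_norm_def ess int(2))
qed

text \<open>The factor \<open>c z = \<rho> z / \<bar>z\<bar>\<^sup>2\<close> in \<open>\<kappa> z = c z *\<^sub>R z\<close>, in a Borel version.\<close>

definition kernel_factor :: "('a::euclidean_space \<Rightarrow> ennreal) \<Rightarrow> ('a \<Rightarrow> real) \<Rightarrow> bool" where
  "kernel_factor \<rho> c \<longleftrightarrow> c \<in> borel_measurable borel \<and> (\<forall>z. c z \<ge> 0) \<and> odd_levy_field (\<lambda>z. c z *\<^sub>R z) \<and>
     (AE z in lborel. c z * (norm z)\<^sup>2 = enn2real (\<rho> z)) \<and>
     (\<exists>\<epsilon>>0. AE z in lborel. norm z < \<epsilon> \<longrightarrow> c z > 0)"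

text \<open>A Borel version of a radial function need not be even; it is symmetrised so that the field is odd everywhere.
  Taking the maximum with \<open>0\<close> makes it nonnegative everywhere.\<close>

lemma admissible_kernel_factor:
  fixes \<rho> :: "'a::euclidean_space \<Rightarrow> ennreal"
  assumes "admissible_kernel \<rho>"
  obtains c where "kernel_factor \<rho> c"
proof -
  have rad: "\<rho> (- z) = \<rho> z" for z using assms by (auto simp: admissible_kernel_def radial_def)
  have fin: "z \<noteq> 0 \<Longrightarrow> \<rho> z < \<infinity>" for z using assms by (simp add: admissible_kernel_def)
  have [measurable]: "\<rho> \<in> borel_measurable lebesgue"
    using assms by (simp add: admissible_kernel_def locally_integrable_def)
  have nn: "(\<integral>\<^sup>+x. ennreal (min 1 (inverse (norm x))) * \<rho> x \<partial>lebesgue) < \<infinity>"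
    using assms by (simp add: admissible_kernel_def)
  obtain \<epsilon> where \<epsilon>: "\<epsilon> > 0" "(INF x\<in>ball 0 \<epsilon>. \<rho> x) > 0" using assms by (auto simp: admissible_kernel_def)
  obtain r0 where [measurable]: "r0 \<in> borel_measurable borel" and r0: "AE x in lborel. enn2real (\<rho> x) = r0 x"
  proof -
    have "(\<lambda>x. enn2real (\<rho> x)) \<in> borel_measurable lebesgue" by measurable
    then show thesis using borel_version that by blast
  qed
  have r0': "AE x in lborel. enn2real (\<rho> x) = r0 (- x)" using AE_reflect[OF r0, of 0] by (simp add: rad)
  define r where "r z = max 0 ((r0 z + r0 (- z)) / 2)" for z
  have [measurable]: "r \<in> borel_measurable borel" unfolding r_def[abs_def] by measurable
  have r: "r (- z) = r z" "r z \<ge> 0" for z by (simp_all add: r_def add.commute)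
  have nz: "AE z in lborel. z \<noteq> (0::'a)" by (rule AE_lborel_singleton)
  have r_eq: "AE z in lborel. r z = enn2real (\<rho> z)"
    using r0 r0'
  proof eventually_elim
    case (elim z)
    then have "r0 z \<ge> 0" using enn2real_nonneg[of "\<rho> z"] by simp
    then show ?case using elim by (simp add: r_def)
  qed
  define c where "c z = r z / (norm z)\<^sup>2" for z
  have [measurable]: "c \<in> borel_measurable borel" unfolding c_def[abs_def] by measurable
  have "integrable lborel (\<lambda>z. min 1 (inverse (norm z)) * r z)"
  proof (rule integrableI_nonneg)
    have "(\<integral>\<^sup>+x. ennreal (min 1 (inverse (norm x)) * r x) \<partial>lborel) = (\<integral>\<^sup>+x. ennreal (min 1 (inverse (norm x))) * \<rho> x \<partial>lborel)"
    proof (rule nn_integral_cong_AE)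
      show "AE x in lborel. ennreal (min 1 (inverse (norm x)) * r x) = ennreal (min 1 (inverse (norm x))) * \<rho> x"
        using r_eq nz
      proof eventually_elim
        case (elim x)
        then have "ennreal (r x) = \<rho> x" using fin[of x] by (simp add: ennreal_enn2real)
        then show ?case using r(2)[of x] by (simp add: ennreal_mult)
      qed
    qed
    also have "\<dots> = (\<integral>\<^sup>+x. ennreal (min 1 (inverse (norm x))) * \<rho> x \<partial>lebesgue)"
      by (rule nn_integral_completion[symmetric])
    finally show "(\<integral>\<^sup>+x. ennreal (min 1 (inverse (norm x)) * r x) \<partial>lborel) < \<infinity>" using nn by simp
    show "AE x in lborel. 0 \<le> min 1 (inverse (norm x)) * r x" using r by simp
  qed measurable
  moreover have c_norm: "min 1 (norm z) * norm (c z *\<^sub>R z) = min 1 (inverse (norm z)) * r z" if "z \<noteq> 0" for z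
  proof -
    have "norm (c z *\<^sub>R z) = r z / norm z" using that r(2)[of z] by (simp add: c_def power2_eq_square)
    moreover have "min 1 (norm z) * inverse (norm z) = min 1 (inverse (norm z))"
      using that by (cases "norm z \<le> 1") (auto simp: min_def field_simps)
    ultimately show ?thesis by (simp add: divide_inverse mult_ac)
  qed
  have "AE z in lborel. min 1 (inverse (norm z)) * r z = min 1 (norm z) * norm (c z *\<^sub>R z)"
    using nz by eventually_elim (rule c_norm[symmetric])
  ultimately have "integrable lborel (\<lambda>z. min 1 (norm z) * norm (c z *\<^sub>R z))"
    by (subst integrable_cong_AE[where g="\<lambda>z. min 1 (inverse (norm z)) * r z"]) (auto elim!: eventually_mono)
  then have odd: "odd_levy_field (\<lambda>z. c z *\<^sub>R z)"
    by (simp add: odd_levy_field_def c_def r)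
  have c_eq: "AE z in lborel. c z * (norm z)\<^sup>2 = enn2real (\<rho> z)"
    using r_eq nz by eventually_elim (simp add: c_def)
  have "AE z in lborel. norm z < \<epsilon> \<longrightarrow> c z > 0"
    using r_eq nz
  proof eventually_elim
    case (elim z)
    show ?case
    proof
      assume "norm z < \<epsilon>"
      then have "\<rho> z > 0" using less_le_trans[OF \<epsilon>(2) INF_lower[of z "ball 0 \<epsilon>" \<rho>]] by simp
      then have "r z > 0" using elim fin[of z] by (simp add: enn2real_positive_iff)
      then show "c z > 0" using elim by (simp add: c_def)
    qed
  qed
  then show thesis
    using that[of c] odd c_eq r \<epsilon>(1) unfolding kernel_factor_def by (auto simp: c_def)
qed

lemma nonlocal_div_eq_div_field:
  fixes \<rho> :: "'a::euclidean_space \<Rightarrow> ennreal"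
  assumes c: "kernel_factor \<rho> c" and [measurable]: "\<Phi> \<in> borel_measurable borel"
  shows "nonlocal_div \<rho> \<Phi> x = div_field (\<lambda>z. c z *\<^sub>R z) \<Phi> x"
proof -
  have [measurable]: "c \<in> borel_measurable borel" using c by (simp add: kernel_factor_def)
  have "AE z in lborel. c z * (norm z)\<^sup>2 = enn2real (\<rho> z)" using c by (simp add: kernel_factor_def)
  then have AE: "AE y in lborel. c (x - y) * (norm (x - y))\<^sup>2 = enn2real (\<rho> (x - y))" by (rule AE_reflect)
  have "nonlocal_div \<rho> \<Phi> x = (\<integral>y. (\<Phi> x - \<Phi> y) \<bullet> (c (x - y) *\<^sub>R (x - y)) \<partial>lborel)"
    unfolding nonlocal_div_def
  proof (rule integral_lebesgue_AE_eq)
    show "AE y in lborel. (((\<Phi> x - \<Phi> y) /\<^sub>R norm (x - y)) \<bullet> ((x - y) /\<^sub>R norm (x - y))) * enn2real (\<rho> (x - y))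
        = (\<Phi> x - \<Phi> y) \<bullet> (c (x - y) *\<^sub>R (x - y))"
      using AE
    proof eventually_elim
      case (elim y)
      show ?case
      proof (cases "x = y")
        case False
        then have "inverse (norm (x - y)) * (inverse (norm (x - y)) * I) * (c (x - y) * (norm (x - y))\<^sup>2) = c (x - y) * I" for I
          by (simp add: power2_eq_square field_simps)
        then show ?thesis unfolding elim[symmetric] inner_scaleR_left inner_scaleR_right by simp
      qed simp
    qed
  qed measurable
  also have "\<dots> = div_field (\<lambda>z. c z *\<^sub>R z) \<Phi> x"
    unfolding div_field_def
    using integral_reflect[of "\<lambda>z. (\<Phi> x - \<Phi> (x - z)) \<bullet> (c z *\<^sub>R z)" x] by simp
  finally show ?thesis .
qed

lemma represents_iff_weak_grad:
  fixes u :: "'a::euclidean_space \<Rightarrow> real"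
  assumes c: "kernel_factor \<rho> c"
    and u[measurable]: "u' \<in> borel_measurable borel" and AE_u: "AE x in lborel. u x = u' x"
    and g[measurable]: "g' \<in> borel_measurable borel" and AE_g: "AE x in lborel. g x = g' x"
  shows "represents g (weak_nonlocal_grad \<rho> u) \<longleftrightarrow> weak_grad (\<lambda>z. c z *\<^sub>R z) u' g'"
proof -
  have [measurable]: "c \<in> borel_measurable borel" using c by (simp add: kernel_factor_def)
  have "weak_nonlocal_grad \<rho> u \<Phi> = - (\<integral>x. u' x * div_field (\<lambda>z. c z *\<^sub>R z) \<Phi> x \<partial>lborel)"
    and "(\<integral>x. g x \<bullet> \<Phi> x \<partial>lebesgue) = (\<integral>x. g' x \<bullet> \<Phi> x \<partial>lborel)" if \<Phi>: "\<Phi> \<in> test_fields" for \<Phi>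
  proof -
    have [measurable]: "\<Phi> \<in> borel_measurable borel" using test_field_measurable[OF \<Phi>] .
    have [measurable]: "div_field (\<lambda>z. c z *\<^sub>R z) \<Phi> \<in> borel_measurable borel"
      by (rule div_field_measurable) measurable
    show "weak_nonlocal_grad \<rho> u \<Phi> = - (\<integral>x. u' x * div_field (\<lambda>z. c z *\<^sub>R z) \<Phi> x \<partial>lborel)"
      unfolding weak_nonlocal_grad_def nonlocal_div_eq_div_field[OF c test_field_measurable[OF \<Phi>]]
      by (subst integral_lebesgue_AE_eq[where f'="\<lambda>x. u' x * div_field (\<lambda>z. c z *\<^sub>R z) \<Phi> x"])
        (use AE_u in \<open>auto elim!: eventually_mono\<close>)
    show "(\<integral>x. g x \<bullet> \<Phi> x \<partial>lebesgue) = (\<integral>x. g' x \<bullet> \<Phi> x \<partial>lborel)"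
      by (rule integral_lebesgue_AE_eq) (use AE_g in \<open>auto elim!: eventually_mono\<close>)
  qed
  then show ?thesis by (simp add: represents_def weak_grad_def)
qed

text \<open>The gradient chosen by \<open>nonlocal_grad\<close> agrees almost everywhere with any other gradient in \<open>L\<^sup>p\<close>, by uniqueness,
  so its norm can be computed from \<open>g'\<close>.\<close>

lemma H_space_I:
  fixes u :: "'a::euclidean_space \<Rightarrow> real"
  assumes c: "kernel_factor \<rho> c" and p: "1 \<le> p"
    and u: "AE x in lborel. u x = u' x" "u' \<in> Lp_space lborel p"
    and g: "g' \<in> Lp_space lborel p" "weak_grad (\<lambda>z. c z *\<^sub>R z) u' g'"
  shows "u \<in> H_space \<rho> p" and "Lp_norm lebesgue p u = Lp_norm lborel p u'"
    and "Lp_norm lebesgue p (nonlocal_grad \<rho> p u) = Lp_norm lborel p g'"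
proof -
  have [measurable]: "u' \<in> borel_measurable borel" "g' \<in> borel_measurable borel"
    using u g by (auto dest: Lp_spaceD_measurable)
  have "g' \<in> Lp_space lebesgue p" using Lp_transfer(1)[of g' g' p] g by simp
  moreover have rep: "represents g' (weak_nonlocal_grad \<rho> u)"
    using represents_iff_weak_grad[OF c _ u(1), of g' g'] g by simp
  ultimately have ex: "\<exists>g. g \<in> Lp_space lebesgue p \<and> represents g (weak_nonlocal_grad \<rho> u)" by blast
  then show "u \<in> H_space \<rho> p"
    using Lp_transfer(1)[OF _ u(1)] u(2) by (auto simp: H_space_def)
  show "Lp_norm lebesgue p u = Lp_norm lborel p u'" using Lp_transfer(2)[OF _ u(1)] by simp
  define G where "G = nonlocal_grad \<rho> p u"
  have G: "G \<in> Lp_space lebesgue p" "represents G (weak_nonlocal_grad \<rho> u)"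
    using someI_ex[OF ex] by (auto simp: G_def nonlocal_grad_def)
  obtain G' where [measurable]: "G' \<in> borel_measurable borel" and G': "AE x in lborel. G x = G' x"
    using borel_version[OF Lp_spaceD_measurable[OF G(1)]] by blast
  have "G' \<in> Lp_space lborel p" using Lp_transfer(1)[OF _ G'] G(1) by simp
  moreover have "weak_grad (\<lambda>z. c z *\<^sub>R z) u' G'"
    using represents_iff_weak_grad[OF c _ u(1) _ G'] G(2) by simp
  ultimately have "AE x in lborel. G' x = g' x" using g p by (rule weak_grad_unique)
  with G' have "AE x in lborel. G x = g' x" by eventually_elim simp
  then show "Lp_norm lebesgue p (nonlocal_grad \<rho> p u) = Lp_norm lborel p g'"
    unfolding G_def[symmetric] by (intro Lp_transfer(2)) auto
qed

lemma H_space_E: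
  fixes u :: "'a::euclidean_space \<Rightarrow> real"
  assumes c: "kernel_factor \<rho> c" and p: "1 \<le> p" and u: "u \<in> H_space \<rho> p"
  obtains u' g' where "AE x in lborel. u x = u' x" "u' \<in> Lp_space lborel p"
    "g' \<in> Lp_space lborel p" "weak_grad (\<lambda>z. c z *\<^sub>R z) u' g'"
proof -
  obtain g where ul: "u \<in> Lp_space lebesgue p" and g: "g \<in> Lp_space lebesgue p" "represents g (weak_nonlocal_grad \<rho> u)"
    using u by (auto simp: H_space_def)
  obtain u' where u': "u' \<in> borel_measurable borel" "AE x in lborel. u x = u' x"
    using borel_version[OF Lp_spaceD_measurable[OF ul]] by blast
  obtain g' where g': "g' \<in> borel_measurable borel" "AE x in lborel. g x = g' x"
    using borel_version[OF Lp_spaceD_measurable[OF g(1)]] by blast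
  show thesis
    using that[OF u'(2)] Lp_transfer(1)[OF u'] ul Lp_transfer(1)[OF g'] g
      represents_iff_weak_grad[OF c u' g'] by blast
qed

lemma kernel_factor_diff_integrable:
  fixes \<rho>1 \<rho>2 :: "'a::euclidean_space \<Rightarrow> ennreal"
  assumes c1: "kernel_factor \<rho>1 c1" and c2: "kernel_factor \<rho>2 c2"
    and diff: "integrable lebesgue (\<lambda>x. (enn2real (\<rho>1 x) - enn2real (\<rho>2 x)) / norm x)"
  shows "integrable lborel (\<lambda>z. c1 z *\<^sub>R z - c2 z *\<^sub>R z)"
proof -
  have [measurable]: "c1 \<in> borel_measurable borel" "c2 \<in> borel_measurable borel"
    using c1 c2 by (auto simp: kernel_factor_def)
  have "AE z in lborel. c1 z * (norm z)\<^sup>2 = enn2real (\<rho>1 z)" "AE z in lborel. c2 z * (norm z)\<^sup>2 = enn2real (\<rho>2 z)"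
    using c1 c2 by (auto simp: kernel_factor_def)
  then have "AE z in lborel. (enn2real (\<rho>1 z) - enn2real (\<rho>2 z)) / norm z = (c1 z - c2 z) * norm z"
  proof eventually_elim
    case (elim z)
    show ?case by (cases "z = 0") (simp_all add: elim[symmetric] power2_eq_square field_simps)
  qed
  with diff have "integrable lborel (\<lambda>z. (c1 z - c2 z) * norm z)"
    by (subst (asm) integrable_lebesgue_AE_eq) auto
  then show ?thesis
    by (rule Bochner_Integration.integrable_bound) (auto simp: abs_mult simp flip: scaleR_diff_left)
qed

section \<open>Comparison of the spaces of the two kernels\<close>

lemma H_space_change_kernel:
  fixes \<rho>1 \<rho>2 :: "'a::euclidean_space \<Rightarrow> ennreal"
  assumes c1: "kernel_factor \<rho>1 c1" and c2: "kernel_factor \<rho>2 c2"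
    and k: "integrable lborel (\<lambda>z. c1 z *\<^sub>R z - c2 z *\<^sub>R z)" and p: "1 \<le> p"
  shows "H_space \<rho>1 p \<subseteq> H_space \<rho>2 p"
    and "\<exists>C>0. \<forall>u\<in>H_space \<rho>1 p. H_norm \<rho>2 p u \<le> C * H_norm \<rho>1 p u"
proof -
  define k' where "k' z = c1 z *\<^sub>R z - c2 z *\<^sub>R z" for z
  have k': "integrable lborel k'" using k by (simp add: k'_def[abs_def])
  define A where "A = (\<integral>z. norm (k' z) \<partial>lborel) + 1"
  have A: "(\<integral>z. norm (k' z) \<partial>lborel) \<le> A" "A > 0" by (auto simp: A_def add_nonneg_pos)
  have odd: "odd_levy_field (\<lambda>z. c1 z *\<^sub>R z)" "odd_levy_field (\<lambda>z. c2 z *\<^sub>R z)"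
    using c1 c2 by (auto simp: kernel_factor_def)
  have core: "\<exists>u' g'. u' \<in> Lp_space lborel p \<and> g' \<in> Lp_space lborel p \<and>
      (\<lambda>y. g' y - correlation u' k' y) \<in> Lp_space lborel p \<and> u \<in> H_space \<rho>2 p \<and>
      Lp_norm lebesgue p u = Lp_norm lborel p u' \<and>
      Lp_norm lebesgue p (nonlocal_grad \<rho>1 p u) = Lp_norm lborel p g' \<and>
      Lp_norm lebesgue p (nonlocal_grad \<rho>2 p u) = Lp_norm lborel p (\<lambda>y. g' y - correlation u' k' y)"
    if u: "u \<in> H_space \<rho>1 p" for u
  proof -
    obtain u' g' where u': "AE x in lborel. u x = u' x" "u' \<in> Lp_space lborel p"
      and g': "g' \<in> Lp_space lborel p" "weak_grad (\<lambda>z. c1 z *\<^sub>R z) u' g'"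
      using H_space_E[OF c1 p u] by blast
    have d: "(\<lambda>y. g' y - correlation u' k' y) \<in> Lp_space lborel p"
      by (rule Lp_space_diff[OF g'(1) correlation_Lp[OF u'(2) p k'] p])
    have wd: "weak_grad (\<lambda>z. c2 z *\<^sub>R z) u' (\<lambda>y. g' y - correlation u' k' y)"
      using weak_grad_change_kernel[OF odd k u'(2) p g'] by (simp add: k'_def[abs_def])
    show ?thesis
      using u'(2) g'(1) d H_space_I[OF c2 p u' d wd] H_space_I(3)[OF c1 p u' g'] by blast
  qed
  then show "H_space \<rho>1 p \<subseteq> H_space \<rho>2 p" by blast
  show "\<exists>C>0. \<forall>u\<in>H_space \<rho>1 p. H_norm \<rho>2 p u \<le> C * H_norm \<rho>1 p u"
  proof (cases "p = \<infinity>")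
    case True
    show ?thesis
    proof (intro exI[of _ "2 + A"] conjI ballI)
      show "2 + A > 0" using A by simp
      fix u assume "u \<in> H_space \<rho>1 p"
      then obtain u' g' where Lp: "u' \<in> Lp_space lborel p" "g' \<in> Lp_space lborel p"
        and n: "Lp_norm lebesgue p u = Lp_norm lborel p u'"
        "Lp_norm lebesgue p (nonlocal_grad \<rho>1 p u) = Lp_norm lborel p g'"
        "Lp_norm lebesgue p (nonlocal_grad \<rho>2 p u) = Lp_norm lborel p (\<lambda>y. g' y - correlation u' k' y)"
        using core by blast
      have [measurable]: "u' \<in> borel_measurable borel" "g' \<in> borel_measurable borel" "k' \<in> borel_measurable borel"
        using Lp k' by (auto dest: Lp_spaceD_measurable)
      define U G where "U = Lp_norm lborel p u'" and "G = Lp_norm lborel p g'"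
      obtain B where "B \<ge> 0" "B = U" "AE x in lborel. norm (u' x) \<le> B"
        using Lp_space_infinityE[OF Lp(1)[unfolded True]] unfolding U_def True by blast
      then have U: "U \<ge> 0" "AE x in lborel. \<bar>u' x\<bar> \<le> U" by simp_all
      obtain B where "B \<ge> 0" "B = G" "AE x in lborel. norm (g' x) \<le> B"
        using Lp_space_infinityE[OF Lp(2)[unfolded True]] unfolding G_def True by blast
      then have G: "G \<ge> 0" "AE x in lborel. norm (g' x) \<le> G" by simp_all
      have "Lp_norm lborel \<infinity> (\<lambda>y. g' y - correlation u' k' y) \<le> G + A * U"
      proof (rule Lp_space_infinityI(2))
        show "AE y in lborel. norm (g' y - correlation u' k' y) \<le> G + A * U"
          using G(2)
        proof eventually_elim
          case (elim y)
          have "norm (correlation u' k' y) \<le> A * U"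
            using Young_infinity[OF _ U(2) k', of y] mult_right_mono[OF A(1) U(1)] by simp
          then show ?case using norm_triangle_ineq4[of "g' y" "correlation u' k' y"] elim by linarith
        qed
      qed (use G U A in auto)
      then have "max U (Lp_norm lborel p (\<lambda>y. g' y - correlation u' k' y)) \<le> max U (G + A * U)"
        using True by auto
      also have "\<dots> \<le> (2 + A) * max U G"
      proof -
        have "A * U \<le> A * max U G" using A by (intro mult_left_mono) auto
        moreover have "0 \<le> A * max U G" using A U by (intro mult_nonneg_nonneg) auto
        moreover have "0 \<le> max U G" using U by simp
        ultimately show ?thesis by (auto simp: distrib_right)
      qed
      finally show "H_norm \<rho>2 p u \<le> (2 + A) * H_norm \<rho>1 p u"
        using True unfolding H_norm_def n U_def G_def by simp
    qed
  next
    case False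
    define q where "q = enn2real p"
    have q: "q \<ge> 1" "p = ennreal q" using one_le_enn2real[OF p False] False by (simp_all add: q_def ennreal_enn2real_if)
    define K where "K = 1 + 2 powr q * (1 + (2 * A) powr q)"
    have K: "K \<ge> 1" "K > 0" by (simp_all add: K_def add_pos_nonneg)
    show ?thesis
    proof (intro exI[of _ "K powr (1 / q)"] conjI ballI)
      show "K powr (1 / q) > 0" using K by simp
      fix u assume "u \<in> H_space \<rho>1 p"
      then obtain u' g' where Lp: "u' \<in> Lp_space lborel p" "g' \<in> Lp_space lborel p"
        and n: "Lp_norm lebesgue p u = Lp_norm lborel p u'"
        "Lp_norm lebesgue p (nonlocal_grad \<rho>1 p u) = Lp_norm lborel p g'"
        "Lp_norm lebesgue p (nonlocal_grad \<rho>2 p u) = Lp_norm lborel p (\<lambda>y. g' y - correlation u' k' y)"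
        using core by blast
      have [measurable]: "u' \<in> borel_measurable borel" "g' \<in> borel_measurable borel" "k' \<in> borel_measurable borel"
        using Lp k' by (auto dest: Lp_spaceD_measurable)
      have uq: "integrable lborel (\<lambda>x. \<bar>u' x\<bar> powr q)" and gq: "integrable lborel (\<lambda>x. norm (g' x) powr q)"
        using Lp unfolding q(2) by (simp_all add: Lp_space_ennreal[OF q(1)])
      define X G G2 where "X = (\<integral>x. \<bar>u' x\<bar> powr q \<partial>lborel)" and "G = (\<integral>x. norm (g' x) powr q \<partial>lborel)"
        and "G2 = (\<integral>y. norm (g' y - correlation u' k' y) powr q \<partial>lborel)"
      have nonneg: "X \<ge> 0" "G \<ge> 0" "G2 \<ge> 0" by (simp_all add: X_def G_def G2_def)
      have norms: "Lp_norm lborel p u' powr q = X" "Lp_norm lborel p g' powr q = G"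
        "Lp_norm lborel p (\<lambda>y. g' y - correlation u' k' y) powr q = G2"
        using False q nonneg unfolding Lp_norm_def q_def[symmetric] by (simp_all add: powr_powr X_def G_def G2_def)
      note Y = Young[OF _ uq q(1) k' A]
      have "G2 \<le> 2 powr q * (G + (\<integral>y. norm (correlation u' k' y) powr q \<partial>lborel))"
        unfolding G2_def G_def by (rule powr_diff_integral_le(2)) (use q gq Y(2) in auto)
      also have "\<dots> \<le> 2 powr q * (G + (2 * A) powr q * X)"
        using Y(3) by (intro mult_left_mono add_left_mono) (auto simp: X_def)
      finally have "X + G2 \<le> X + 2 powr q * (G + (2 * A) powr q * X)" by simp
      also have "\<dots> \<le> K * (X + G)"
        using nonneg by (simp add: K_def algebra_simps)
      finally have "(X + G2) powr (1 / q) \<le> (K * (X + G)) powr (1 / q)"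
        using nonneg q by (intro powr_mono2) auto
      also have "\<dots> = K powr (1 / q) * (X + G) powr (1 / q)"
        using nonneg K by (simp add: powr_mult)
      finally show "H_norm \<rho>2 p u \<le> K powr (1 / q) * H_norm \<rho>1 p u"
        using False by (simp add: H_norm_def n q_def[symmetric] norms)
    qed
  qed
qed

lemma Lp_norm_restrict:
  fixes u :: "'a::euclidean_space \<Rightarrow> real"
  assumes \<Omega>: "open \<Omega>" and u: "AE x in lborel. u x = u' x" and u': "u' \<in> Lp_space lborel (ennreal q)" "\<And>x. x \<notin> \<Omega> \<Longrightarrow> u' x = 0"
    and q: "q \<ge> 1"
  shows "Lp_norm (lebesgue_on \<Omega>) (ennreal q) u = (\<integral>x. \<bar>u' x\<bar> powr q \<partial>lborel) powr (1 / q)"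
proof -
  have [measurable]: "u' \<in> borel_measurable borel" using u' by (auto dest: Lp_spaceD_measurable)
  have "(\<integral>x. norm (u x) powr q \<partial>lebesgue_on \<Omega>) = (\<integral>x. indicator \<Omega> x *\<^sub>R (norm (u x) powr q) \<partial>lebesgue)"
    using \<Omega> by (intro integral_restrict_space) auto
  also have "\<dots> = (\<integral>x. \<bar>u' x\<bar> powr q \<partial>lborel)"
  proof (rule integral_lebesgue_AE_eq)
    show "AE x in lborel. indicator \<Omega> x *\<^sub>R (norm (u x) powr q) = \<bar>u' x\<bar> powr q"
      using u
    proof eventually_elim
      case (elim x)
      then show ?case using u'(2)[of x] q by (cases "x \<in> \<Omega>") auto
    qed
  qed measurable
  finally show ?thesis using q by (simp add: Lp_norm_def)
qed

text \<open>In one direction, functions in \<open>H0_space\<close> vanish only almost everywhere outside \<open>\<Omega>\<close>; multiplying a Borel version by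
  the indicator of the open set \<open>\<Omega>\<close> makes it vanish everywhere there.\<close>

lemma poincare_on_iff:
  fixes \<rho> :: "'a::euclidean_space \<Rightarrow> ennreal"
  assumes c: "kernel_factor \<rho> c" and q: "q \<ge> 1" and \<Omega>: "open \<Omega>" and C: "C \<ge> 0"
  shows "(\<forall>u\<in>H0_space \<rho> (ennreal q) \<Omega>. Lp_norm (lebesgue_on \<Omega>) (ennreal q) u
        \<le> C * Lp_norm lebesgue (ennreal q) (nonlocal_grad \<rho> (ennreal q) u))
    \<longleftrightarrow> poincare_on (\<lambda>z. c z *\<^sub>R z) q \<Omega> (C powr q)"
proof -
  let ?p = "ennreal q"
  have p1: "1 \<le> ?p" using q by simp
  have norm_eq: "Lp_norm lborel ?p g = (\<integral>x. norm (g x) powr q \<partial>lborel) powr (1 / q)" for g :: "'a \<Rightarrow> 'a"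
    using q by (simp add: Lp_norm_def)
  have root: "X powr (1 / q) \<le> C * G powr (1 / q) \<longleftrightarrow> X \<le> C powr q * G" if "X \<ge> 0" "G \<ge> 0" for X G :: real
  proof -
    have "C * G powr (1 / q) = (C powr q * G) powr (1 / q)"
      using C q that by (simp add: powr_mult powr_powr)
    moreover have "X powr (1 / q) \<le> Y powr (1 / q) \<longleftrightarrow> X \<le> Y" if "Y \<ge> 0" for Y
      using powr_mono2[of "1 / q" X Y] powr_less_mono2[of "1 / q" Y X] q \<open>X \<ge> 0\<close> that
      by (cases "X \<le> Y") auto
    ultimately show ?thesis using that by simp
  qed
  show ?thesis
  proof
    assume P: "\<forall>u\<in>H0_space \<rho> ?p \<Omega>. Lp_norm (lebesgue_on \<Omega>) ?p u \<le> C * Lp_norm lebesgue ?p (nonlocal_grad \<rho> ?p u)"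
    show "poincare_on (\<lambda>z. c z *\<^sub>R z) q \<Omega> (C powr q)"
      unfolding poincare_on_def
    proof (intro allI impI, elim conjE)
      fix u g assume u: "u \<in> Lp_space lborel ?p" "\<forall>x. x \<notin> \<Omega> \<longrightarrow> u x = 0"
        and g: "g \<in> Lp_space lborel ?p" "weak_grad (\<lambda>z. c z *\<^sub>R z) u g"
      have AEu: "AE x in lborel. u x = u x" by simp
      have "u \<in> H0_space \<rho> ?p \<Omega>"
        using H_space_I(1)[OF c p1 AEu u(1) g] u(2) by (simp add: H0_space_def)
      then have "Lp_norm (lebesgue_on \<Omega>) ?p u \<le> C * Lp_norm lebesgue ?p (nonlocal_grad \<rho> ?p u)" using P by blast
      then show "(\<integral>x. \<bar>u x\<bar> powr q \<partial>lborel) \<le> C powr q * (\<integral>x. norm (g x) powr q \<partial>lborel)"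
        using Lp_norm_restrict[OF \<Omega> AEu u(1) _ q] u(2) H_space_I(3)[OF c p1 AEu u(1) g]
        by (simp add: norm_eq root)
    qed
  next
    assume P: "poincare_on (\<lambda>z. c z *\<^sub>R z) q \<Omega> (C powr q)"
    show "\<forall>u\<in>H0_space \<rho> ?p \<Omega>. Lp_norm (lebesgue_on \<Omega>) ?p u \<le> C * Lp_norm lebesgue ?p (nonlocal_grad \<rho> ?p u)"
    proof
      fix u assume u: "u \<in> H0_space \<rho> ?p \<Omega>"
      then have "u \<in> H_space \<rho> ?p" by (simp add: H0_space_def)
      then obtain v g where v: "AE x in lborel. u x = v x" "v \<in> Lp_space lborel ?p"
        and g: "g \<in> Lp_space lborel ?p" "weak_grad (\<lambda>z. c z *\<^sub>R z) v g"
        using H_space_E[OF c p1] by blast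
      have [measurable]: "v \<in> borel_measurable borel" using v by (auto dest: Lp_spaceD_measurable)
      have [measurable]: "\<Omega> \<in> sets borel" using \<Omega> by simp
      define w where "w x = indicator \<Omega> x * v x" for x
      have [measurable]: "w \<in> borel_measurable borel" unfolding w_def[abs_def] by measurable
      have "AE x in lborel. x \<notin> \<Omega> \<longrightarrow> u x = 0" using u by (simp add: H0_space_def AE_completion_iff)
      with v(1) have vw: "AE x in lborel. v x = w x"
        by eventually_elim (auto simp: w_def indicator_def)
      with v(1) have uw: "AE x in lborel. u x = w x" by eventually_elim simp
      have w: "w \<in> Lp_space lborel ?p"
        using v(2) Lp_transfer(1)[of v v ?p] Lp_transfer(1)[OF _ vw, of ?p] by simp
      have wg: "weak_grad (\<lambda>z. c z *\<^sub>R z) w g"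
        unfolding weak_grad_def
      proof
        fix \<Phi> :: "'a \<Rightarrow> 'a" assume \<Phi>: "\<Phi> \<in> test_fields"
        have [measurable]: "div_field (\<lambda>z. c z *\<^sub>R z) \<Phi> \<in> borel_measurable borel"
          using c by (intro div_field_measurable test_field_measurable[OF \<Phi>] odd_levy_field_measurable)
            (simp add: kernel_factor_def)
        have "(\<integral>x. w x * div_field (\<lambda>z. c z *\<^sub>R z) \<Phi> x \<partial>lborel) = (\<integral>x. v x * div_field (\<lambda>z. c z *\<^sub>R z) \<Phi> x \<partial>lborel)"
          by (rule integral_cong_AE) (use vw in \<open>auto elim!: eventually_mono\<close>)
        then show "- (\<integral>x. w x * div_field (\<lambda>z. c z *\<^sub>R z) \<Phi> x \<partial>lborel) = (\<integral>x. g x \<bullet> \<Phi> x \<partial>lborel)"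
          using bspec[OF g(2)[unfolded weak_grad_def] \<Phi>] by simp
      qed
      have w0: "x \<notin> \<Omega> \<Longrightarrow> w x = 0" for x by (simp add: w_def)
      have "(\<integral>x. \<bar>w x\<bar> powr q \<partial>lborel) \<le> C powr q * (\<integral>x. norm (g x) powr q \<partial>lborel)"
        using P w w0 g(1) wg unfolding poincare_on_def by blast
      then show "Lp_norm (lebesgue_on \<Omega>) ?p u \<le> C * Lp_norm lebesgue ?p (nonlocal_grad \<rho> ?p u)"
        using Lp_norm_restrict[OF \<Omega> uw w w0 q] H_space_I(3)[OF c p1 uw w g(1) wg]
        by (simp add: norm_eq root)
    qed
  qed
qed

theorem proposition3p10:
  fixes \<rho>1 \<rho>2 :: "real ^ 'n \<Rightarrow> ennreal" and \<Omega> :: "(real ^ 'n) set"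
  assumes "open \<Omega>"
    and "admissible_kernel \<rho>1" and "admissible_kernel \<rho>2"
    and "integrable lebesgue (\<lambda>x. (enn2real (\<rho>1 x) - enn2real (\<rho>2 x)) / norm x)"
  shows "(\<forall>p::ennreal. 1 \<le> p \<longrightarrow>
            H0_space \<rho>1 p \<Omega> = H0_space \<rho>2 p \<Omega> \<and>
            equivalent_norms_on (H0_space \<rho>1 p \<Omega>) (H_norm \<rho>1 p) (H_norm \<rho>2 p)) \<and>
         (\<forall>p::ennreal. 1 < p \<and> p < \<infinity> \<and> bounded \<Omega> \<longrightarrow>
            (\<exists>C1>0. \<forall>u\<in>H0_space \<rho>1 p \<Omega>.
               Lp_norm (lebesgue_on \<Omega>) p u \<le> C1 * Lp_norm lebesgue p (nonlocal_grad \<rho>1 p u)) \<longrightarrow>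
            (\<exists>C2>0. \<forall>u\<in>H0_space \<rho>2 p \<Omega>.
               Lp_norm (lebesgue_on \<Omega>) p u \<le> C2 * Lp_norm lebesgue p (nonlocal_grad \<rho>2 p u)))"
proof -
  obtain c1 where c1: "kernel_factor \<rho>1 c1" using admissible_kernel_factor[OF assms(2)] .
  obtain c2 where c2: "kernel_factor \<rho>2 c2" using admissible_kernel_factor[OF assms(3)] .
  have k12: "integrable lborel (\<lambda>z. c1 z *\<^sub>R z - c2 z *\<^sub>R z)"
    by (rule kernel_factor_diff_integrable[OF c1 c2 assms(4)])
  then have k21: "integrable lborel (\<lambda>z. c2 z *\<^sub>R z - c1 z *\<^sub>R z)"
    by (subst minus_diff_eq[symmetric]) (rule Bochner_Integration.integrable_minus)
  show ?thesis
  proof (intro conjI allI impI)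
    fix p :: ennreal assume p: "1 \<le> p"
    have eq: "H_space \<rho>1 p = H_space \<rho>2 p"
      using H_space_change_kernel(1)[OF c1 c2 k12 p] H_space_change_kernel(1)[OF c2 c1 k21 p] by blast
    then show "H0_space \<rho>1 p \<Omega> = H0_space \<rho>2 p \<Omega>" by (simp add: H0_space_def)
    obtain C where C: "C > 0" "\<And>u. u \<in> H_space \<rho>1 p \<Longrightarrow> H_norm \<rho>2 p u \<le> C * H_norm \<rho>1 p u"
      using H_space_change_kernel(2)[OF c1 c2 k12 p] by blast
    obtain D where D: "D > 0" "\<And>u. u \<in> H_space \<rho>2 p \<Longrightarrow> H_norm \<rho>1 p u \<le> D * H_norm \<rho>2 p u"
      using H_space_change_kernel(2)[OF c2 c1 k21 p] by blast
    have "inverse D * H_norm \<rho>1 p u \<le> H_norm \<rho>2 p u \<and> H_norm \<rho>2 p u \<le> C * H_norm \<rho>1 p u"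
      if "u \<in> H0_space \<rho>1 p \<Omega>" for u
    proof -
      have u: "u \<in> H_space \<rho>1 p" using that by (simp add: H0_space_def)
      then show ?thesis using C(2)[OF u] D(2)[of u] D(1) eq by (simp add: field_simps)
    qed
    then show "equivalent_norms_on (H0_space \<rho>1 p \<Omega>) (H_norm \<rho>1 p) (H_norm \<rho>2 p)"
      unfolding equivalent_norms_on_def using C(1) D(1)
      by (intro exI[of _ "inverse D"] exI[of _ C]) auto
  next
    fix p :: ennreal
    assume p: "1 < p \<and> p < \<infinity> \<and> bounded \<Omega>"
      and "\<exists>C1>0. \<forall>u\<in>H0_space \<rho>1 p \<Omega>.
         Lp_norm (lebesgue_on \<Omega>) p u \<le> C1 * Lp_norm lebesgue p (nonlocal_grad \<rho>1 p u)"
    then obtain C1 where C1: "C1 > 0" "\<forall>u\<in>H0_space \<rho>1 p \<Omega>.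
         Lp_norm (lebesgue_on \<Omega>) p u \<le> C1 * Lp_norm lebesgue p (nonlocal_grad \<rho>1 p u)" by blast
    define q where "q = enn2real p"
    have q: "q \<ge> 1" "p = ennreal q"
      using one_le_enn2real[of p] p by (auto simp: q_def ennreal_enn2real_if)
    have P1: "poincare_on (\<lambda>z. c1 z *\<^sub>R z) q \<Omega> (C1 powr q)"
      using poincare_on_iff[OF c1 q(1) assms(1), of C1] C1 unfolding q(2) by simp
    obtain R where R: "R > 0" "\<Omega> \<subseteq> cball 0 R"
      using p bounded_subset_ballD[of \<Omega> 0] ball_subset_cball by blast
    obtain \<epsilon> where \<epsilon>: "\<epsilon> > 0" "AE z in lborel. norm z < \<epsilon> \<longrightarrow> c2 z > 0"
      using c2 by (auto simp: kernel_factor_def)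
    obtain n :: nat where n: "poincare_on (\<lambda>z. c2 z *\<^sub>R z) q \<Omega> (real (Suc n))"
      using poincare_change_kernel[OF _ _ k21 refl _ \<epsilon> q(1) _ R P1] c1 c2 by (auto simp: kernel_factor_def)
    define C2 where "C2 = real (Suc n) powr (1 / q)"
    have C2: "C2 > 0" "C2 powr q = real (Suc n)" using q by (simp_all add: C2_def powr_powr)
    have "\<forall>u\<in>H0_space \<rho>2 p \<Omega>. Lp_norm (lebesgue_on \<Omega>) p u \<le> C2 * Lp_norm lebesgue p (nonlocal_grad \<rho>2 p u)"
      using poincare_on_iff[OF c2 q(1) assms(1), of C2] C2 n unfolding q(2) by simp
    then show "\<exists>C2>0. \<forall>u\<in>H0_space \<rho>2 p \<Omega>.
         Lp_norm (lebesgue_on \<Omega>) p u \<le> C2 * Lp_norm lebesgue p (nonlocal_grad \<rho>2 p u)"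
      using C2(1) by blast
  qed
qed

end
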